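(* Fix any constants $\varepsilon,\delta>0$. For all integers $n\le m$ there is a one-sided $\varepsilon$-error randomized scheme with cached auxiliary word for storing subsets $A\subseteq\{1,\ldots,m\}$ with $|A|\le n$, in which the main storage $B$ is a bit string of length $n^{1+\delta}\mathrm{poly}(\log m)$ and the auxiliary word $C$ has length $\mathrm{poly}(\log m)$. Each membership query ``$x\in A$?'' is answered with two bit probes to $B$: for $x\in A$ the answer is always correct, and for each $x\notin A$ the probability of error is less than $\varepsilon$. The positions of the bits probed in $B$ are computed from $x$ and the auxiliary word $C$ (and the random coins) in time $\mathrm{poly}(\log m)$. Moreover, given $A$, the entire scheme (the string $B$ and the word $C$) can be computed by a probabilistic algorithm in expected time $\mathrm{poly}(n,\log m)$.
   Context: A randomized scheme with cached auxiliary word (for parameters $n,m$) assigns to each set $A\subseteq\{1,\ldots,m\}$ with $|A|\le n$ a pair $(C,B)$ of bit strings, where $C$ is a short ``cached'' word and $B$ is the main storage; both may depend on $A$. A query ``$x\in A$?'' for $x\in\{1,\ldots,m\}$ is answered by a randomized algorithm that may read all of $C$, uses $x$, $C$ and its coin tosses to choose positions in $B$, reads only those bits of $B$ (here two bit probes), and outputs ``yes'' or ``no'' based on $x$, $C$, its coins and the bits read. The scheme has one-sided error $\varepsilon$ if for every such $A$: for every $x\in A$ the answer is ``yes'' with probability $1$, and for every $x\notin A$ the answer is ``yes'' with probability less than $\varepsilon$. The constants in $\mathrm{poly}(\cdot)$ may depend on $\varepsilon,\delta$. *)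

theory Defs
  imports "HOL-Probability.SPMF" "HOL-Library.Log_Nat" "HOL-Computational_Algebra.Polynomial"
begin

section \<open>A probabilistic random access machine with logarithmic cost\<close>

text \<open>
  The machine is given as a structured language over a memory that consists of unbounded arrays of
  natural numbers. A program mentions finitely many arrays, addressed by constants; cells are
  addressed by computed values. Every number that an evaluation touches (constants, addresses,
  loaded values, intermediate and final results) is charged its binary length, so that running times
  agree with those of (multi-tape, probabilistic) Turing machines up to a polynomial, even though
  multiplication and division are primitive.
\<close>

type_synonym mem = "nat \<Rightarrow> nat \<Rightarrow> nat"

datatype bop = Plus | Minus | Times | Div | Mod | Less | Equal

datatype expr = Const nat | Load nat expr | Bin bop expr expr

datatype prog =
    Skip
  | Store nat expr expr
  | Toss nat expr
  | Seq prog prog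
  | Cond expr prog prog
  | While expr prog

fun bop_val :: "bop \<Rightarrow> nat \<Rightarrow> nat \<Rightarrow> nat" where
  "bop_val Plus u v = u + v"
| "bop_val Minus u v = u - v"
| "bop_val Times u v = u * v"
| "bop_val Div u v = u div v"
| "bop_val Mod u v = u mod v"
| "bop_val Less u v = of_bool (u < v)"
| "bop_val Equal u v = of_bool (u = v)"

primrec val :: "expr \<Rightarrow> mem \<Rightarrow> nat" where
  "val (Const v) s = v"
| "val (Load a e) s = s a (val e s)"
| "val (Bin f e1 e2) s = bop_val f (val e1 s) (val e2 s)"

text \<open>\<^term>\<open>floorlog 2 v\<close> is the number of binary digits of \<^term>\<open>v\<close>, and 0 for 0.\<close>

definition len :: "nat \<Rightarrow> nat" where
  "len v = Suc (floorlog 2 v)"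

text \<open>The operands and the address of a node are charged at the corresponding subexpressions.\<close>

primrec cost :: "expr \<Rightarrow> mem \<Rightarrow> nat" where
  "cost (Const v) s = len v"
| "cost (Load a e) s = cost e s + len (s a (val e s))"
| "cost (Bin f e1 e2) s = cost e1 s + cost e2 s + len (bop_val f (val e1 s) (val e2 s))"

definition upd :: "mem \<Rightarrow> nat \<Rightarrow> nat \<Rightarrow> nat \<Rightarrow> mem" where
  "upd s a i v = s(a := (s a)(i := v))"

definition add_time :: "nat \<Rightarrow> (mem \<times> nat) spmf \<Rightarrow> (mem \<times> nat) spmf" where
  "add_time k p = map_spmf (\<lambda>(s, t). (s, k + t)) p"

definition and_then :: "(mem \<times> nat) spmf \<Rightarrow> (mem \<Rightarrow> (mem \<times> nat) spmf) \<Rightarrow> (mem \<times> nat) spmf" where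
  "and_then p q = bind_spmf p (\<lambda>(s, t). add_time t (q s))"

lemma and_then_mono [partial_function_mono]:
  "mono_spmf (\<lambda>f. and_then p (\<lambda>s. add_time k (q f s)))"
  if "\<And>s. mono_spmf (\<lambda>f. q f s)"
  unfolding and_then_def add_time_def split_def
  by (intro bind_spmf_mono map_spmf_mono that spmf.const_mono)

partial_function (spmf) loop :: "expr \<Rightarrow> (mem \<Rightarrow> (mem \<times> nat) spmf) \<Rightarrow> mem \<Rightarrow> (mem \<times> nat) spmf" where
  "loop e body s =
     (if val e s = 0 then return_spmf (s, 1 + cost e s)
      else and_then (body s) (\<lambda>s'. add_time (1 + cost e s) (loop e body s')))"

text \<open>
  \<^term>\<open>exec c s\<close> is the joint subdistribution of final memory and running time; the missing mass is
  the probability of divergence. A toss writes one fair bit.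
\<close>

primrec exec :: "prog \<Rightarrow> mem \<Rightarrow> (mem \<times> nat) spmf" where
  "exec Skip s = return_spmf (s, 1)"
| "exec (Store a e1 e2) s = return_spmf (upd s a (val e1 s) (val e2 s), 1 + cost e1 s + cost e2 s)"
| "exec (Toss a e) s =
     map_spmf (\<lambda>b. (upd s a (val e s) (of_bool b), 1 + cost e s)) coin_spmf"
| "exec (Seq c1 c2) s = and_then (exec c1 s) (exec c2)"
| "exec (Cond e c1 c2) s =
     add_time (1 + cost e s) (if val e s = 0 then exec c2 s else exec c1 s)"
| "exec (While e c) s = loop e (exec c) s"

definition runs_within :: "prog \<Rightarrow> mem \<Rightarrow> real \<Rightarrow> bool" where
  "runs_within c s T \<longleftrightarrow>
     lossless_spmf (exec c s) \<and> (\<forall>(s', t) \<in> set_spmf (exec c s). real t \<le> T)"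

text \<open>Divergence counts as infinite running time.\<close>

definition expected_time :: "prog \<Rightarrow> mem \<Rightarrow> ennreal" where
  "expected_time c s =
     (\<integral>\<^sup>+ r. (case r of None \<Rightarrow> \<infinity> | Some (s', t) \<Rightarrow> of_nat t) \<partial>measure_pmf (exec c s))"


section \<open>Input and output\<close>

text \<open>A list is kept in an array with its length in cell 0 and its entries from cell 1 on.\<close>

definition list_array :: "nat list \<Rightarrow> nat \<Rightarrow> nat" where
  "list_array xs i = (case i of 0 \<Rightarrow> length xs | Suc j \<Rightarrow> if j < length xs then xs ! j else 0)"

definition bit_array :: "bool list \<Rightarrow> nat \<Rightarrow> nat" where
  "bit_array bs = list_array (map of_bool bs)"

definition array_bits :: "(nat \<Rightarrow> nat) \<Rightarrow> bool list" where
  "array_bits f = map (\<lambda>i. f (Suc i) \<noteq> 0) [0..<f 0]"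

definition input :: "(nat \<Rightarrow> nat) list \<Rightarrow> mem" where
  "input fs a = (if a < length fs then fs ! a else (\<lambda>_. 0))"


section \<open>Two-probe schemes with cached auxiliary word\<close>

text \<open>
  A query consists of two programs. The first one computes two (0-based) positions in \<^term>\<open>B\<close>
  from the parameters, \<^term>\<open>x\<close>, \<^term>\<open>C\<close> and coin tosses, and leaves them in cells 0 and 1 of
  array 0. The two bits found there then replace array 0, and the second program continues on this
  memory, thus sharing \<^term>\<open>x\<close>, \<^term>\<open>C\<close> and the earlier coins. Its answer is cell 0 of array 0.
\<close>

definition query_input :: "nat \<Rightarrow> nat \<Rightarrow> bool list \<Rightarrow> nat \<Rightarrow> mem" where
  "query_input n m C x = input [list_array [n, m, x], bit_array C]"

definition probe :: "bool list \<Rightarrow> mem \<Rightarrow> mem" where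
  "probe B s = s(0 := bit_array [B ! s 0 0, B ! s 0 1])"

definition query :: "prog \<Rightarrow> prog \<Rightarrow> nat \<Rightarrow> nat \<Rightarrow> bool list \<times> bool list \<Rightarrow> nat \<Rightarrow> bool spmf" where
  "query pos ans n m = (\<lambda>(C, B) x.
     bind_spmf (exec pos (query_input n m C x))
       (\<lambda>(s, _). map_spmf (\<lambda>(s', _). s' 0 0 \<noteq> 0) (exec ans (probe B s))))"

definition probes_valid :: "prog \<Rightarrow> nat \<Rightarrow> nat \<Rightarrow> bool list \<times> bool list \<Rightarrow> nat \<Rightarrow> bool" where
  "probes_valid pos n m = (\<lambda>(C, B) x.
     \<forall>(s, _) \<in> set_spmf (exec pos (query_input n m C x)). s 0 0 < length B \<and> s 0 1 < length B)"

definition storable :: "nat \<Rightarrow> nat \<Rightarrow> nat set set" where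
  "storable n m = {A. A \<subseteq> {1..m} \<and> card A \<le> n}"

definition one_sided_scheme ::
  "real \<Rightarrow> nat \<Rightarrow> nat \<Rightarrow> prog \<Rightarrow> prog \<Rightarrow> (nat set \<Rightarrow> bool list \<times> bool list) \<Rightarrow> bool" where
  "one_sided_scheme \<epsilon> n m pos ans store \<longleftrightarrow>
     (\<forall>A \<in> storable n m. \<forall>x \<in> {1..m}.
        probes_valid pos n m (store A) x \<and>
        lossless_spmf (query pos ans n m (store A) x) \<and>
        (x \<in> A \<longrightarrow> spmf (query pos ans n m (store A) x) True = 1) \<and>
        (x \<notin> A \<longrightarrow> spmf (query pos ans n m (store A) x) True < \<epsilon>))"

definition encoder_input :: "nat \<Rightarrow> nat \<Rightarrow> nat set \<Rightarrow> mem" where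
  "encoder_input n m A = input [list_array [n, m], list_array (sorted_list_of_set A)]"

text \<open>The possible results \<^term>\<open>(C, B)\<close>; \<^term>\<open>C\<close> is read off array 0 and \<^term>\<open>B\<close> off array 1.\<close>

definition encodings :: "prog \<Rightarrow> nat \<Rightarrow> nat \<Rightarrow> nat set \<Rightarrow> (bool list \<times> bool list) set" where
  "encodings enc n m A =
     (\<lambda>(s, _). (array_bits (s 0), array_bits (s 1))) ` set_spmf (exec enc (encoder_input n m A))"

definition poly2 :: "real poly poly \<Rightarrow> real \<Rightarrow> real \<Rightarrow> real" where
  "poly2 p x y = poly (poly p [:x:]) y"

end

theory Submission
  imports Defs "HOL-Computational_Algebra.Primes"
begin

text \<open>
  The cached word holds the seed of a hash function that spreads the stored set \<open>A\<close> over
  \<open>O(n powr (1 + 1 / D))\<close> buckets with at most \<open>D\<close> elements of \<open>A\<close> each. The main storage consists of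
  one table for each bucket and each of the first \<open>T = O(log m)\<close> primes \<open>p\<close>, in which the residues
  modulo \<open>p\<close> of the elements of the bucket are marked. A query takes the bucket of \<open>x\<close>, picks one of
  the primes at random and looks up the residue of \<open>x\<close>; this single probe is made twice. If \<open>x \<notin> A\<close>, it
  errs only if the prime divides \<open>x - a\<close> for one of the at most \<open>D\<close> elements \<open>a\<close> of the bucket, and
  each of these differences has at most \<open>log 2 m\<close> prime divisors. Although \<open>x\<close> ranges over the
  whole universe, the hash function only has to be good for \<open>A\<close>.

  The hash function reduces \<open>x\<close> modulo a prime \<open>q\<close> of size polynomial in \<open>n\<close> and \<open>log m\<close>, evaluates a
  polynomial of degree at most \<open>D\<close> over the field with \<open>q\<close> elements, and reduces the result modulo the number of
  buckets. As \<open>D\<close> is constant, there are only polynomially many seeds, so that a good one is found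
  by exhaustive search: the encoder tosses no coins, and it need not know whether \<open>q\<close> is prime, since
  it only counts the loads of the buckets. A good seed exists since, once \<open>q\<close> is injective on \<open>A\<close>, the values of
  the polynomial at \<open>D + 1\<close> elements of \<open>A\<close> determine it.
\<close>

section \<open>Running times of programs\<close>

text \<open>One fixed triple of programs has to serve all \<open>n\<close> and \<open>m\<close>, so
  every parameter is recomputed by the programs themselves. Exponents and degrees depend only on
  \<open>D\<close> and \<open>R\<close> and are unrolled into expressions; \<open>side n\<close> and
  \<open>trials m\<close> are powers of two, found by doubling. A power of two as the number of
  primes also lets fair coins select one of them exactly uniformly, without rejection and hence with
  a worst-case time bound. A single element of the bucket spoils less than a fraction
  \<open>1 / R\<close> of the primes, because \<open>m ^ R < 2 ^ trials m\<close> whereas a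
  difference is at most \<open>m\<close>. With \<open>D <= \<epsilon> * R\<close> the at most
  \<open>D\<close> elements together stay below \<open>\<epsilon>\<close>. Since the machine charges
  lengths, a time bound needs two ingredients: the number of loop iterations, and a common bound
  \<open>width m\<close> on the lengths of all numbers in memory. Loops are never nested; double
  loops are flattened, so that one rule for loops with loop-free bodies suffices.\<close>

primrec loopfree :: "prog \<Rightarrow> bool" where
  "loopfree Skip = True"
| "loopfree (Store a e1 e2) = True"
| "loopfree (Toss a e) = True"
| "loopfree (Seq c1 c2) = (loopfree c1 \<and> loopfree c2)"
| "loopfree (Cond e c1 c2) = (loopfree c1 \<and> loopfree c2)"
| "loopfree (While e c) = False"

text \<open>A toss is treated demonically: the postcondition must hold for both bits, which is what
  sure correctness and worst-case time require. \<open>While\<close> gets \<open>False\<close>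
  because loops always go through \<open>runs_while\<close>.\<close>

primrec wp :: "prog \<Rightarrow> (mem \<Rightarrow> bool) \<Rightarrow> mem \<Rightarrow> bool" where
  "wp Skip Q s = Q s"
| "wp (Store a e1 e2) Q s = Q (upd s a (val e1 s) (val e2 s))"
| "wp (Toss a e) Q s = (\<forall>b. Q (upd s a (val e s) (of_bool b)))"
| "wp (Seq c1 c2) Q s = wp c1 (wp c2 Q) s"
| "wp (Cond e c1 c2) Q s = (if val e s = 0 then wp c2 Q s else wp c1 Q s)"
| "wp (While e c) Q s = False"

text \<open>Worst-case time over the whole support, together with losslessness, yields
  \<open>runs_within\<close> and also bounds \<open>expected_time\<close>.\<close>

definition runs :: "prog \<Rightarrow> mem \<Rightarrow> nat \<Rightarrow> (mem \<Rightarrow> bool) \<Rightarrow> bool" where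
  "runs c s T Q \<longleftrightarrow> lossless_spmf (exec c s) \<and> (\<forall>(s', t) \<in> set_spmf (exec c s). t \<le> T \<and> Q s')"

lemma set_add_time: "set_spmf (add_time k p) = (\<lambda>(s, t). (s, k + t)) ` set_spmf p"
  by (simp add: add_time_def)

lemma lossless_add_time [simp]: "lossless_spmf (add_time k p) = lossless_spmf p"
  by (simp add: add_time_def)

lemma add_time_return [simp]: "add_time k (return_spmf (s, t)) = return_spmf (s, k + t)"
  by (simp add: add_time_def)

lemma runs_weaken: "runs c s T Q \<Longrightarrow> T \<le> T' \<Longrightarrow> (\<And>s'. Q s' \<Longrightarrow> Q' s') \<Longrightarrow> runs c s T' Q'"
  unfolding runs_def by fastforce

lemma runs_seq:
  assumes "runs c1 s T1 Q" and "\<And>s'. Q s' \<Longrightarrow> runs c2 s' T2 Q'"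
  shows "runs (Seq c1 c2) s (T1 + T2) Q'"
  using assms unfolding runs_def
  by (fastforce simp: and_then_def split_def lossless_bind_spmf set_bind_spmf set_add_time intro: add_mono)

text \<open>Every node of an expression charges its own value, so the cost bounds the length of the value,
  and a bound on the lengths of all cells bounds costs up to a factor that depends on the program.\<close>

lemma len_pos [simp]: "1 \<le> len v"
  by (simp add: len_def)

lemma len_mono: "u \<le> v \<Longrightarrow> len u \<le> len v"
  by (simp add: len_def floorlog_mono)

lemma len_leI: "v < 2 ^ k \<Longrightarrow> len v \<le> Suc k"
  by (simp add: len_def floorlog_leI)

lemma less_len: "v < 2 ^ (len v - 1)"
  using floorlog_leD[of 2 v "floorlog 2 v"] by (simp add: len_def)

text \<open>Lengths \<open>i + 1\<close> and \<open>j + 1\<close> leave room for every value below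
  \<open>2 ^ (i + j + 1)\<close>: a product, a sum with its carry, the value 1 of a comparison. The
  other operations do not exceed \<open>u\<close>.\<close>

lemma len_bop: "len (bop_val f u v) \<le> len u + len v"
proof -
  obtain i j where i: "len u = Suc i" and j: "len v = Suc j" using len_pos by (metis Suc_le_D One_nat_def)
  have u: "u < 2 ^ i" and v: "v < 2 ^ j" using less_len[of u] less_len[of v] i j by auto
  have ij: "len u + len v = Suc (Suc (i + j))" using i j by simp
  have m: "w < 2 ^ Suc (i + j) \<Longrightarrow> len w \<le> len u + len v" for w using len_leI[of w "Suc (i+j)"] ij by simp
  have le: "w \<le> u \<Longrightarrow> len w \<le> len u + len v" for w using len_mono[of w u] by simp
  show ?thesis
  proof (cases f)
    case Plus
    have "(2::nat) ^ i \<le> 2 ^ (i+j)" "(2::nat) ^ j \<le> 2 ^ (i+j)" by simp_all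
    then have "u + v < 2 ^ Suc (i + j)" using u v unfolding power_Suc by linarith
    then show ?thesis using m Plus by simp
  next
    case Times
    have "u * v < 2 ^ i * 2 ^ j" using u v by (simp add: mult_strict_mono')
    then have "u * v < 2 ^ Suc (i + j)" by (simp add: power_add)
    then show ?thesis using m Times by simp
  next
    case Less
    have "(1::nat) < 2 ^ Suc (i + j)" by (rule one_less_power) auto
    then show ?thesis using m[of "bop_val f u v"] Less by (cases "u < v") auto
  next
    case Equal
    have "(1::nat) < 2 ^ Suc (i + j)" by (rule one_less_power) auto
    then show ?thesis using m[of "bop_val f u v"] Equal by (cases "u = v") auto
  qed (auto intro!: le)
qed

section \<open>Length bounds on memories and the cost of loop-free programs\<close>

definition mem_bounded :: "nat \<Rightarrow> mem \<Rightarrow> bool" where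
  "mem_bounded l s \<longleftrightarrow> (\<forall>a i. len (s a i) \<le> l)"

lemma mem_bounded_pos: "mem_bounded l s \<Longrightarrow> 1 \<le> l"
  unfolding mem_bounded_def by (meson le_trans len_pos)

lemma mem_bounded_upd: "mem_bounded l s \<Longrightarrow> len v \<le> l \<Longrightarrow> mem_bounded l (upd s a i v)"
  unfolding mem_bounded_def upd_def by auto

lemma mem_bounded_mono: "mem_bounded l s \<Longrightarrow> l \<le> l' \<Longrightarrow> mem_bounded l' s"
  unfolding mem_bounded_def by (meson le_trans)

lemma len_val: "len (val e s) \<le> cost e s"
  by (induction e) auto

text \<open>The factor 2 pays for the result of an operation, whose length is at most the sum of the
  lengths of its operands.\<close>

primrec expr_factor :: "expr \<Rightarrow> nat" where
  "expr_factor (Const v) = len v"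
| "expr_factor (Load a e) = expr_factor e + 1"
| "expr_factor (Bin f e1 e2) = 2 * (expr_factor e1 + expr_factor e2)"

lemma cost_le:
  assumes "mem_bounded l s"
  shows "cost e s \<le> expr_factor e * l"
proof (induction e)
  case (Const v)
  then show ?case using mem_bounded_pos[OF assms] by simp
next
  case (Load a e)
  moreover have "len (s a (val e s)) \<le> l" using assms unfolding mem_bounded_def by blast
  ultimately show ?case by simp
next
  case (Bin f e1 e2)
  then show ?case using len_bop[of f "val e1 s" "val e2 s"] len_val[of e1 s] len_val[of e2 s]
    by (simp add: algebra_simps)
qed

text \<open>Loop-free code lengthens the cells by a constant factor at most. Under iteration this
  factor would compound, so \<open>runs_while\<close> demands that the invariant re-establish the
  bound \<open>l\<close>.\<close>

primrec growth :: "prog \<Rightarrow> nat" where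
  "growth Skip = 1"
| "growth (Store a e1 e2) = expr_factor e2 + 1"
| "growth (Toss a e) = 2"
| "growth (Seq c1 c2) = growth c1 * growth c2"
| "growth (Cond e c1 c2) = growth c1 + growth c2"
| "growth (While e c) = 1"

primrec time_factor :: "prog \<Rightarrow> nat" where
  "time_factor Skip = 1"
| "time_factor (Store a e1 e2) = 1 + expr_factor e1 + expr_factor e2"
| "time_factor (Toss a e) = 1 + expr_factor e"
| "time_factor (Seq c1 c2) = time_factor c1 + growth c1 * time_factor c2"
| "time_factor (Cond e c1 c2) = 1 + expr_factor e + time_factor c1 + time_factor c2"
| "time_factor (While e c) = 1 + expr_factor e + time_factor c"

lemma runs_loopfree_growth:
  assumes "loopfree c" "mem_bounded l s" "wp c Q s"
  shows "runs c s (time_factor c * l) (\<lambda>s'. Q s' \<and> mem_bounded (growth c * l) s')"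
  using assms
proof (induction c arbitrary: s l Q)
  case Skip
  then show ?case using mem_bounded_pos[OF Skip(2)] by (simp add: runs_def)
next
  case (Store a e1 e2)
  have "mem_bounded (expr_factor e2 * l + l) (upd s a (val e1 s) (val e2 s))"
    using Store cost_le[OF Store(2), of e2] len_val[of e2 s]
    by (intro mem_bounded_upd) (auto elim: mem_bounded_mono)
  then show ?case
    using Store mem_bounded_pos[OF Store(2)] cost_le[OF Store(2), of e1] cost_le[OF Store(2), of e2]
    by (simp add: runs_def algebra_simps)
next
  case (Toss a e)
  have "mem_bounded (2 * l) (upd s a (val e s) (of_bool b))" for b
    using Toss mem_bounded_pos[OF Toss(2)]
    by (intro mem_bounded_upd) (auto elim: mem_bounded_mono simp: len_def floorlog_def split: bool.split)
  then show ?case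
    using Toss mem_bounded_pos[OF Toss(2)] cost_le[OF Toss(2), of e]
    by (auto simp add: runs_def algebra_simps)
next
  case (Seq c1 c2)
  have "runs (Seq c1 c2) s (time_factor c1 * l + time_factor c2 * (growth c1 * l))
      (\<lambda>s'. Q s' \<and> mem_bounded (growth c2 * (growth c1 * l)) s')"
    by (rule runs_seq, rule Seq(1)[of l s "wp c2 Q"]) (use Seq in auto)
  then show ?case by (simp add: algebra_simps)
next
  case (Cond e c1 c2)
  note b = cost_le[OF Cond(4), of e] mem_bounded_pos[OF Cond(4)]
  show ?case
  proof (cases "val e s = 0")
    case True
    from Cond(2)[of l s Q] Cond True have "runs c2 s (time_factor c2 * l) (\<lambda>s'. Q s' \<and> mem_bounded (growth c2 * l) s')" by simp
    then show ?thesis using True b unfolding runs_def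
      by (fastforce simp: set_add_time algebra_simps elim: mem_bounded_mono)
  next
    case False
    from Cond(1)[of l s Q] Cond False have "runs c1 s (time_factor c1 * l) (\<lambda>s'. Q s' \<and> mem_bounded (growth c1 * l) s')" by simp
    then show ?thesis using False b unfolding runs_def
      by (fastforce simp: set_add_time algebra_simps elim: mem_bounded_mono)
  qed
qed simp

lemma runs_loopfree:
  assumes "loopfree c" "mem_bounded l s" "wp c Q s"
  shows "runs c s (time_factor c * l) Q"
  using runs_loopfree_growth[OF assms] by (rule runs_weaken) auto

text \<open>The first argument of the invariant bounds the number of remaining iterations.\<close>

lemma runs_while:
  assumes "loopfree c" "I v s"
    and b: "\<And>v s. I v s \<Longrightarrow> mem_bounded l s"
    and step: "\<And>v s. I v s \<Longrightarrow> val e s \<noteq> 0 \<Longrightarrow> wp c (\<lambda>s'. \<exists>v'<v. I v' s') s"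
  shows "runs (While e c) s (Suc v * (time_factor (While e c) * l)) (\<lambda>s'. (\<exists>v'. I v' s') \<and> val e s' = 0)"
  using assms(2)
proof (induction v arbitrary: s rule: less_induct)
  case (less v)
  note bs = b[OF less(2)]
  note cl = cost_le[OF bs, of e] mem_bounded_pos[OF bs]
  show ?case
  proof (cases "val e s = 0")
    case True
    then show ?thesis using less(2) cl by (auto simp: runs_def loop.simps[of e "exec c" s] algebra_simps)
  next
    case False
    let ?Q = "\<lambda>s'. (\<exists>v'. I v' s') \<and> val e s' = 0"
    let ?T = "v * (time_factor (While e c) * l)"
    have 1: "runs c s (time_factor c * l) (\<lambda>s'. \<exists>v'<v. I v' s')"
      by (rule runs_loopfree[OF assms(1) bs step[OF less(2) False]])
    have 2: "runs (While e c) s' ?T ?Q" if h: "\<exists>v'<v. I v' s'" for s'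
    proof -
      from h obtain v' where v': "v' < v" "I v' s'" by auto
      from less(1)[OF this] show ?thesis by (rule runs_weaken) (use v' in \<open>auto intro!: mult_le_mono1 simp only: Suc_le_eq\<close>)
    qed
    have ex: "exec (While e c) s = and_then (exec c s) (\<lambda>s'. add_time (1 + cost e s) (exec (While e c) s'))"
      using False by (simp add: loop.simps[of e "exec c" s])
    have T: "time_factor c * l + ((1 + cost e s) + ?T) \<le> Suc v * (time_factor (While e c) * l)"
      using cl by (simp add: algebra_simps)
    show ?thesis unfolding runs_def ex
    proof (intro conjI ballI)
      show "lossless_spmf (and_then (exec c s) (\<lambda>s'. add_time (1 + cost e s) (exec (While e c) s')))"
        using 1 2 unfolding runs_def and_then_def by (fastforce simp: lossless_bind_spmf split_def)
    next
      fix z assume "z \<in> set_spmf (and_then (exec c s) (\<lambda>s'. add_time (1 + cost e s) (exec (While e c) s')))"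
      then obtain s' t s'' t' where z: "(s', t) \<in> set_spmf (exec c s)" "(s'', t') \<in> set_spmf (exec (While e c) s')"
        "z = (s'', t + (1 + cost e s + t'))"
        by (auto simp: and_then_def set_bind_spmf set_add_time split_def simp del: exec.simps)
      from 1 z(1) have t: "t \<le> time_factor c * l" "\<exists>v'<v. I v' s'" unfolding runs_def by auto
      from 2[OF t(2)] z(2) have "t' \<le> ?T" "?Q s''" unfolding runs_def by (auto simp del: exec.simps)
      with t T z(3) show "case z of (s', t) \<Rightarrow> t \<le> Suc v * (time_factor (While e c) * l) \<and> ?Q s'" by auto
    qed
  qed
qed

lemma runs_within_runs: "runs c s T Q \<Longrightarrow> real T \<le> X \<Longrightarrow> runs_within c s X"
  unfolding runs_def runs_within_def by fastforce

text \<open>Losslessness excludes \<open>None\<close>, which would count as infinite time.\<close>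

lemma expected_time_runs:
  assumes "runs c s T Q"
  shows "expected_time c s \<le> of_nat T"
proof -
  have "AE r in measure_pmf (exec c s). (case r of None \<Rightarrow> \<infinity> | Some (s', t) \<Rightarrow> of_nat t) \<le> (of_nat T :: ennreal)"
    unfolding AE_measure_pmf_iff
  proof
    fix r assume r: "r \<in> set_pmf (exec c s)"
    have "r \<noteq> None" using assms r unfolding runs_def lossless_iff_set_pmf_None by metis
    then obtain s' t where st: "r = Some (s', t)" by (cases r) auto
    with r have "(s', t) \<in> set_spmf (exec c s)" by (simp add: in_set_spmf)
    then show "(case r of None \<Rightarrow> \<infinity> | Some (s', t) \<Rightarrow> of_nat t) \<le> (of_nat T :: ennreal)"
      using assms st unfolding runs_def by auto
  qed
  then show ?thesis unfolding expected_time_def by (intro measure_pmf.nn_integral_le_const) auto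
qed

section \<open>Primes\<close>

text \<open>Leibniz's harmonic triangle: with \<open>f n m = m * (n choose m)\<close> one has
  \<open>1 / f (Suc n) (Suc m) = 1 / f n m - 1 / f (Suc n) m\<close>.\<close>

lemma times_binomial_dvd_Lcm:
  assumes "1 \<le> m" "m \<le> n"
  shows "m * (n choose m) dvd Lcm {1..n}"
proof -
  have "\<exists>k::int. real (Lcm {1..n}) = k * (m * (n choose m))"
    using assms
  proof (induction m arbitrary: n rule: nat_induct_at_least)
    case base
    have "n dvd Lcm {1..n}" using base by (intro dvd_Lcm) auto
    then obtain k where "Lcm {1..n} = n * k" by (elim dvdE)
    then show ?case by (intro exI[of _ "int k"]) simp
  next
    case (Suc m)
    then obtain n' where n: "n = Suc n'" "m \<le> n'" by (cases n) auto
    obtain a :: int where a: "real (Lcm {1..n'}) = a * (m * (n' choose m))" using Suc n by blast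
    obtain b :: int where b: "real (Lcm {1..n}) = b * (m * (n choose m))" using Suc n by force
    have "Lcm {1..n'} dvd Lcm {1..n}" by (intro Lcm_subset) (use n in auto)
    then obtain c where c: "Lcm {1..n} = Lcm {1..n'} * c" by (elim dvdE)
    let ?x = "real (n' choose m)" and ?y = "real (n' choose Suc m)" and ?z = "real (n choose m)" and ?w = "real (n choose Suc m)"
    have pos: "?x > 0" "?z > 0" "?w > 0" "real m > 0" using Suc n by (auto simp: zero_less_binomial_iff simp del: binomial_Suc_Suc)
    have 1: "real (Suc m) * ?w = real n * ?x"
      using Suc_times_binomial_eq[of n' m] n by (metis mult.commute of_nat_mult)
    have 2: "real (Suc n' - m) * ?z = real (Suc n') * ?x"
      using binomial_absorb_comp[of "Suc n'" m] n by (metis diff_Suc_1 of_nat_mult)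
    have 2: "(real n - real m) * ?z = real n * ?x" using 2 n by (simp add: of_nat_diff)
    have L: "real (Lcm {1..n}) = a * (m * ?x) * c" using a c by simp
    have e: "a * (m * ?x) * c = b * (m * ?z)" using L b by simp
    have "real_of_int b * (real (Suc m) * ?w) * ?z = real n * ?x * (b * ?z)" using 1 by simp
    also have "\<dots> = real n * ?x * (a * ?x * c)" using e pos by simp
    also have "\<dots> = (a * c * ?x) * ((real n - real m) * ?z)" using 2 by simp
    finally have "(real_of_int b * (real (Suc m) * ?w)) * ?z = (a * c * ?x * (real n - real m)) * ?z"
      by (simp only: mult.assoc)
    then have 3: "real_of_int b * (real (Suc m) * ?w) = a * c * ?x * (real n - real m)"
      by (metis mult_right_cancel pos(2) less_irrefl)
    \<comment> \<open>\<open>a * c\<close> and \<open>b\<close> are the quotients of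
      \<open>Lcm {1..n}\<close> by the two neighbouring entries of the triangle, so their difference
      is the quotient sought.\<close>
    have "real_of_int (a * c - b) * (real (Suc m) * ?w) = a * c * (real n * ?x) - b * (real (Suc m) * ?w)"
      using 1 by (simp add: algebra_simps)
    also have "\<dots> = a * (m * ?x) * c" unfolding 3 by (simp add: algebra_simps)
    finally show ?case unfolding L by (intro exI[of _ "a * c - b"]) (simp only: of_nat_mult of_int_mult of_int_of_nat_eq mult.assoc)
  qed
  then obtain k :: int where k: "real (Lcm {1..n}) = k * (m * (n choose m))" by blast
  then have "real_of_int (int (Lcm {1..n})) = real_of_int (k * int (m * (n choose m)))"
    by (simp only: of_int_mult of_int_of_nat_eq)
  then have "int (Lcm {1..n}) = k * int (m * (n choose m))" by (simp only: of_int_eq_iff)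
  then have "int (m * (n choose m)) dvd int (Lcm {1..n})" by (metis dvd_triv_right)
  then show ?thesis by (simp only: of_nat_dvd_iff)
qed

text \<open>The multiplicity of \<open>p\<close> in an lcm is a maximum, which is attained by some
  member.\<close>

lemma prime_power_dvd_Lcm:
  fixes p :: nat
  assumes "prime p" "finite A" "0 \<notin> A" "p ^ k dvd Lcm A" "k > 0"
  shows "\<exists>a\<in>A. p ^ k dvd a"
  using assms(2-4)
proof (induction A rule: finite_induct)
  case empty
  then show ?case using assms by auto
next
  case (insert a A)
  have nz: "a \<noteq> 0" "Lcm A \<noteq> 0" using insert by (auto simp: Lcm_0_iff)
  have "k \<le> multiplicity p (lcm a (Lcm A))"
    using insert nz assms(1) by (intro multiplicity_geI) auto
  also have "\<dots> = max (multiplicity p a) (multiplicity p (Lcm A))"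
    using nz assms(1) by (intro multiplicity_lcm) auto
  finally have "p ^ k dvd a \<or> p ^ k dvd Lcm A"
    by (auto simp: le_max_iff_disj intro: multiplicity_dvd')
  then show ?case using insert by auto
qed

text \<open>Each prime contributes a power that already divides some number up to \<open>n\<close>,
  hence a factor of at most \<open>n\<close>. Read backwards, a lower bound on the lcm is a lower
  bound on the number of primes.\<close>

lemma Lcm_le_power_primes:
  fixes n :: nat
  assumes "n \<ge> 1"
  shows "Lcm {1..n} \<le> n ^ card {p. prime p \<and> p \<le> n}"
proof -
  let ?L = "Lcm {1..n}"
  have nz: "?L \<noteq> 0" by (simp add: Lcm_0_iff)
  have le: "p ^ multiplicity p ?L \<le> n \<and> p \<le> n" if p: "p \<in> prime_factors ?L" for p
  proof -
    from p have pr: "prime p" and k: "multiplicity p ?L > 0"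
      by (auto simp: prime_factors_multiplicity)
    obtain a where a: "a \<in> {1..n}" "p ^ multiplicity p ?L dvd a"
      using prime_power_dvd_Lcm[OF pr _ _ multiplicity_dvd k] by auto
    then have 1: "p ^ multiplicity p ?L \<le> n" using dvd_imp_le[of _ a] by force
    have "p ^ 1 \<le> p ^ multiplicity p ?L" using k prime_gt_0_nat[OF pr] by (intro power_increasing) auto
    with 1 show ?thesis by simp
  qed
  have 1: "(\<Prod>p\<in>prime_factors ?L. p ^ multiplicity p ?L) = ?L"
    using prod_prime_factors[OF nz] by (simp only: normalize_nat_def id_apply)
  have 2: "(\<Prod>p\<in>prime_factors ?L. p ^ multiplicity p ?L) \<le> (\<Prod>p\<in>prime_factors ?L. n)"
    by (rule prod_mono) (simp only: le simp_thms zero_le)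
  have "prime_factors ?L \<subseteq> {p. prime p \<and> p \<le> n}"
    using le in_prime_factors_imp_prime by blast
  then have "card (prime_factors ?L) \<le> card {p. prime p \<and> p \<le> n}" by (rule card_mono[rotated]) simp
  then have "n ^ card (prime_factors ?L) \<le> n ^ card {p. prime p \<and> p \<le> n}"
    using assms by (rule power_increasing)
  with 1 2 show ?thesis unfolding prod_constant by (metis le_trans)
qed

text \<open>A weak Chebyshev bound: at least \<open>sqrt x / 2\<close> primes up to
  \<open>x = 4 ^ a\<close>. With \<open>2 * k = 4 ^ a\<close>, the central binomial coefficient
  gives \<open>2 ^ k <= Lcm {1..2 * k}\<close>, and the upper bound on the lcm is a power of two as
  well, so the exponents can be compared.\<close>

lemma card_primes_power_four:
  assumes "a \<ge> 1"
  shows "2 ^ (a - 1) \<le> card {p::nat. prime p \<and> p \<le> 4 ^ a}"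
proof -
  define k where "k = (2::nat) ^ (2 * a - 1)"
  let ?c = "card {p::nat. prime p \<and> p \<le> 4 ^ a}"
  have four: "(4::nat) ^ a = 2 ^ (2 * a)" by (simp add: power_mult)
  have "2 * a = Suc (2 * a - 1)" using assms by simp
  then have "2 ^ (2 * a) = 2 * (2::nat) ^ (2 * a - 1)" by (metis power_Suc)
  then have k2: "2 * k = 4 ^ a" unfolding k_def four by simp
  have k: "k \<ge> 1" by (simp add: k_def)
  have "2 ^ k \<le> Lcm {1..2 * k}"
  proof -
    have "k * (2 * k choose k) dvd Lcm {1..2 * k}" using k by (intro times_binomial_dvd_Lcm) auto
    then have "k * (2 * k choose k) \<le> Lcm {1..2 * k}" by (intro dvd_imp_le) (auto simp: Lcm_0_iff intro!: Nat.gr0I)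
    moreover have "2 ^ k \<le> real (k * (2 * k choose k))"
    proof -
      have "real 4 ^ k / (2 * real k) \<le> real (2 * k choose k)"
        using central_binomial_lower_bound[of k] k by simp
      then have "real 4 ^ k \<le> real (2 * (k * (2 * k choose k)))" using k by (simp add: field_simps)
      moreover have "2 * 2 ^ k \<le> real 4 ^ k"
      proof -
        have "(2::real) ^ 1 * 2 ^ k \<le> 2 ^ k * 2 ^ k" using k by (intro mult_right_mono power_increasing) auto
        then show ?thesis by (simp flip: power_mult_distrib)
      qed
      ultimately show ?thesis by simp
    qed
    ultimately show ?thesis using of_nat_le_iff[where 'a = real, of "2 ^ k" "k * (2 * k choose k)"] by simp
  qed
  also have "\<dots> \<le> (2 * k) ^ ?c" using Lcm_le_power_primes[of "2 * k"] k k2 by simp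
  also have "\<dots> = 2 ^ (2 * a * ?c)" unfolding k2 four by (rule power_mult[symmetric])
  finally have "k \<le> 2 * a * ?c" by (rule power_le_imp_le_exp[rotated]) simp
  then have "2 ^ (2 * a - 1) \<le> 2 * a * ?c" unfolding k_def .
  \<comment> \<open>This gives away the logarithmic gap in exchange for a clean square root; only
    polynomial bounds on primes are needed later.\<close>
  moreover have "2 * a \<le> 2 ^ a"
    using assms
  proof (induction a rule: nat_induct_at_least)
    case (Suc a)
    have "(2::nat) ^ 1 \<le> 2 ^ a" using Suc by (intro power_increasing) auto
    then show ?case using Suc by simp
  qed simp
  then have "2 * a * ?c \<le> 2 ^ a * ?c" by (rule mult_le_mono1)
  moreover have "(2::nat) ^ (2 * a - 1) = 2 ^ a * 2 ^ (a - 1)"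
    using assms unfolding power_add[symmetric] by (intro arg_cong[of _ _ "power 2"]) simp
  ultimately have "2 ^ a * 2 ^ (a - 1) \<le> 2 ^ a * ?c" by linarith
  then show ?thesis by simp
qed

text \<open>Rounding \<open>Y\<close> up to a power \<open>2 ^ a <= 2 * Y\<close> gives
  \<open>4 ^ Suc a <= 16 * Y\<^sup>2\<close>, the origin of the 16 here and in
  \<open>seed_base\<close>.\<close>

lemma card_primes_square: "Y \<le> card {p::nat. prime p \<and> p \<le> 16 * Y\<^sup>2}"
proof (cases "Y = 0")
  case False
  define a where "a = (LEAST j. Y \<le> 2 ^ j)"
  have ex: "Y \<le> 2 ^ Y" using less_exp[of Y] by simp
  have Y: "Y \<le> 2 ^ a" unfolding a_def by (rule LeastI[of _ Y]) (rule ex)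
  have 2: "2 ^ a \<le> 2 * Y"
  proof (cases a)
    case (Suc b)
    have "\<not> Y \<le> 2 ^ b" using not_less_Least[of b "\<lambda>j. Y \<le> 2 ^ j"] Suc unfolding a_def by simp
    then show ?thesis using Suc by simp
  qed (use False in auto)
  have "(4::nat) ^ a = (2 ^ a)\<^sup>2"
    unfolding power2_eq_square power_mult_distrib[symmetric] by simp
  then have "4 ^ Suc a = 4 * ((2::nat) ^ a)\<^sup>2" by simp
  also have "\<dots> \<le> 4 * (2 * Y)\<^sup>2" using 2 by (intro mult_le_mono2 power_mono) auto
  also have "\<dots> = 16 * Y\<^sup>2" by (simp add: power_mult_distrib)
  finally have 4: "4 ^ Suc a \<le> 16 * Y\<^sup>2" .
  have "Y \<le> card {p::nat. prime p \<and> p \<le> 4 ^ Suc a}"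
    using card_primes_power_four[of "Suc a"] Y by (simp only: diff_Suc_1) (simp del: power_Suc)
  also have "\<dots> \<le> card {p::nat. prime p \<and> p \<le> 16 * Y\<^sup>2}"

  proof (rule card_mono)
    show "finite {p. prime p \<and> p \<le> 16 * Y\<^sup>2}"
      by (rule finite_subset[of _ "{..16 * Y\<^sup>2}"]) blast+
    show "{p. prime p \<and> p \<le> 4 ^ Suc a} \<subseteq> {p. prime p \<and> p \<le> 16 * Y\<^sup>2}"
      by (intro Collect_mono impI conjI; elim conjE) (assumption, rule le_trans[OF _ 4])
  qed
  finally show ?thesis .
qed simp

text \<open>The product of distinct prime divisors divides \<open>d\<close>, and each is at least 2.
  This limits how many primes can identify two given numbers, both for the hash modulus and for the
  tables.\<close>

lemma two_power_card_primes_le: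
  fixes d :: nat
  assumes "finite S" "\<And>p. p \<in> S \<Longrightarrow> prime p \<and> p dvd d" "d > 0"
  shows "2 ^ card S \<le> d"
proof -
  have "2 ^ card S = (\<Prod>p\<in>S. 2::nat)" by simp
  also have "\<dots> \<le> \<Prod>S" using assms(2) by (intro prod_mono) (auto dest: prime_ge_2_nat)
  also have "\<Prod>S dvd d"
    using assms(1,2)
  proof (induction S rule: finite_induct)
    case (insert p S)
    have "coprime p (\<Prod>S)" using insert by (intro prod_coprime_right primes_coprime) auto
    then show ?case using insert by (auto intro: divides_mult)
  qed simp
  then have "\<Prod>S \<le> d" using assms by (intro dvd_imp_le) auto
  finally show ?thesis .
qed

section \<open>Enumeration of the primes, counted from 0, and a primality test\<close>

definition nth_prime :: "nat \<Rightarrow> nat" where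
  "nth_prime = enumerate {p. prime p}"

lemma prime_nth_prime: "prime (nth_prime k)"
  using enumerate_in_set[OF primes_infinite] by (auto simp: nth_prime_def)

lemma nth_prime_less_iff: "nth_prime i < nth_prime j \<longleftrightarrow> i < j"
  unfolding nth_prime_def using primes_infinite by simp

lemma nth_prime_eq_iff: "nth_prime i = nth_prime j \<longleftrightarrow> i = j"
  by (metis nth_prime_less_iff linorder_neq_iff)

lemma ex_nth_prime: "prime p \<Longrightarrow> \<exists>k. p = nth_prime k"
  unfolding nth_prime_def using enumerate_Ex[of "{p. prime p}" p] primes_infinite by (metis mem_Collect_eq)

lemma primes_below_nth_prime: "{q. prime q \<and> q < nth_prime k} = nth_prime ` {..<k}"
proof
  show "{q. prime q \<and> q < nth_prime k} \<subseteq> nth_prime ` {..<k}"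
  proof
    fix q assume q: "q \<in> {q. prime q \<and> q < nth_prime k}"
    then obtain i where "q = nth_prime i" using ex_nth_prime[of q] by auto
    then show "q \<in> nth_prime ` {..<k}" using q nth_prime_less_iff by simp
  qed
qed (auto simp: prime_nth_prime nth_prime_less_iff)

lemma card_primes_below_nth_prime: "card {q. prime q \<and> q < nth_prime k} = k"
  unfolding primes_below_nth_prime by (subst card_image) (auto intro: inj_onI simp: nth_prime_eq_iff)

lemma nth_prime_card_primes: "prime p \<Longrightarrow> nth_prime (card {q. prime q \<and> q < p}) = p"
  using ex_nth_prime card_primes_below_nth_prime by metis

lemma nth_prime_le:
  assumes "k < Y"
  shows "nth_prime k \<le> 16 * Y\<^sup>2"
proof (rule ccontr)
  assume "\<not> ?thesis"
  then have "card {p::nat. prime p \<and> p \<le> 16 * Y\<^sup>2} \<le> card {q. prime q \<and> q < nth_prime k}"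
    by (intro card_mono) auto
  then show False using card_primes_square[of Y] card_primes_below_nth_prime[of k] assms by simp
qed

text \<open>Two proper factors of a composite \<open>p\<close> both divide
  \<open>fact (p - 1)\<close>, so their product divides the square; without squaring,
  \<open>p = 4\<close> would fail. The squared factorial can be updated from one candidate to the
  next, so that the test is a single remainder and needs no inner loop.\<close>

lemma prime_iff_not_dvd_fact_square:
  fixes p :: nat
  assumes "p \<ge> 2"
  shows "prime p \<longleftrightarrow> \<not> p dvd (fact (p - 1))\<^sup>2"
proof
  assume p: "prime p"
  show "\<not> p dvd (fact (p - 1))\<^sup>2"
  proof
    assume "p dvd (fact (p - 1))\<^sup>2"
    then have "p dvd fact (p - 1)" using p prime_dvd_power by blast
    then show False using p prime_dvd_fact_iff[of p "p - 1"] assms by auto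
  qed
next
  assume n: "\<not> p dvd (fact (p - 1))\<^sup>2"
  show "prime p"
  proof (rule ccontr)
    assume "\<not> prime p"
    then obtain a where a: "a dvd p" "a \<noteq> 1" "a \<noteq> p" using assms by (auto simp: prime_nat_iff)
    then obtain b where b: "p = a * b" by (elim dvdE)
    have "a > 0" "b > 0" "b \<noteq> p" using assms a b by (auto intro: Nat.gr0I)
    moreover have "b dvd p" using b by simp
    ultimately have "a \<le> p - 1" "b \<le> p - 1"
      using a dvd_imp_le[of a p] dvd_imp_le[of b p] assms by simp_all
    then have "a dvd fact (p - 1)" "b dvd fact (p - 1)"
      using \<open>a > 0\<close> \<open>b > 0\<close> by (auto intro: dvd_fact)
    then have "p dvd (fact (p - 1))\<^sup>2" unfolding b power2_eq_square by (rule mult_dvd_mono)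
    with n show False by simp
  qed
qed

section \<open>Polynomial hashing\<close>

text \<open>Evaluates at \<open>x\<close> the polynomial whose \<open>k\<close> coefficients are the base-\<open>E\<close> digits of \<open>w\<close>.\<close>

primrec horner :: "nat \<Rightarrow> nat \<Rightarrow> nat \<Rightarrow> nat \<Rightarrow> nat" where
  "horner E 0 w x = 0"
| "horner E (Suc k) w x = w mod E + x * horner E k (w div E) x"

section \<open>Roots of digit polynomials modulo a prime\<close>

primrec digit_poly :: "nat \<Rightarrow> nat \<Rightarrow> nat \<Rightarrow> int poly" where
  "digit_poly E 0 w = 0"
| "digit_poly E (Suc k) w = pCons (int (w mod E)) (digit_poly E k (w div E))"

lemma poly_digit_poly: "poly (digit_poly E k w) (int x) = int (horner E k w x)"
  by (induction k arbitrary: w) auto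

lemma degree_digit_poly: "degree (digit_poly E (Suc k) w) \<le> k"
proof (induction k arbitrary: w)
  case (Suc k)
  show ?case using Suc[of "w div E"] degree_pCons_le le_trans Suc_le_mono
    by (metis digit_poly.simps(2))
qed simp

text \<open>A polynomial over a field with more roots than its degree vanishes, here phrased through
  divisibility of integers so that no type of residues modulo \<open>q\<close> is involved.
  Splitting off a root \<open>a\<close> leaves a quotient that still vanishes modulo
  \<open>q\<close> on the other points, because \<open>q\<close> is prime and does not divide
  \<open>x - a\<close>.\<close>

lemma dvd_coeff_of_many_roots:
  fixes f :: "int poly"
  assumes "prime q" "finite S" "degree f < card S"
    and "\<And>x y. x \<in> S \<Longrightarrow> y \<in> S \<Longrightarrow> x \<noteq> y \<Longrightarrow> \<not> q dvd x - y"
    and "\<And>x. x \<in> S \<Longrightarrow> q dvd poly f x"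
  shows "q dvd coeff f i"
  using assms(2-)
proof (induction S arbitrary: f i rule: finite_induct)
  case (insert a S)
  show ?case
  proof (cases "degree f = 0")
    case True
    then obtain c where "f = [:c:]" by (elim degree_eq_zeroE)
    then show ?thesis using insert.prems(3)[of a] by (cases i) auto
  next
    case False
    define g where "g = synthetic_div f a"
    have f: "f = [:- a, 1:] * g + [:poly f a:]"
      using synthetic_div_correct'[of a f] by (simp add: g_def)
    have "degree g < card S" using insert.prems(1) False insert.hyps
      by (simp add: g_def degree_synthetic_div)
    moreover have "q dvd poly g x" if x: "x \<in> S" for x
    proof -
      have "poly f x = (x - a) * poly g x + poly f a" by (subst f) (simp add: algebra_simps)
      then have "(x - a) * poly g x = poly f x - poly f a" by simp
      then have "q dvd (x - a) * poly g x" using insert.prems(3) x by simp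
      moreover have "\<not> q dvd x - a" using insert.prems(2) x insert.hyps by auto
      ultimately show ?thesis using assms(1) prime_dvd_mult_iff by blast
    qed
    ultimately have g: "q dvd coeff g j" for j using insert.IH insert.prems(2) by blast
    have "coeff f i = coeff (pCons 0 g) i - a * coeff g i + coeff [:poly f a:] i"
      by (subst f) simp
    moreover have "q dvd coeff (pCons 0 g) i" using g by (cases i) auto
    moreover have "q dvd coeff [:poly f a:] i" using insert.prems(3)[of a] by (cases i) auto
    ultimately show ?thesis using g by simp
  qed
qed simp

text \<open>Base-\<open>q\<close> digits are below \<open>q\<close>, so congruent digits are
  equal.\<close>

lemma digit_poly_inject:
  assumes "\<And>i. int q dvd coeff (digit_poly q k v - digit_poly q k v') i" "v < q ^ k" "v' < q ^ k" "q > 0"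
  shows "v = v'"
  using assms(1-3)
proof (induction k arbitrary: v v')
  case (Suc k)
  have "int q dvd int (v mod q) - int (v' mod q)" using Suc.prems(1)[of 0] by simp
  then have "int (v mod q) mod int q = int (v' mod q) mod int q" by (simp only: mod_eq_dvd_iff)
  then have 1: "v mod q = v' mod q" by (simp flip: of_nat_mod)
  have "v div q = v' div q"
    using Suc.prems assms(4)
    by (intro Suc.IH) (use Suc.prems(1)[of "Suc _"] in \<open>auto simp: less_mult_imp_div_less mult.commute\<close>)
  then show ?case using 1 by (metis div_mult_mod_eq)
qed simp

lemma horner_inject:
  assumes "prime q" "finite S" "card S = Suc k" "inj_on (\<lambda>x. x mod q) S"
    and "v < q ^ Suc k" "v' < q ^ Suc k"
    and eq: "\<And>x. x \<in> S \<Longrightarrow> horner q (Suc k) v x mod q = horner q (Suc k) v' x mod q"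
  shows "v = v'"
proof (rule digit_poly_inject[OF _ assms(5,6)])
  let ?f = "digit_poly q (Suc k) v - digit_poly q (Suc k) v'"
  show "int q dvd coeff ?f i" for i
  proof (rule dvd_coeff_of_many_roots[where S = "int ` S"])
    show "prime (int q)" "finite (int ` S)" using assms by auto
    have "degree ?f \<le> k" by (intro degree_diff_le degree_digit_poly)
    then show "degree ?f < card (int ` S)" using assms(3) by (simp add: card_image)
  next
    fix x y assume "x \<in> int ` S" "y \<in> int ` S" "x \<noteq> y"
    then obtain a b where ab: "x = int a" "y = int b" "a \<in> S" "b \<in> S" "a \<noteq> b" by auto
    then have "a mod q \<noteq> b mod q" using assms(4) by (auto dest: inj_onD)
    then show "\<not> int q dvd x - y" using ab by (simp flip: mod_eq_dvd_iff of_nat_mod)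
  next
    fix x assume "x \<in> int ` S"
    then obtain a where a: "x = int a" "a \<in> S" by auto
    have "poly ?f x = int (horner q (Suc k) v a) - int (horner q (Suc k) v' a)"
      using a poly_digit_poly by (simp del: digit_poly.simps horner.simps)
    then show "int q dvd poly ?f x" using eq[OF a(2)]
      by (simp del: digit_poly.simps horner.simps flip: mod_eq_dvd_iff of_nat_mod)
  qed
qed (use assms(1) prime_gt_0_nat in auto)

text \<open>Digits below \<open>q\<close> are also digits in base \<open>E\<close>. The existence
  proof counts polynomials in base \<open>q\<close>, whereas the programs read seeds in a base that
  is computable from \<open>n\<close> and \<open>m\<close> without knowing \<open>q\<close>.\<close>

lemma horner_change_base:
  assumes "0 < q" "q \<le> E"
  shows "\<exists>w < E ^ k. \<forall>x. horner E k w x = horner q k v x"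
proof (induction k arbitrary: v)
  case (Suc k)
  then obtain w where w: "w < E ^ k" "\<forall>x. horner E k w x = horner q k (v div q) x" by blast
  have d: "v mod q < E" using assms by (meson mod_less_divisor order.strict_trans2)
  have "v mod q + E * w < E * Suc w" using d by simp
  also have "\<dots> \<le> E * E ^ k" using w by (intro mult_le_mono2) simp
  finally show ?case using d w by (intro exI[of _ "v mod q + E * w"]) auto
qed auto

section \<open>Counting the polynomials that overload a bucket\<close>

lemma card_residue_class:
  assumes "N > 0"
  shows "card {y::nat. y < q \<and> y mod N = b} \<le> q div N + 1"
proof -
  have "inj_on (\<lambda>y. y div N) {y. y < q \<and> y mod N = b}"
    by (intro inj_onI) (metis (mono_tags, lifting) mem_Collect_eq div_mult_mod_eq)
  then have "card {y. y < q \<and> y mod N = b} = card ((\<lambda>y. y div N) ` {y. y < q \<and> y mod N = b})"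
    by (rule card_image[symmetric])
  also have "\<dots> \<le> card {..q div N}" by (intro card_mono) (auto intro: div_le_mono)
  finally show ?thesis by simp
qed

text \<open>A polynomial is determined by its values on \<open>S\<close>. If these collide, they all
  lie in one residue class modulo \<open>N\<close>: there are \<open>N\<close> classes and at most
  \<open>q div N + 1\<close> values in each.\<close>

lemma card_colliding_seeds:
  assumes q: "prime q" and S: "finite S" "card S = Suc k" "inj_on (\<lambda>x. x mod q) S" and N: "N > 0"
  shows "card {v. v < q ^ Suc k \<and> (\<exists>b. \<forall>x\<in>S. horner q (Suc k) v x mod q mod N = b)}
    \<le> N * (q div N + 1) ^ Suc k" (is "card ?V \<le> _")
proof -
  define h where "h = (\<lambda>v. restrict (\<lambda>x. horner q (Suc k) v x mod q) S)"
  define Z where "Z = (\<lambda>b. \<Pi>\<^sub>E x\<in>S. {y. y < q \<and> y mod N = b})"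
  have fin: "finite (Z b)" for b unfolding Z_def using S by (intro finite_PiE) auto
  have "inj_on h ?V"
  proof (rule inj_onI)
    fix v v' assume v: "v \<in> ?V" "v' \<in> ?V" and h: "h v = h v'"
    show "v = v'"
    proof (rule horner_inject[OF q S])
      show "v < q ^ Suc k" "v' < q ^ Suc k" using v by blast+
      fix x assume "x \<in> S"
      moreover have "h v x = h v' x" using h by (rule fun_cong)
      ultimately show "horner q (Suc k) v x mod q = horner q (Suc k) v' x mod q"
        unfolding h_def by (simp only: restrict_apply if_True)
    qed
  qed
  then have "card ?V = card (h ` ?V)" by (rule card_image[symmetric])
  also have "h ` ?V \<subseteq> (\<Union>b<N. Z b)"
  proof
    fix g assume "g \<in> h ` ?V"
    then obtain v b where v: "g = h v" "\<forall>x\<in>S. horner q (Suc k) v x mod q mod N = b" by auto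
    obtain x where "x \<in> S" using S by fastforce
    then have "b < N" using v(2) N by (metis mod_less_divisor)
    moreover have "g \<in> Z b" using v q prime_gt_0_nat
      by (auto simp: Z_def h_def simp del: horner.simps)
    ultimately show "g \<in> (\<Union>b<N. Z b)" by blast
  qed
  then have "card (h ` ?V) \<le> card (\<Union>b<N. Z b)" by (intro card_mono) (auto intro: fin)
  also have "\<dots> \<le> (\<Sum>b<N. card (Z b))" by (rule card_UN_le) simp
  also have "\<dots> \<le> (\<Sum>b<N. (q div N + 1) ^ Suc k)"
  proof (rule sum_mono)
    fix b
    have "card (Z b) = card {y. y < q \<and> y mod N = b} ^ Suc k"
      unfolding Z_def using S by (simp add: card_PiE)
    also have "\<dots> \<le> (q div N + 1) ^ Suc k" by (rule power_mono[OF card_residue_class[OF N] zero_le])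
    finally show "card (Z b) \<le> (q div N + 1) ^ Suc k" .
  qed
  finally show ?thesis by simp
qed

text \<open>Union bound: if each of the \<open>q ^ Suc k\<close> polynomials overloaded a bucket,
  each would collide on some subset of \<open>A\<close> with \<open>Suc k\<close> elements, and
  there are at most \<open>n ^ Suc k\<close> such subsets.\<close>

lemma card_overloading_seeds:
  assumes q: "prime q" and A: "finite A" "card A \<le> n" "inj_on (\<lambda>x. x mod q) A" and N: "N > 0" "N \<le> q"
    and nN: "n ^ Suc k * 2 ^ Suc k < N ^ k"
  shows "\<exists>v < q ^ Suc k. \<forall>b. card {x\<in>A. horner q (Suc k) v x mod q mod N = b} \<le> k"
proof (rule ccontr)
  assume c: "\<not> ?thesis"
  let ?B = "\<lambda>S. {v. v < q ^ Suc k \<and> (\<exists>b. \<forall>x\<in>S. horner q (Suc k) v x mod q mod N = b)}"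
  let ?SS = "{S. S \<subseteq> A \<and> card S = Suc k}"
  have "{..<q ^ Suc k} \<subseteq> (\<Union>S\<in>?SS. ?B S)"
  proof
    fix v assume v: "v \<in> {..<q ^ Suc k}"
    then obtain b where "Suc k \<le> card {x\<in>A. horner q (Suc k) v x mod q mod N = b}"
      using c by (auto simp: not_le Suc_le_eq simp del: horner.simps)
    then obtain S where "S \<subseteq> {x\<in>A. horner q (Suc k) v x mod q mod N = b}" "card S = Suc k"
      by (rule obtain_subset_with_card_n)
    then have "S \<in> ?SS" "v \<in> ?B S" using v by blast+
    then show "v \<in> (\<Union>S\<in>?SS. ?B S)" by (rule UN_I)
  qed
  then have "card {..<q ^ Suc k} \<le> card (\<Union>S\<in>?SS. ?B S)"
    using A by (intro card_mono) auto
  also have "\<dots> \<le> (\<Sum>S\<in>?SS. card (?B S))" using A by (intro card_UN_le) auto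
  also have "\<dots> \<le> (\<Sum>S\<in>?SS. N * (q div N + 1) ^ Suc k)"
    using A by (intro sum_mono card_colliding_seeds q N(1)) (auto intro: finite_subset inj_on_subset)
  also have "\<dots> = (card A choose Suc k) * (N * (q div N + 1) ^ Suc k)"
    using A by (simp add: n_subsets)
  finally have 1: "q ^ Suc k \<le> (card A choose Suc k) * (N * (q div N + 1) ^ Suc k)" by simp
  have ch: "card A choose Suc k \<le> n ^ Suc k"
  proof (cases "Suc k \<le> card A")
    case True
    then have "card A choose Suc k \<le> card A ^ Suc k" by (rule binomial_le_pow)
    also have "\<dots> \<le> n ^ Suc k" using A(2) by (intro power_mono) auto
    finally show ?thesis .
  qed (simp add: binomial_eq_0)
  \<comment> \<open>\<open>N <= q\<close> absorbs the rounding of \<open>q div N + 1\<close>, at the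
    price of a factor 2 per element of the subset.\<close>
  have "N * (q div N + 1) \<le> 2 * q"
    using N(2) times_div_less_eq_dividend[of N q] unfolding distrib_left mult_1_right by linarith
  then have 2: "N ^ Suc k * (q div N + 1) ^ Suc k \<le> (2 * q) ^ Suc k"
    unfolding power_mult_distrib[symmetric] by (rule power_mono) simp
  have "N ^ Suc k * q ^ Suc k \<le> N ^ Suc k * (n ^ Suc k * (N * (q div N + 1) ^ Suc k))"
    using 1 ch by (meson le_trans mult_le_mono1 mult_le_mono2)
  also have "\<dots> = n ^ Suc k * N * (N ^ Suc k * (q div N + 1) ^ Suc k)" by (simp only: ac_simps)
  also have "\<dots> \<le> n ^ Suc k * N * (2 * q) ^ Suc k" by (rule mult_le_mono2[OF 2])
  also have "\<dots> = (n ^ Suc k * 2 ^ Suc k) * N * q ^ Suc k" by (simp only: power_mult_distrib ac_simps)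
  also have "\<dots> < N ^ k * N * q ^ Suc k"
    using nN N q prime_gt_0_nat by (intro mult_strict_right_mono) auto
  finally show False by (simp add: ac_simps)
qed

text \<open>Of the at least \<open>Y\<close> primes up to \<open>16 * Y\<^sup>2\<close>, at most
  \<open>N\<close> are below \<open>N\<close>, and at most \<open>T\<close> divide the difference of
  any of the at most \<open>n\<^sup>2\<close> pairs. The \<open>+ 1\<close> in \<open>Y\<close>
  leaves a prime over.\<close>

lemma ex_prime_injective_mod:
  assumes A: "A \<subseteq> {1..m}" "card A \<le> n" and T: "m < 2 ^ T" and Y: "Y = N + n\<^sup>2 * T + 1"
  shows "\<exists>q. prime q \<and> N \<le> q \<and> q \<le> 16 * Y\<^sup>2 \<and> inj_on (\<lambda>x. x mod q) A"
proof (rule ccontr)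
  assume c: "\<not> ?thesis"
  have finA: "finite A" using A finite_subset by blast
  let ?I = "{p \<in> A \<times> A. fst p < snd p}"
  let ?D = "\<lambda>p. {q. prime q \<and> q dvd (snd p - fst p)}"
  have finD: "finite (?D p)" if "p \<in> ?I" for p
  proof (rule finite_subset)
    show "?D p \<subseteq> {..snd p - fst p}" using that dvd_imp_le[of _ "snd p - fst p"] by auto
  qed simp
  have "{q. prime q \<and> q \<le> 16 * Y\<^sup>2} \<subseteq> {..<N} \<union> (\<Union>p\<in>?I. ?D p)"
  proof
    fix q assume q: "q \<in> {q. prime q \<and> q \<le> 16 * Y\<^sup>2}"
    show "q \<in> {..<N} \<union> (\<Union>p\<in>?I. ?D p)"
    proof (cases "q < N")
      case False
      then have "\<not> inj_on (\<lambda>x. x mod q) A" using c q by auto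
      then obtain a b where ab: "a \<in> A" "b \<in> A" "a < b" "a mod q = b mod q"
        unfolding inj_on_def by (metis linorder_neqE_nat)
      then have "q dvd b - a" using mod_eq_dvd_iff_nat[of a b q] by simp
      then show ?thesis using ab q by force
    qed simp
  qed
  then have "card {q. prime q \<and> q \<le> 16 * Y\<^sup>2} \<le> card ({..<N} \<union> (\<Union>p\<in>?I. ?D p))"
    using finA finD by (intro card_mono) auto
  also have "\<dots> \<le> card {..<N} + card (\<Union>p\<in>?I. ?D p)" by (rule card_Un_le)
  also have "\<dots> \<le> N + (\<Sum>p\<in>?I. card (?D p))" using finA by (simp add: card_UN_le)
  also have "(\<Sum>p\<in>?I. card (?D p)) \<le> (\<Sum>p\<in>?I. T)"
  proof (rule sum_mono)
    fix p assume p: "p \<in> ?I"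
    have "2 ^ card (?D p) \<le> snd p - fst p" using p finD[OF p] by (intro two_power_card_primes_le) auto
    also have "\<dots> < 2 ^ T" using p A T by (auto simp: subset_iff intro!: le_less_trans[of _ m])
    finally show "card (?D p) \<le> T" by simp
  qed
  also have "\<dots> = card ?I * T" by simp
  also have "\<dots> \<le> card (A \<times> A) * T"
    using finA by (intro mult_le_mono1 card_mono) auto
  also have "\<dots> \<le> n\<^sup>2 * T" using A(2) by (simp add: power2_eq_square card_cartesian_product mult_le_mono)
  finally show False using card_primes_square[of Y] Y by simp
qed

section \<open>Parameters of the scheme\<close>

text \<open>The lowest digit of the seed is the modulus \<open>q\<close> and the others are the
  coefficients, so that the search over seeds includes the search for \<open>q\<close>. If that
  digit is 0, reduction modulo 0 is the identity and the last reduction still yields a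
  bucket.\<close>

definition bucket :: "nat \<Rightarrow> nat \<Rightarrow> nat \<Rightarrow> nat \<Rightarrow> nat \<Rightarrow> nat" where
  "bucket k E N w x = horner E k (w div E) x mod (w mod E) mod N"

text \<open>\<open>D\<close> bounds the load of a bucket and sets the storage exponent
  \<open>1 + 1 / D\<close>; \<open>R\<close> sets the number of primes and thereby the
  error.\<close>

locale params =
  fixes D R :: nat
  assumes D: "2 \<le> D" and R: "1 \<le> R"
begin

text \<open>\<open>side n\<close> is about \<open>n powr (1 / D)\<close>; there are \<open>bins n\<close> buckets, \<open>trials m\<close> primes below
  \<open>modulus m\<close>, and \<open>seed_base n m ^ (D + 2)\<close> seeds.\<close>

definition side :: "nat \<Rightarrow> nat" where "side n = 2 ^ (LEAST j. n \<le> (2 ^ j) ^ D)"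
definition trials :: "nat \<Rightarrow> nat" where "trials m = 2 ^ (LEAST j. m ^ R < 2 ^ (2 ^ j))"
definition modulus :: "nat \<Rightarrow> nat" where "modulus m = Suc (nth_prime (trials m - 1))"
definition bins :: "nat \<Rightarrow> nat" where "bins n = 4 * n * side n"
definition seed_base :: "nat \<Rightarrow> nat \<Rightarrow> nat" where
  "seed_base n m = 16 * (bins n + n\<^sup>2 * trials m + 1)\<^sup>2 + 1"
definition hash :: "nat \<Rightarrow> nat \<Rightarrow> nat \<Rightarrow> nat \<Rightarrow> nat" where
  "hash n m w x = bucket (Suc D) (seed_base n m) (bins n) w x"
definition good :: "nat \<Rightarrow> nat \<Rightarrow> nat set \<Rightarrow> nat \<Rightarrow> bool" where
  "good n m A w \<longleftrightarrow> (\<forall>b. card {x \<in> A. hash n m w x = b} \<le> D)"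
text \<open>A mixed-radix address with digits for bucket, prime and residue; all tables have the
  same size \<open>modulus m\<close>. The offset \<open>n\<close> skips the cells of the encoder's
  input list, as \<open>B\<close> is built in the same array.\<close>

definition position :: "nat \<Rightarrow> nat \<Rightarrow> nat \<Rightarrow> nat \<Rightarrow> nat \<Rightarrow> nat" where
  "position n m w x t = n + (hash n m w x * trials m + t) * modulus m + x mod nth_prime t"

section \<open>Sizes of the parameters and existence of a good seed\<close>

lemma ex_side: "\<exists>j. (n::nat) \<le> (2 ^ j) ^ D"
proof
  have "n \<le> 2 ^ n" using less_exp[of n] by simp
  also have "\<dots> \<le> (2 ^ n) ^ D" using D by (intro self_le_power) auto
  finally show "n \<le> (2 ^ n) ^ D" .
qed

lemma side: "n \<le> side n ^ D"
  unfolding side_def using LeastI_ex[OF ex_side] .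

lemma side_pos: "side n > 0" by (simp add: side_def)

text \<open>As long as the doubling loop finds its current power too small, one more doubling does
  not overshoot; \<open>trials_minimal\<close> plays the same part for the other loop.\<close>

lemma side_minimal: "(2 ^ j) ^ D < n \<Longrightarrow> 2 * 2 ^ j \<le> side n"
proof -
  assume a: "(2 ^ j) ^ D < n"
  have "\<not> (LEAST j. n \<le> (2 ^ j) ^ D) \<le> j"
  proof
    assume "(LEAST j. n \<le> (2 ^ j) ^ D) \<le> j"
    then have "side n ^ D \<le> (2 ^ j) ^ D" unfolding side_def by (intro power_mono power_increasing) auto
    then show False using side[of n] a by simp
  qed
  then have "Suc j \<le> (LEAST j. n \<le> (2 ^ j) ^ D)" by simp
  then have "2 ^ Suc j \<le> side n" unfolding side_def by (rule power_increasing) simp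
  then show ?thesis by simp
qed

lemma side_half: "side n \<noteq> 1 \<Longrightarrow> \<exists>j. side n = 2 * 2 ^ j \<and> (2 ^ j) ^ D < n"
proof -
  assume s: "side n \<noteq> 1"
  then obtain j where j: "(LEAST j. n \<le> (2 ^ j) ^ D) = Suc j"
    unfolding side_def by (cases "LEAST j. n \<le> (2 ^ j) ^ D") auto
  then have "\<not> n \<le> (2 ^ j) ^ D" using not_less_Least[of j "\<lambda>j. n \<le> (2 ^ j) ^ D"] by simp
  then show ?thesis using j unfolding side_def by (intro exI[of _ j]) auto
qed

lemma side_le: "1 \<le> n \<Longrightarrow> side n \<le> 2 * n"
proof (cases "side n = 1")
  case False
  then obtain j where j: "side n = 2 * 2 ^ j" "(2 ^ j) ^ D < n" using side_half by blast
  have "(2::nat) ^ j \<le> (2 ^ j) ^ D" using D by (intro self_le_power) auto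
  then show ?thesis using j by simp
qed simp

lemma side_le_powr: "1 \<le> n \<Longrightarrow> real (side n) \<le> 2 * real n powr (1 / D)"
proof -
  assume n: "1 \<le> n"
  show ?thesis
  proof (cases "side n = 1")
    case True
    then show ?thesis using n ge_one_powr_ge_zero[of "real n" "1 / D"] by simp
  next
    case False
    then obtain j where j: "side n = 2 * 2 ^ j" "(2 ^ j) ^ D < n" using side_half by blast
    have "real ((2 ^ j) ^ D) \<le> real n" using j(2) by (intro of_nat_mono) simp
    then have "(real (2 ^ j) ^ D) powr (1 / D) \<le> real n powr (1 / D)"
      by (intro powr_mono2) auto
    moreover have "(real (2 ^ j) ^ D) powr (1 / D) = real (2 ^ j)"
      using D by (subst powr_realpow[symmetric]) (auto simp: powr_powr)
    ultimately show ?thesis using j by simp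
  qed
qed

lemma ex_trials: "\<exists>j. (m::nat) ^ R < 2 ^ (2 ^ j)"
proof
  show "m ^ R < 2 ^ (2 ^ (m ^ R))" using less_exp[of "m ^ R"] less_exp[of "2 ^ (m ^ R)"] by (meson less_trans)
qed

lemma trials: "m ^ R < 2 ^ trials m"
  unfolding trials_def using LeastI_ex[OF ex_trials] .

lemma less_two_trials: "m < 2 ^ trials m"
  using trials[of m] self_le_power[of m R] R by (cases "m = 0") auto

lemma trials_pos: "trials m > 0" by (simp add: trials_def)

lemma trials_minimal: "2 ^ (2 ^ j) \<le> m ^ R \<Longrightarrow> 2 * 2 ^ j \<le> trials m"
proof -
  assume a: "2 ^ (2 ^ j) \<le> m ^ R"
  have "\<not> (LEAST j. m ^ R < 2 ^ (2 ^ j)) \<le> j"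
  proof
    assume "(LEAST j. m ^ R < 2 ^ (2 ^ j)) \<le> j"
    then have "(2::nat) ^ trials m \<le> 2 ^ (2 ^ j)" unfolding trials_def by (intro power_increasing) auto
    then show False using trials[of m] a by linarith
  qed
  then have "Suc j \<le> (LEAST j. m ^ R < 2 ^ (2 ^ j))" by simp
  then have "2 ^ Suc j \<le> trials m" unfolding trials_def by (rule power_increasing) simp
  then show ?thesis by simp
qed

lemma trials_le: "1 \<le> m \<Longrightarrow> real (trials m) \<le> 1 + 2 * R * log 2 m"
proof (cases "LEAST j. m ^ R < 2 ^ (2 ^ j)")
  case 0
  assume "1 \<le> m"
  then show ?thesis using 0 by (simp add: trials_def)
next
  case (Suc j)
  assume m: "1 \<le> m"
  have "\<not> m ^ R < 2 ^ (2 ^ j)" using not_less_Least[of j "\<lambda>j. m ^ R < 2 ^ (2 ^ j)"] Suc by simp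
  then have "real (2 ^ (2 ^ j)) \<le> real (m ^ R)" by (intro of_nat_mono) simp
  then have "log 2 (real (2 ^ (2 ^ j))) \<le> log 2 (real (m ^ R))"
    using m by (intro log_mono) auto
  then have "real (2 ^ j) \<le> R * log 2 m" using m by (simp add: log_nat_power)
  then show ?thesis using Suc by (simp add: trials_def)
qed

lemma bins_pos: "1 \<le> n \<Longrightarrow> bins n > 0"
  by (simp add: bins_def side_pos)

lemma hash_less: "1 \<le> n \<Longrightarrow> hash n m w x < bins n"
  by (simp add: hash_def bucket_def bins_pos)

lemma ex_good:
  assumes n: "1 \<le> n" and A: "A \<in> storable n m"
  shows "\<exists>w < seed_base n m ^ (D + 2). good n m A w"
proof -
  let ?N = "bins n" and ?E = "seed_base n m"
  have A': "A \<subseteq> {1..m}" "card A \<le> n" using A by (auto simp: storable_def)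
  then have fin: "finite A" using finite_subset by blast
  obtain q where q: "prime q" "?N \<le> q" "q \<le> 16 * (bins n + n\<^sup>2 * trials m + 1)\<^sup>2" "inj_on (\<lambda>x. x mod q) A"
    using ex_prime_injective_mod[OF A' less_two_trials refl] by blast
  have qE: "q < ?E" using q(3) by (simp add: seed_base_def)
  \<comment> \<open>The factor 4 in \<open>bins\<close> outweighs the loss \<open>2 ^ Suc D\<close>
    of the counting argument as \<open>2 <= D\<close>, and \<open>side n ^ D\<close> supplies the
    missing factor \<open>n\<close>.\<close>
  have "(2::nat) ^ Suc D < 2 ^ (2 * D)" using D by (intro power_strict_increasing) auto
  also have "(2::nat) ^ (2 * D) = 4 ^ D" by (simp add: power_mult)
  finally have 2: "2 ^ Suc D < (4::nat) ^ D" .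
  have "n ^ Suc D * 2 ^ Suc D < n ^ Suc D * 4 ^ D" using 2 n by (intro mult_strict_left_mono) auto
  also have "\<dots> = n ^ D * 4 ^ D * n" by simp
  also have "\<dots> \<le> n ^ D * 4 ^ D * side n ^ D" by (intro mult_le_mono2 side)
  also have "\<dots> = ?N ^ D" by (simp add: bins_def power_mult_distrib)
  finally have less: "n ^ Suc D * 2 ^ Suc D < ?N ^ D" .
  obtain v where v: "\<forall>b. card {x\<in>A. horner q (Suc D) v x mod q mod ?N = b} \<le> D"
    using card_overloading_seeds[OF q(1) fin A'(2) q(4) bins_pos[OF n] q(2) less] by blast
  obtain w where w: "w < ?E ^ Suc D" "\<forall>x. horner ?E (Suc D) w x = horner q (Suc D) v x"
    using horner_change_base[of q ?E "Suc D" v] qE prime_gt_0_nat[OF q(1)] by auto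
  \<comment> \<open>The prime becomes the lowest digit below the \<open>Suc D\<close> coefficients,
    which makes \<open>D + 2\<close> digits.\<close>
  have "q + ?E * w < ?E * Suc w" using qE by simp
  also have "\<dots> \<le> ?E * ?E ^ Suc D" using w(1) by (intro mult_le_mono2) simp
  finally have "q + ?E * w < ?E ^ (D + 2)" by simp
  moreover have "hash n m (q + ?E * w) x = horner q (Suc D) v x mod q mod ?N" for x
    using qE w(2) by (simp add: hash_def bucket_def del: horner.simps)
  ultimately show ?thesis using v unfolding good_def by (intro exI[of _ "q + ?E * w"]) (simp del: horner.simps)
qed

section \<open>Positions in the storage and the probability of error\<close>

lemma nth_prime_less_modulus: "t < trials m \<Longrightarrow> nth_prime t < modulus m"
proof -
  assume "t < trials m"
  then have "t \<le> trials m - 1" by simp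
  then have "nth_prime t \<le> nth_prime (trials m - 1)"
    using nth_prime_less_iff[of "trials m - 1" t] by simp
  then show ?thesis by (simp add: modulus_def)
qed

lemma modulus_le: "modulus m \<le> 16 * (trials m)\<^sup>2 + 1"
  using nth_prime_le[of "trials m - 1" "trials m"] trials_pos[of m] by (simp add: modulus_def)

lemma position_bounds:
  assumes "1 \<le> n" "t < trials m"
  shows "n \<le> position n m w x t" "position n m w x t < n + bins n * trials m * modulus m"
proof -
  show "n \<le> position n m w x t" by (simp add: position_def)
  have "x mod nth_prime t < modulus m"
    using nth_prime_less_modulus[OF assms(2)] prime_gt_0_nat[OF prime_nth_prime[of t]]
    by (meson less_trans mod_less_divisor)
  then have "position n m w x t < n + Suc (hash n m w x * trials m + t) * modulus m"
    by (simp add: position_def)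
  also have "Suc (hash n m w x * trials m + t) \<le> Suc (hash n m w x) * trials m" using assms(2) by simp
  also have "\<dots> \<le> bins n * trials m" using hash_less[OF assms(1)] by (intro mult_le_mono1) (simp add: Suc_le_eq)
  finally show "position n m w x t < n + bins n * trials m * modulus m" by simp
qed

lemma position_eq_imp:
  assumes "position n m w a t' = position n m w x t" "t < trials m" "t' < trials m"
  shows "hash n m w a = hash n m w x \<and> t' = t \<and> a mod nth_prime t = x mod nth_prime t"
proof -
  have less: "y mod nth_prime s < modulus m" if "s < trials m" for y s
    using nth_prime_less_modulus[OF that] prime_gt_0_nat[OF prime_nth_prime[of s]]
    by (meson less_trans mod_less_divisor)
  have eq: "(hash n m w a * trials m + t') * modulus m + a mod nth_prime t' =
    (hash n m w x * trials m + t) * modulus m + x mod nth_prime t"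
    using assms(1) by (simp add: position_def)
  have d: "(c * k + r) div k = c" "(c * k + r) mod k = r" if "r < k" for c k r :: nat
    using that by auto
  have 1: "hash n m w a * trials m + t' = hash n m w x * trials m + t"
    using arg_cong[OF eq, of "\<lambda>z. z div modulus m"] d(1)[OF less[OF assms(3)]] d(1)[OF less[OF assms(2)]] by simp
  have 2: "a mod nth_prime t' = x mod nth_prime t"
    using arg_cong[OF eq, of "\<lambda>z. z mod modulus m"] d(2)[OF less[OF assms(3)]] d(2)[OF less[OF assms(2)]] by simp
  have 3: "hash n m w a = hash n m w x"
    using arg_cong[OF 1, of "\<lambda>z. z div trials m"] d(1)[OF assms(3)] d(1)[OF assms(2)] by simp
  then show ?thesis using 1 2 by simp
qed

text \<open>If \<open>c\<close> of the primes divide a difference, then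
  \<open>2 ^ (R * c) <= m ^ R < 2 ^ trials m\<close>, so \<open>R * c <= trials m - 1\<close>.
  Summing over at most \<open>D\<close> elements of the bucket gives less than
  \<open>D * trials m <= \<epsilon> * R * trials m\<close>; the \<open>- 1\<close> makes the bound
  strict.\<close>

lemma error_bound:
  fixes \<epsilon> :: real
  assumes A: "A \<in> storable n m" and x: "x \<in> {1..m}" "x \<notin> A" and w: "good n m A w"
    and \<epsilon>: "\<epsilon> > 0" "D \<le> \<epsilon> * R"
  shows "card {t. t < trials m \<and> (\<exists>a\<in>A. \<exists>t'<trials m. position n m w x t = position n m w a t')} / trials m < \<epsilon>"
proof -
  let ?T = "trials m"
  let ?A = "{a\<in>A. hash n m w a = hash n m w x}"
  define d where "d = (\<lambda>a. max a x - min a x)"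
  let ?bad = "\<lambda>a. {t. t < ?T \<and> nth_prime t dvd d a}"
  have fin: "finite A" using A finite_subset by (auto simp: storable_def)
  have "{t. t < ?T \<and> (\<exists>a\<in>A. \<exists>t'<?T. position n m w x t = position n m w a t')} \<subseteq> (\<Union>a\<in>?A. ?bad a)"
  proof
    fix t assume "t \<in> {t. t < ?T \<and> (\<exists>a\<in>A. \<exists>t'<?T. position n m w x t = position n m w a t')}"
    then obtain a t' where t: "t < ?T" "a \<in> A" "t' < ?T" "position n m w a t' = position n m w x t" by auto
    note e = position_eq_imp[OF t(4) t(1) t(3)]
    then have "max a x mod nth_prime t = min a x mod nth_prime t" by (simp add: max_def min_def)
    then have "nth_prime t dvd d a" unfolding d_def by (subst mod_eq_dvd_iff_nat[symmetric]) auto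
    then show "t \<in> (\<Union>a\<in>?A. ?bad a)" using t e by auto
  qed
  then have "card {t. t < ?T \<and> (\<exists>a\<in>A. \<exists>t'<?T. position n m w x t = position n m w a t')}
    \<le> card (\<Union>a\<in>?A. ?bad a)" (is "card ?X \<le> _")
    using fin by (intro card_mono) auto
  also have "\<dots> \<le> (\<Sum>a\<in>?A. card (?bad a))" using fin by (intro card_UN_le) auto
  finally have "R * card ?X \<le> R * (\<Sum>a\<in>?A. card (?bad a))" by (rule mult_le_mono2)
  also have "\<dots> = (\<Sum>a\<in>?A. R * card (?bad a))" by (rule sum_distrib_left)
  also have "\<dots> \<le> (\<Sum>a\<in>?A. ?T - 1)"
  proof (rule sum_mono)
    fix a assume a: "a \<in> ?A"
    then have am: "a \<in> {1..m}" "a \<noteq> x" using A x by (auto simp: storable_def)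
    have d: "0 < d a" "d a \<le> m" using am x by (auto simp: d_def max_def min_def)
    have "card (?bad a) = card (nth_prime ` ?bad a)"
      by (rule card_image[symmetric]) (auto intro: inj_onI simp: nth_prime_eq_iff)
    moreover have "2 ^ card (nth_prime ` ?bad a) \<le> d a"
      using d by (intro two_power_card_primes_le) (auto simp: prime_nth_prime)
    ultimately have "2 ^ card (?bad a) \<le> m" using d by simp
    then have "(2 ^ card (?bad a)) ^ R \<le> m ^ R" by (rule power_mono) simp
    then have "(2::nat) ^ (R * card (?bad a)) \<le> m ^ R" by (simp add: power_mult[symmetric] mult.commute)
    also have "\<dots> < 2 ^ ?T" by (rule trials)
    finally have "R * card (?bad a) < ?T" by simp
    then show "R * card (?bad a) \<le> ?T - 1" by simp
  qed
  also have "\<dots> \<le> D * (?T - 1)" using w by (simp add: good_def)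
  also have "\<dots> < D * ?T" using D trials_pos[of m] by simp
  finally have "real (R * card ?X) < real (D * ?T)" by (simp only: of_nat_less_iff)
  also have "\<dots> \<le> \<epsilon> * R * ?T" using \<epsilon>(2) by (simp add: mult_right_mono)
  finally have "real R * card ?X < real R * (\<epsilon> * ?T)" by (simp add: mult_ac)
  then have "card ?X < \<epsilon> * ?T" using R by simp
  then show ?thesis using trials_pos[of m] by (simp add: field_simps)
qed

end

section \<open>Computing the parameters\<close>

lemma upd_apply: "upd s a i v b j = (if b = a \<and> j = i then v else s b j)"
  by (simp add: upd_def)

text \<open>Up to the factor \<^const>\<open>time_factor\<close>, which depends on the program only, \<open>X\<close> bounds the time.\<close>

definition runs_in :: "nat \<Rightarrow> prog \<Rightarrow> mem \<Rightarrow> (mem \<Rightarrow> bool) \<Rightarrow> bool" where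
  "runs_in X c s Q \<longleftrightarrow> runs c s (time_factor c * X) Q"

lemma growth_pos: "1 \<le> growth c"
  by (induction c) auto

text \<open>The bound \<open>X\<close> is shared instead of added: \<open>time_factor\<close>
  already sums over the two parts, and \<open>growth\<close> is at least 1.\<close>

lemma runs_in_seq:
  assumes "runs_in X c1 s Q" and "\<And>s'. Q s' \<Longrightarrow> runs_in X c2 s' Q'"
  shows "runs_in X (Seq c1 c2) s Q'"
  unfolding runs_in_def
proof (rule runs_weaken[OF runs_seq])
  show "runs c1 s (time_factor c1 * X) Q" using assms(1) by (simp add: runs_in_def)
  show "runs c2 s' (time_factor c2 * X) Q'" if "Q s'" for s' using assms(2)[OF that] by (simp add: runs_in_def)
  have "1 * (time_factor c2 * X) \<le> growth c1 * (time_factor c2 * X)" using growth_pos by (rule mult_le_mono1)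
  then show "time_factor c1 * X + time_factor c2 * X \<le> time_factor (Seq c1 c2) * X"
    by (simp add: algebra_simps)
qed

lemma runs_in_loopfree:
  assumes "loopfree c" "mem_bounded l s" "l \<le> X" "wp c Q s"
  shows "runs_in X c s Q"
  unfolding runs_in_def
  by (rule runs_weaken[OF runs_loopfree[OF assms(1,2,4)]]) (use assms(3) in auto)

lemma runs_in_while:
  assumes "loopfree c" "I v s" "Suc v * l \<le> X"
    and "\<And>v s. I v s \<Longrightarrow> mem_bounded l s"
    and "\<And>v s. I v s \<Longrightarrow> val e s \<noteq> 0 \<Longrightarrow> wp c (\<lambda>s'. \<exists>v'<v. I v' s') s"
  shows "runs_in X (While e c) s (\<lambda>s'. (\<exists>v'. I v' s') \<and> val e s' = 0)"
  unfolding runs_in_def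
proof (rule runs_weaken[OF runs_while[OF assms(1,2,4,5)]])
  have "time_factor (While e c) * (Suc v * l) \<le> time_factor (While e c) * X"
    using assms(3) by (rule mult_le_mono2)
  then show "Suc v * (time_factor (While e c) * l) \<le> time_factor (While e c) * X"
    by (simp only: ac_simps)
qed auto

lemma runs_in_weaken: "runs_in X c s Q \<Longrightarrow> X \<le> X' \<Longrightarrow> (\<And>s'. Q s' \<Longrightarrow> Q' s') \<Longrightarrow> runs_in X' c s Q'"
  unfolding runs_in_def by (erule runs_weaken) auto

text \<open>Translates the guard of the prime search, which counts primes, into a bound on the
  candidate.\<close>

lemma card_primes_less_iff:
  assumes "T > 0"
  shows "card {q. prime q \<and> q < p} < T \<longleftrightarrow> p \<le> nth_prime (T - 1)"
proof
  assume c: "card {q. prime q \<and> q < p} < T"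
  show "p \<le> nth_prime (T - 1)"
  proof (rule ccontr)
    assume less: "\<not> ?thesis"
    have "nth_prime i < p" if "i < T" for i
    proof -
      have "\<not> T - 1 < i" using that by linarith
      then show ?thesis using less nth_prime_less_iff[of "T - 1" i] by linarith
    qed
    then have "nth_prime ` {..<T} \<subseteq> {q. prime q \<and> q < p}" by (auto simp: prime_nth_prime)
    then have "card (nth_prime ` {..<T}) \<le> card {q. prime q \<and> q < p}" by (rule card_mono[rotated]) simp
    moreover have "card (nth_prime ` {..<T}) = T"
      by (subst card_image) (auto intro: inj_onI simp: nth_prime_eq_iff)
    ultimately show False using c by simp
  qed
next
  assume "p \<le> nth_prime (T - 1)"
  then have "card {q. prime q \<and> q < p} \<le> card {q. prime q \<and> q < nth_prime (T - 1)}"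
    by (intro card_mono) auto
  then show "card {q. prime q \<and> q < p} < T" using assms card_primes_below_nth_prime[of "T - 1"] by simp
qed

abbreviation Var :: "nat \<Rightarrow> expr" where "Var i \<equiv> Load 2 (Const i)"
abbreviation Assign :: "nat \<Rightarrow> expr \<Rightarrow> prog" where "Assign i e \<equiv> Store 2 (Const i) e"

primrec power_expr :: "expr \<Rightarrow> nat \<Rightarrow> expr" where
  "power_expr e 0 = Const 1"
| "power_expr e (Suc k) = Bin Times e (power_expr e k)"

lemma val_power_expr [simp]: "val (power_expr e k) s = val e s ^ k"
  by (induction k) auto

context params
begin

text \<open>The variables (cells of array 2) are
  0: \<^term>\<open>side n\<close>, 1: \<^term>\<open>trials m\<close>, 2: \<^term>\<open>2 ^ trials m\<close>, 3: number of primes found,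
  4: candidate prime, finally \<^term>\<open>modulus m\<close>, 5: squared factorial, 6: \<^term>\<open>bins n\<close>, 7: \<^term>\<open>seed_base n m\<close>,
  8: seed, 9: loop counter, 10: random trial, 11: loop counter, 12: coin, 13: size of the stored set.
  Array 3 holds the primes and array 4 the loads of the buckets, separately for every seed.\<close>

definition side_prog :: prog where
  "side_prog = Seq (Assign 0 (Const 1))
    (While (Bin Less (power_expr (Var 0) D) (Load 0 (Const 1))) (Assign 0 (Bin Times (Const 2) (Var 0))))"

definition trials_prog :: prog where
  "trials_prog = Seq (Seq (Assign 1 (Const 1)) (Assign 2 (Const 2)))
    (While (Bin Less (Var 2) (Bin Plus (power_expr (Load 0 (Const 2)) R) (Const 1)))
      (Seq (Assign 1 (Bin Times (Const 2) (Var 1))) (Assign 2 (Bin Times (Var 2) (Var 2)))))"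

definition primes_prog :: prog where
  "primes_prog = Seq (Seq (Assign 3 (Const 0)) (Seq (Assign 4 (Const 2)) (Assign 5 (Const 1))))
    (While (Bin Less (Var 3) (Var 1))
      (Seq (Cond (Bin Mod (Var 5) (Var 4))
          (Seq (Store 3 (Var 3) (Var 4)) (Assign 3 (Bin Plus (Var 3) (Const 1)))) Skip)
        (Seq (Assign 5 (Bin Times (Var 5) (power_expr (Var 4) 2)))
          (Assign 4 (Bin Plus (Var 4) (Const 1))))))"

definition sizes_prog :: prog where
  "sizes_prog = Seq (Assign 6 (Bin Times (Bin Times (Const 4) (Load 0 (Const 1))) (Var 0)))
    (Assign 7 (Bin Plus (Bin Times (Const 16) (power_expr (Bin Plus (Bin Plus (Var 6)
      (Bin Times (power_expr (Load 0 (Const 1)) 2) (Var 1))) (Const 1)) 2)) (Const 1)))"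

definition setup_prog :: prog where
  "setup_prog = Seq side_prog (Seq trials_prog (Seq primes_prog sizes_prog))"

text \<open>A common bound on the lengths of all numbers in memory:
  \<open>3 * (modulus m)\<^sup>2\<close> covers the squared factorials, \<open>D + 3\<close> the
  \<open>D + 2\<close> digits of a seed with one unit to spare, and the constants are slack.\<close>

definition width :: "nat \<Rightarrow> nat" where
  "width m = (D + 3) * (20 * trials m + 3 * (modulus m)\<^sup>2 + 20)"

lemma len_le_width: "v < 2 ^ k \<Longrightarrow> k < width m \<Longrightarrow> len v \<le> width m"
  using len_leI[of v k] by simp

lemma width_ge: "20 * trials m + 3 * (modulus m)\<^sup>2 + D + 20 \<le> width m"
proof -
  have "X + D \<le> (D + 3) * X" if "1 \<le> X" for X
  proof -
    have "D * 1 \<le> D * X" using that by (rule mult_le_mono2)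
    then show ?thesis unfolding distrib_right by linarith
  qed
  from this[of "20 * trials m + 3 * (modulus m)\<^sup>2 + 20"] show ?thesis
    unfolding width_def by (simp only: ac_simps)
qed

lemma trials_less_modulus: "trials m < modulus m"
proof -
  have "k < nth_prime k" for k
  proof (induction k)
    case 0
    then show ?case using prime_gt_0_nat[OF prime_nth_prime] .
  next
    case (Suc k)
    then show ?case using nth_prime_less_iff[of k "Suc k"] by simp
  qed
  from this[of "trials m - 1"] show ?thesis using trials_pos[of m] unfolding modulus_def by simp
qed

lemma width_le: "width m \<le> modulus m * width m"
  using trials_less_modulus[of m] by (cases "modulus m") auto

lemma modulus_less_square: "modulus m \<le> (modulus m)\<^sup>2"
  by (simp add: power2_eq_square)

lemma len_modulus: "v \<le> modulus m \<Longrightarrow> len v \<le> width m"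
  using width_ge[of m] modulus_less_square[of m] le_less_trans[OF _ less_exp, of v "modulus m"]
  by (intro len_le_width[of v "modulus m"]) auto

lemma len_trials: "v < 2 ^ (20 * trials m) \<Longrightarrow> len v \<le> width m"
  using width_ge[of m] by (intro len_le_width) auto

lemma len_fact: "p \<le> modulus m \<Longrightarrow> len ((fact p)\<^sup>2) \<le> width m"
proof -
  assume p: "p \<le> modulus m"
  let ?M = "modulus m"
  have "fact p \<le> (fact ?M :: nat)" using p by (rule fact_mono)
  also have "\<dots> \<le> ?M ^ ?M" using fact_le_power[of ?M, where 'a = nat] by simp
  also have "\<dots> \<le> (2 ^ ?M) ^ ?M" using less_exp[of ?M] by (intro power_mono) auto
  also have "\<dots> = 2 ^ (?M\<^sup>2)" by (simp add: power_mult power2_eq_square)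
  finally have "(fact p)\<^sup>2 \<le> ((2::nat) ^ (?M\<^sup>2))\<^sup>2" by (intro power_mono) auto
  also have "\<dots> = 2 ^ (2 * ?M\<^sup>2)" by (metis power_mult mult.commute)
  also have "\<dots> < 2 ^ (2 * ?M\<^sup>2 + 1)" by simp
  finally show ?thesis using width_ge[of m] by (intro len_le_width[of _ "2 * ?M\<^sup>2 + 1"]) auto
qed

lemma len_le_m:
  assumes "v \<le> m"
  shows "len v \<le> width m"
proof -
  have "v < 2 ^ trials m" using assms less_two_trials[of m] by simp
  also have "\<dots> \<le> 2 ^ (20 * trials m)" by (rule power_increasing) auto
  finally show ?thesis by (rule len_trials)
qed

lemma side_less: "1 \<le> n \<Longrightarrow> n \<le> m \<Longrightarrow> side n < 2 ^ (trials m + 1)"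
  using side_le[of n] less_two_trials[of m] by simp

lemma bins_less: "1 \<le> n \<Longrightarrow> n \<le> m \<Longrightarrow> bins n < 2 ^ (2 * trials m + 3)"
proof -
  assume n: "1 \<le> n" "n \<le> m"
  let ?p = "(2::nat) ^ trials m"
  have "bins n \<le> 8 * (n * n)" using side_le[OF n(1)] by (simp add: bins_def)
  also have "\<dots> < 8 * (?p * ?p)" using n less_two_trials[of m]
    by (intro mult_strict_left_mono mult_strict_mono') auto
  also have "\<dots> = 2 ^ (2 * trials m + 3)" unfolding mult_2 power_add by simp
  finally show ?thesis .
qed

lemma seed_base_less:
  assumes n: "1 \<le> n" "n \<le> m"
  shows "seed_base n m < 2 ^ (6 * trials m + 13)"
proof -
  let ?T = "trials m"
  let ?Y = "bins n + n\<^sup>2 * ?T + 1"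
  have "n\<^sup>2 * ?T \<le> (2 ^ ?T)\<^sup>2 * 2 ^ ?T"
    using n less_two_trials[of m] less_exp[of ?T] by (intro mult_le_mono power_mono) auto
  also have "\<dots> = 2 ^ (3 * ?T)" unfolding power2_eq_square power_add[symmetric] by simp
  finally have 1: "n\<^sup>2 * ?T \<le> 2 ^ (3 * ?T)" .
  have "bins n < 2 ^ (2 * ?T + 3)" by (rule bins_less[OF n])
  also have "\<dots> \<le> 2 ^ (3 * ?T + 3)" by (intro power_increasing) auto
  finally have "?Y \<le> 2 ^ (3 * ?T + 3) + 2 ^ (3 * ?T)" using 1 by simp
  also have "\<dots> \<le> 2 ^ (3 * ?T + 4)" unfolding power_add by simp
  finally have "?Y\<^sup>2 \<le> (2 ^ (3 * ?T + 4))\<^sup>2" by (rule power_mono) simp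
  also have "\<dots> = 2 ^ (6 * ?T + 8)" unfolding power2_eq_square power_add[symmetric] by simp
  finally have "seed_base n m \<le> 16 * 2 ^ (6 * ?T + 8) + 1" by (simp add: seed_base_def)
  also have "\<dots> < 2 ^ (6 * ?T + 13)"
  proof -
    define z where "z = (2::nat) ^ (6 * ?T)"
    have "1 \<le> z" by (simp add: z_def)
    then show ?thesis by (simp add: power_add flip: z_def)
  qed
  finally show ?thesis .
qed

definition seeds :: "nat \<Rightarrow> nat \<Rightarrow> nat" where "seeds n m = seed_base n m ^ (D + 2)"

lemma seeds_less:
  assumes n: "1 \<le> n" "n \<le> m"
  shows "seeds n m < 2 ^ (width m - 1)"
proof -
  have "seeds n m < (2 ^ (6 * trials m + 13)) ^ (D + 2)"
    unfolding seeds_def by (rule power_strict_mono[OF seed_base_less[OF n]]) auto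
  also have "\<dots> = 2 ^ ((6 * trials m + 13) * (D + 2))" by (rule power_mult[symmetric])
  also have "\<dots> \<le> 2 ^ (width m - 1)"
  proof (rule power_increasing)
    let ?X = "20 * trials m + 3 * (modulus m)\<^sup>2 + 20"
    have "(6 * trials m + 13) * (D + 2) \<le> ?X * (D + 2)" by (rule mult_le_mono1) simp
    moreover have "width m = ?X * (D + 2) + ?X" unfolding width_def by (simp add: algebra_simps)
    ultimately show "(6 * trials m + 13) * (D + 2) \<le> width m - 1" by linarith
  qed simp
  finally show ?thesis .
qed

lemma len_seeds: "1 \<le> n \<Longrightarrow> n \<le> m \<Longrightarrow> w \<le> seeds n m \<Longrightarrow> len w \<le> width m"
  using seeds_less[of n m] width_ge[of m] by (intro len_le_width[of w "width m - 1"]) auto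

lemma len_le_two: "len 0 \<le> width m" "len 1 \<le> width m" "len 2 \<le> width m"
  using trials_less_modulus[of m] trials_pos[of m] by (auto intro!: len_modulus)

text \<open>Encoder and query share the setup, so both work with identical parameters. It leaves
  their inputs and the zeros of array 4 intact.\<close>

definition setup_ok :: "nat \<Rightarrow> nat \<Rightarrow> mem \<Rightarrow> mem \<Rightarrow> bool" where
  "setup_ok n m s0 s \<longleftrightarrow> s 2 1 = trials m \<and> s 2 4 = modulus m \<and> s 2 6 = bins n \<and> s 2 7 = seed_base n m \<and>
    (\<forall>i<trials m. s 3 i = nth_prime i) \<and> (\<forall>a i. a \<noteq> 2 \<and> a \<noteq> 3 \<longrightarrow> s a i = s0 a i) \<and> mem_bounded (width m) s"

section \<open>Correctness of the setup program\<close>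

context
  fixes n m :: nat and s0 :: mem
  assumes n: "1 \<le> n" "n \<le> m" and s0: "s0 0 1 = n" "s0 0 2 = m" "mem_bounded (width m) s0"
begin

definition side_ok where
  "side_ok s \<longleftrightarrow> s 2 0 = side n \<and> (\<forall>a i. a \<noteq> 2 \<longrightarrow> s a i = s0 a i) \<and> mem_bounded (width m) s"

lemma runs_side: "runs_in (modulus m * width m) side_prog s0 side_ok"
  unfolding side_prog_def
proof (rule runs_in_seq)
  \<comment> \<open>\<open>v\<close> is the number of doublings still to be made.\<close>
  define I where "I = (\<lambda>v s. (\<exists>j. s 2 0 = 2 ^ j \<and> side n = 2 ^ (j + v)) \<and> (\<forall>a i. a \<noteq> 2 \<longrightarrow> s a i = s0 a i) \<and> mem_bounded (width m) s)"
  define J where "J = (LEAST j. n \<le> (2 ^ j) ^ D)"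
  have J: "side n = 2 ^ J" by (simp add: side_def J_def)
  show "runs_in (modulus m * width m) (Assign 0 (Const 1)) s0 (I J)"
    by (rule runs_in_loopfree[OF _ s0(3) width_le]) (use J s0 len_le_two in \<open>auto simp: I_def upd_apply intro!: mem_bounded_upd exI[of _ 0]\<close>)
  fix s assume I: "I J s"
  have "J < trials m + 1"
    by (rule power_less_imp_less_exp[of 2]) (use side_less[OF n] J in simp_all)
  then have "Suc J \<le> modulus m" using trials_less_modulus[of m] by simp
  then have time: "Suc J * width m \<le> modulus m * width m" by (rule mult_le_mono1)
  let ?e = "Bin Less (power_expr (Var 0) D) (Load 0 (Const 1))"
  show "runs_in (modulus m * width m) (While ?e (Assign 0 (Bin Times (Const 2) (Var 0)))) s side_ok"
  proof (rule runs_in_weaken[OF runs_in_while[where I = I, OF _ I time]])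
    fix v s assume I: "I v s" and e: "val ?e s \<noteq> 0"
    then obtain j where j: "s 2 0 = 2 ^ j" "side n = 2 ^ (j + v)" "(2 ^ j) ^ D < n"
      using s0 by (auto simp: I_def split: if_splits)
    from side_minimal[OF j(3)] have "2 ^ Suc j \<le> (2::nat) ^ (j + v)" using j(2) by simp
    then have "Suc j \<le> j + v" by (rule power_le_imp_le_exp[rotated]) simp
    then obtain v' where v: "v = Suc v'" by (cases v) auto
    have "2 * 2 ^ j \<le> side n" by (rule side_minimal[OF j(3)])
    also have "\<dots> < 2 ^ (20 * trials m)"
      by (rule less_le_trans[OF side_less[OF n]], rule power_increasing) (use trials_pos[of m] in auto)
    finally have "len (2 * 2 ^ j) \<le> width m" by (rule len_trials)
    then have "I v' (upd s 2 0 (2 * 2 ^ j))"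
      using I j v by (auto simp: I_def upd_apply intro!: mem_bounded_upd exI[of _ "Suc j"])
    then show "wp (Assign 0 (Bin Times (Const 2) (Var 0))) (\<lambda>s'. \<exists>v'<v. I v' s') s"
      using j v by auto
  next
    fix s assume "(\<exists>v'. I v' s) \<and> val ?e s = 0"
    then obtain v j where j: "I v s" "s 2 0 = 2 ^ j" "side n = 2 ^ (j + v)" "n \<le> (2 ^ j) ^ D"
      using s0 by (auto simp: I_def split: if_splits)
    have "side n \<le> 2 ^ j" unfolding side_def by (intro power_increasing Least_le j(4)) auto
    then have "v = 0" using j(3) by simp
    then show "side_ok s" using j by (simp add: I_def side_ok_def)
  qed (auto simp: I_def)
qed

definition trials_ok where
  "trials_ok s \<longleftrightarrow> s 2 0 = side n \<and> s 2 1 = trials m \<and> (\<forall>a i. a \<noteq> 2 \<longrightarrow> s a i = s0 a i) \<and> mem_bounded (width m) s"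

lemma runs_trials:
  assumes "side_ok s1"
  shows "runs_in (modulus m * width m) trials_prog s1 trials_ok"
  unfolding trials_prog_def
proof (rule runs_in_seq)
  \<comment> \<open>Cell 2 carries \<open>2 ^ (2 ^ j)\<close> along: doubling the exponent is one
    squaring, and the guard compares with \<open>m ^ R\<close> directly.\<close>
  define I where "I = (\<lambda>v s. (\<exists>j. s 2 1 = 2 ^ j \<and> s 2 2 = 2 ^ (2 ^ j) \<and> trials m = 2 ^ (j + v)) \<and> s 2 0 = side n \<and>
    (\<forall>a i. a \<noteq> 2 \<longrightarrow> s a i = s0 a i) \<and> mem_bounded (width m) s)"
  define J where "J = (LEAST j. m ^ R < 2 ^ (2 ^ j))"
  have J: "trials m = 2 ^ J" by (simp add: trials_def J_def)
  have b: "mem_bounded (width m) s1" using assms by (simp add: side_ok_def)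
  show "runs_in (modulus m * width m) (Seq (Assign 1 (Const 1)) (Assign 2 (Const 2))) s1 (I J)"
    by (rule runs_in_loopfree[OF _ b width_le]) (use J assms len_le_two in \<open>auto simp: side_ok_def I_def upd_apply intro!: mem_bounded_upd exI[of _ 0]\<close>)
  fix s assume I: "I J s"
  have "Suc J \<le> modulus m" using trials_less_modulus[of m] J less_exp[of J] by linarith
  then have time: "Suc J * width m \<le> modulus m * width m" by (rule mult_le_mono1)
  let ?e = "Bin Less (Var 2) (Bin Plus (power_expr (Load 0 (Const 2)) R) (Const 1))"
  let ?c = "Seq (Assign 1 (Bin Times (Const 2) (Var 1))) (Assign 2 (Bin Times (Var 2) (Var 2)))"
  show "runs_in (modulus m * width m) (While ?e ?c) s trials_ok"
  proof (rule runs_in_weaken[OF runs_in_while[where I = I, OF _ I time]])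
    fix v s assume I: "I v s" and e: "val ?e s \<noteq> 0"
    then obtain j where j: "s 2 1 = 2 ^ j" "s 2 2 = 2 ^ (2 ^ j)" "trials m = 2 ^ (j + v)" "2 ^ (2 ^ j) \<le> m ^ R"
      using s0 by (auto simp: I_def split: if_splits)
    from trials_minimal[OF j(4)] have "2 ^ Suc j \<le> (2::nat) ^ (j + v)" using j(3) by simp
    then have "Suc j \<le> j + v" by (rule power_le_imp_le_exp[rotated]) simp
    then obtain v' where v: "v = Suc v'" by (cases v) auto
    have le: "2 * 2 ^ j \<le> trials m" by (rule trials_minimal[OF j(4)])
    then have 1: "len (2 * 2 ^ j) \<le> width m" using trials_less_modulus[of m] by (intro len_modulus) simp
    have sq: "2 ^ (2 ^ j) * 2 ^ (2 ^ j) = (2::nat) ^ (2 * 2 ^ j)" unfolding mult_2 power_add ..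
    have "(2::nat) ^ (2 * 2 ^ j) \<le> 2 ^ trials m" using le by (intro power_increasing) auto
    also have "\<dots> < 2 ^ (20 * trials m)" using trials_pos[of m] by (intro power_strict_increasing) auto
    finally have 2: "len (2 ^ (2 ^ j) * 2 ^ (2 ^ j)) \<le> width m" unfolding sq by (rule len_trials)
    have "I v' (upd (upd s 2 1 (2 * 2 ^ j)) 2 2 (2 ^ (2 ^ j) * 2 ^ (2 ^ j)))"
      using I j v 1 2 sq by (auto simp: I_def upd_apply intro!: mem_bounded_upd exI[of _ "Suc j"])
    then show "wp ?c (\<lambda>s'. \<exists>v'<v. I v' s') s"
      using j v by (auto simp: upd_apply)
  next
    fix s assume "(\<exists>v'. I v' s) \<and> val ?e s = 0"
    then obtain v j where j: "I v s" "s 2 1 = 2 ^ j" "trials m = 2 ^ (j + v)" "m ^ R < 2 ^ (2 ^ j)"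
      using s0 by (auto simp: I_def split: if_splits)
    have "trials m \<le> 2 ^ j" unfolding trials_def by (intro power_increasing Least_le j(4)) auto
    then have "v = 0" using j(3) by simp
    then show "trials_ok s" using j by (simp add: I_def trials_ok_def)
  qed (auto simp: I_def)
qed

definition primes_ok where
  "primes_ok s \<longleftrightarrow> s 2 0 = side n \<and> s 2 1 = trials m \<and> s 2 4 = modulus m \<and> (\<forall>i<trials m. s 3 i = nth_prime i) \<and>
    (\<forall>a i. a \<noteq> 2 \<and> a \<noteq> 3 \<longrightarrow> s a i = s0 a i) \<and> mem_bounded (width m) s"

lemma runs_primes:
  assumes "trials_ok s1"
  shows "runs_in (modulus m * width m) primes_prog s1 primes_ok"
  unfolding primes_prog_def
proof (rule runs_in_seq)
  let ?c = "\<lambda>p::nat. card {q. prime q \<and> q < p}"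
  \<comment> \<open>The candidate never passes \<open>modulus m\<close>, the successor of the last
    prime wanted, so its distance to it is the variant.\<close>
  define I where "I = (\<lambda>v s. s 2 3 = ?c (s 2 4) \<and> s 2 4 \<ge> 2 \<and> s 2 5 = (fact (s 2 4 - 1))\<^sup>2 \<and> s 2 4 + v = modulus m \<and>
    (\<forall>i<s 2 3. s 3 i = nth_prime i) \<and> s 2 0 = side n \<and> s 2 1 = trials m \<and>
    (\<forall>a i. a \<noteq> 2 \<and> a \<noteq> 3 \<longrightarrow> s a i = s0 a i) \<and> mem_bounded (width m) s)"
  have b: "mem_bounded (width m) s1" using assms by (simp add: trials_ok_def)
  have M2: "2 \<le> modulus m" using trials_less_modulus[of m] trials_pos[of m] by simp
  have "{q::nat. prime q \<and> q < 2} = {}" by (auto dest: prime_ge_2_nat)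
  then have c2: "?c 2 = 0" by simp
  show "runs_in (modulus m * width m) (Seq (Assign 3 (Const 0)) (Seq (Assign 4 (Const 2)) (Assign 5 (Const 1)))) s1 (I (modulus m - 2))"
    by (rule runs_in_loopfree[OF _ b width_le]) (use assms len_le_two M2 c2 in \<open>auto simp: trials_ok_def I_def upd_apply intro!: mem_bounded_upd\<close>)
  fix s assume I: "I (modulus m - 2) s"
  have "Suc (modulus m - 2) \<le> modulus m" using M2 by simp
  then have time: "Suc (modulus m - 2) * width m \<le> modulus m * width m" by (rule mult_le_mono1)
  let ?e = "Bin Less (Var 3) (Var 1)"
  let ?b = "Seq (Cond (Bin Mod (Var 5) (Var 4))
          (Seq (Store 3 (Var 3) (Var 4)) (Assign 3 (Bin Plus (Var 3) (Const 1)))) Skip)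
        (Seq (Assign 5 (Bin Times (Var 5) (power_expr (Var 4) 2)))
          (Assign 4 (Bin Plus (Var 4) (Const 1))))"
  show "runs_in (modulus m * width m) (While ?e ?b) s primes_ok"
  proof (rule runs_in_weaken[OF runs_in_while[where I = I, OF _ I time]])
    fix v s assume I: "I v s" and e: "val ?e s \<noteq> 0"
    define p where "p = s 2 4"
    have p: "s 2 3 = ?c p" "s 2 4 = p" "2 \<le> p" "s 2 5 = (fact (p - 1))\<^sup>2" "p + v = modulus m" "?c p < trials m"
      using I e by (auto simp: I_def p_def split: if_splits)
    have le: "p \<le> nth_prime (trials m - 1)" using p(6) card_primes_less_iff[OF trials_pos] by blast
    then have "p < modulus m" by (simp add: modulus_def)
    then obtain v' where v: "v = Suc v'" using p(5) by (cases v) auto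
    have "(fact (p - 1))\<^sup>2 * p ^ 2 = ((fact p)\<^sup>2 :: nat)"
      using fact_reduce[of p, where 'a = nat] p(3) by (simp only: power_mult_distrib mult.commute of_nat_id)
    moreover have "len ((fact p)\<^sup>2) \<le> width m" "len (p + 1) \<le> width m" "len (?c p + 1) \<le> width m" "len p \<le> width m"
      using le p(6) \<open>p < modulus m\<close> trials_less_modulus[of m] by (auto intro!: len_modulus len_fact)
    moreover have "?c (Suc p) = ?c p + 1" if "prime p"
    proof -
      have "{q. prime q \<and> q < Suc p} = insert p {q. prime q \<and> q < p}" using that by auto
      then show ?thesis by simp
    qed
    moreover have "{q. prime q \<and> q < Suc p} = {q. prime q \<and> q < p}" if "\<not> prime p" using that less_Suc_eq by auto
    moreover have "prime p \<longleftrightarrow> (fact (p - 1))\<^sup>2 mod p \<noteq> 0"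
      using prime_iff_not_dvd_fact_square[OF p(3)] by (simp only: dvd_eq_mod_eq_0)
    moreover have "prime p \<Longrightarrow> nth_prime (?c p) = p" by (rule nth_prime_card_primes)
    ultimately show "wp ?b (\<lambda>s'. \<exists>v'<v. I v' s') s"
      using I p(1-4) p(5)[symmetric] v by (cases "prime p") (auto simp: I_def upd_apply less_Suc_eq intro!: mem_bounded_upd exI[of _ v'])
  next
    fix s assume "(\<exists>v'. I v' s) \<and> val ?e s = 0"
    then obtain v where v: "I v s" "trials m \<le> ?c (s 2 4)"
      using s0 by (auto simp: I_def split: if_splits)
    then have "\<not> s 2 4 \<le> nth_prime (trials m - 1)" using card_primes_less_iff[OF trials_pos[of m], of "s 2 4"] by simp
    then have "modulus m \<le> s 2 4" by (simp add: modulus_def)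
    then show "primes_ok s" using v by (auto simp: I_def primes_ok_def)
  qed (auto simp: I_def)
qed

lemma runs_setup: "runs_in (modulus m * width m) setup_prog s0 (setup_ok n m s0)"
  unfolding setup_prog_def
proof (rule runs_in_seq[OF runs_side runs_in_seq[OF runs_trials runs_in_seq[OF runs_primes]]])
  fix s assume s: "primes_ok s"
  have "len (bins n) \<le> width m"
    by (intro len_trials less_le_trans[OF bins_less[OF n]] power_increasing) (use trials_pos[of m] in auto)
  moreover have "len (seed_base n m) \<le> width m"
    by (intro len_trials less_le_trans[OF seed_base_less[OF n]] power_increasing) (use trials_pos[of m] in auto)
  ultimately show "runs_in (modulus m * width m) sizes_prog s (setup_ok n m s0)"
    using s s0 width_le by (intro runs_in_loopfree[of _ "width m"])
      (auto simp: sizes_prog_def primes_ok_def setup_ok_def upd_apply bins_def seed_base_def intro!: mem_bounded_upd)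
qed

end

end

section \<open>The encoder\<close>

lemma card_less_Suc: "card {j. j < Suc i \<and> P j} = card {j. j < i \<and> P j} + of_bool (P i)"
proof -
  have "{j. j < Suc i \<and> P j} = (if P i then insert i {j. j < i \<and> P j} else {j. j < i \<and> P j})"
    by (auto simp: less_Suc_eq)
  then show ?thesis by simp
qed

lemma length_array_bits [simp]: "length (array_bits f) = f 0"
  by (simp add: array_bits_def)

lemma nth_array_bits: "i < f 0 \<Longrightarrow> array_bits f ! i \<longleftrightarrow> f (Suc i) \<noteq> 0"
  by (simp add: array_bits_def)

lemma card_indices:
  assumes "distinct xs"
  shows "card {j. j < length xs \<and> P (xs ! j)} = card {x \<in> set xs. P x}"
proof -
  have "{x \<in> set xs. P x} = (!) xs ` {j. j < length xs \<and> P (xs ! j)}"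
    by (auto simp: in_set_conv_nth)
  moreover have "inj_on ((!) xs) {j. j < length xs \<and> P (xs ! j)}"
    using assms by (auto intro!: inj_onI simp: nth_eq_iff_index_eq)
  ultimately show ?thesis by (simp add: card_image)
qed

text \<open>The double loop over stored elements and primes runs as a single loop, whose counter is
  split by \<open>div\<close> and \<open>mod\<close>.\<close>

lemma ex_less_times:
  assumes "T > 0"
  shows "(\<exists>j<k * T. P (j div T) (j mod T)) \<longleftrightarrow> (\<exists>i<k. \<exists>t<T. P i (t::nat))"
proof safe
  fix j assume "j < k * T" "P (j div T) (j mod T)"
  then show "\<exists>i<k. \<exists>t<T. P i t" using assms by (intro exI[of _ "j div T"] conjI exI[of _ "j mod T"]) (auto simp: less_mult_imp_div_less)
next
  fix i t assume it: "i < k" "t < T" "P i t"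
  have "i * T + t < Suc i * T" using it by simp
  also have "\<dots> \<le> k * T" using it by (intro mult_le_mono1) simp
  finally show "\<exists>j<k * T. P (j div T) (j mod T)" using it by (intro exI[of _ "i * T + t"]) auto
qed

text \<open>The number of coefficients is a constant of the program, so the evaluation is an
  expression and not a loop.\<close>

primrec horner_expr :: "expr \<Rightarrow> nat \<Rightarrow> expr \<Rightarrow> expr" where
  "horner_expr x 0 w = Const 0"
| "horner_expr x (Suc k) w = Bin Plus (Bin Mod w (Var 7)) (Bin Times x (horner_expr x k (Bin Div w (Var 7))))"

lemma val_horner_expr: "val (horner_expr x k w) s = horner (s 2 7) k (val w s) (val x s)"
  by (induction k arbitrary: w) auto

context params
begin

definition hash_expr :: "expr \<Rightarrow> expr" where
  "hash_expr x = Bin Mod (Bin Mod (horner_expr x (Suc D) (Bin Div (Var 8) (Var 7))) (Bin Mod (Var 8) (Var 7))) (Var 6)"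

lemma val_hash_expr:
  "s 2 6 = bins n \<Longrightarrow> s 2 7 = seed_base n m \<Longrightarrow> val (hash_expr x) s = hash n m (s 2 8) (val x s)"
  by (simp add: hash_expr_def hash_def bucket_def val_horner_expr del: horner_expr.simps horner.simps)

definition position_expr :: "expr \<Rightarrow> expr \<Rightarrow> expr" where
  "position_expr x t = Bin Plus (Bin Plus (Load 0 (Const 1))
    (Bin Times (Bin Plus (Bin Times (hash_expr x) (Var 1)) t) (Var 4))) (Bin Mod x (Load 3 t))"

lemma val_position_expr:
  assumes "s 2 1 = trials m" "s 2 4 = modulus m" "s 2 6 = bins n" "s 2 7 = seed_base n m"
    "s 0 1 = n" "s 3 (val t s) = nth_prime (val t s)"
  shows "val (position_expr x t) s = position n m (s 2 8) (val x s) (val t s)"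
  using assms val_hash_expr[of s n m x] by (simp add: position_expr_def position_def)

text \<open>Two counters in one loop: an overloaded bucket advances the seed and resets the element.
  Each seed has its own block of counters, so nothing has to be cleared.\<close>

definition search_prog :: prog where
  "search_prog = Seq (Seq (Assign 13 (Load 1 (Const 0))) (Seq (Assign 8 (Const 0)) (Assign 9 (Const 0))))
    (While (Bin Less (Var 9) (Var 13))
      (let cell = Bin Plus (Bin Times (Var 8) (Var 6)) (hash_expr (Load 1 (Bin Plus (Var 9) (Const 1)))) in
        Cond (Bin Less (Load 4 cell) (Const D))
          (Seq (Store 4 cell (Bin Plus (Load 4 cell) (Const 1))) (Assign 9 (Bin Plus (Var 9) (Const 1))))
          (Seq (Assign 8 (Bin Plus (Var 8) (Const 1))) (Assign 9 (Const 0)))))"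

definition fill_prog :: prog where
  "fill_prog = Seq (Assign 9 (Const 0))
    (While (Bin Less (Var 9) (Bin Times (Var 13) (Var 1)))
      (Seq (Store 1 (Bin Plus (position_expr (Load 1 (Bin Plus (Bin Div (Var 9) (Var 1)) (Const 1)))
          (Bin Mod (Var 9) (Var 1))) (Const 1)) (Const 1))
        (Assign 9 (Bin Plus (Var 9) (Const 1)))))"

text \<open>\<open>B\<close> is already in place in array 1, and only its length has to be written
  over that of the input list. The binary digits of the seed go to array 0, least significant
  first.\<close>

definition cache_prog :: prog where
  "cache_prog = Seq (Seq (Store 1 (Const 0) (Bin Plus (Load 0 (Const 1)) (Bin Times (Bin Times (Var 6) (Var 1)) (Var 4))))
      (Seq (Assign 9 (Const 2)) (Assign 11 (Var 8))))
    (Seq (While (Var 11)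
      (Seq (Store 0 (Bin Plus (Var 9) (Const 1)) (Bin Mod (Var 11) (Const 2)))
        (Seq (Assign 11 (Bin Div (Var 11) (Const 2))) (Assign 9 (Bin Plus (Var 9) (Const 1))))))
    (Store 0 (Const 0) (Var 9)))"

definition encode_prog :: prog where
  "encode_prog = Seq setup_prog (Seq search_prog (Seq fill_prog cache_prog))"

text \<open>The first factor majorizes the number of rounds of every loop:
  \<open>seeds n m * (n + 1)\<close> for the search, \<open>n * trials m\<close> for filling,
  \<open>modulus m\<close> for the setup, \<open>width m\<close> for the bits of the seed.\<close>

definition encode_time :: "nat \<Rightarrow> nat \<Rightarrow> nat" where
  "encode_time n m = (seeds n m * (n + 1) * trials m * modulus m + width m + 1) * width m"

definition cached_seed :: "bool list \<Rightarrow> nat" where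
  "cached_seed C = (\<Sum>j<length C - 2. of_bool (C ! (j + 2)) * 2 ^ j)"

text \<open>The first \<open>n\<close> bits of \<open>B\<close> and the first two bits of \<open>C\<close> are left over from the input and never used.\<close>

definition valid_code :: "nat \<Rightarrow> nat \<Rightarrow> nat set \<Rightarrow> bool list \<Rightarrow> bool list \<Rightarrow> bool" where
  "valid_code n m A C B \<longleftrightarrow> good n m A (cached_seed C) \<and> cached_seed C \<le> seeds n m \<and>
    2 \<le> length C \<and> length C \<le> width m + 2 \<and> length B = n + bins n * trials m * modulus m \<and>
    (\<forall>i. n \<le> i \<longrightarrow> i < length B \<longrightarrow> B ! i = (\<exists>a\<in>A. \<exists>t<trials m. i = position n m (cached_seed C) a t))"

lemma len_D: "v \<le> D \<Longrightarrow> len v \<le> width m"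
  using width_ge[of m] le_less_trans[OF _ less_exp, of v D] by (intro len_le_width[of v D]) auto

lemma len_width: "v \<le> width m + 2 \<Longrightarrow> len v \<le> width m"
proof -
  assume v: "v \<le> width m + 2"
  define z where "z = width m - 2"
  have z: "width m = Suc (Suc z)" "z \<ge> 10" using width_ge[of m] by (simp_all add: z_def)
  have "v \<le> z + 4" using v z by simp
  also have "\<dots> < 2 * Suc z" using z by simp
  also have "\<dots> \<le> 2 * 2 ^ z" using less_exp[of z] by (intro mult_le_mono2) (simp only: Suc_le_eq)
  also have "\<dots> = 2 ^ Suc z" by simp
  finally show ?thesis using z by (intro len_le_width[of v "Suc z"]) auto
qed

lemma len_storage:
  assumes n: "1 \<le> n" "n \<le> m" and v: "v \<le> n + bins n * trials m * modulus m"
  shows "len v \<le> width m"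
proof -
  have "bins n * trials m * modulus m \<le> 2 ^ (2 * trials m + 3) * 2 ^ trials m * 2 ^ modulus m"
    using bins_less[OF n] by (intro mult_le_mono) (auto intro: less_imp_le)
  also have "\<dots> = 2 ^ (3 * trials m + modulus m + 3)" unfolding power_add[symmetric] by (intro arg_cong[of _ _ "power 2"]) simp
  finally have "(n + bins n * trials m * modulus m) < 2 ^ trials m + 2 ^ (3 * trials m + modulus m + 3)" using n less_two_trials[of m] by simp
  also have "\<dots> \<le> 2 ^ (3 * trials m + modulus m + 3) + 2 ^ (3 * trials m + modulus m + 3)"
    by (intro add_right_mono power_increasing) auto
  also have "\<dots> = 2 ^ (3 * trials m + modulus m + 4)" by (simp add: power_add)
  finally show ?thesis
    using v width_ge[of m] modulus_less_square[of m] by (intro len_le_width[of _ "3 * trials m + modulus m + 4"]) auto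
qed

section \<open>Correctness of the encoder\<close>

context
  fixes n m :: nat and A :: "nat set" and s0 :: mem and xs :: "nat list" and k :: nat
  assumes n: "1 \<le> n" "n \<le> m" and A: "A \<in> storable n m"
    and s0_def: "s0 = encoder_input n m A" and xs_def: "xs = sorted_list_of_set A" and k_def: "k = length xs"
begin

lemma stored_list: "set xs = A" "distinct xs" "k \<le> n" "A \<subseteq> {1..m}"
proof -
  have "finite A" using A finite_subset by (auto simp: storable_def)
  then show "set xs = A" "distinct xs" by (simp_all add: xs_def)
  then show "k \<le> n" "A \<subseteq> {1..m}" using A distinct_card[of xs] by (auto simp: storable_def k_def)
qed

lemma encoder_memory: "s0 0 1 = n" "s0 0 2 = m" "s0 1 0 = k" "i < k \<Longrightarrow> s0 1 (Suc i) = xs ! i"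
  "k \<le> i \<Longrightarrow> s0 1 (Suc i) = 0" "s0 4 i = 0"
  by (auto simp: s0_def encoder_input_def input_def list_array_def k_def xs_def numeral_2_eq_2 split: nat.split)

lemma bounded_encoder_memory: "mem_bounded (width m) s0"
  unfolding mem_bounded_def
proof (intro allI)
  fix a i
  have x: "xs ! j \<le> m" if "j < length xs" for j using stored_list(1,4) nth_mem[OF that] by auto
  have "s0 a i \<le> m \<or> s0 a i = 2"
    using n x stored_list(3) unfolding s0_def encoder_input_def input_def list_array_def k_def xs_def[symmetric]
    by (auto split: nat.split simp: nth_Cons' numeral_2_eq_2)
  then show "len (s0 a i) \<le> width m" using len_le_m len_le_two by auto
qed

definition base where
  "base s \<longleftrightarrow> s 2 1 = trials m \<and> s 2 4 = modulus m \<and> s 2 6 = bins n \<and> s 2 7 = seed_base n m \<and>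
    (\<forall>i<trials m. s 3 i = nth_prime i) \<and> (\<forall>i. s 0 i = s0 0 i) \<and> s 2 13 = k \<and> mem_bounded (width m) s"

definition search_ok where
  "search_ok s \<longleftrightarrow> base s \<and> (\<forall>i. s 1 i = s0 1 i) \<and> good n m A (s 2 8) \<and> s 2 8 \<le> seeds n m"

lemma encode_time_ge:
  assumes "y \<le> seeds n m * (n + 1) * trials m * modulus m + width m + 1"
  shows "y * width m \<le> encode_time n m"
  unfolding encode_time_def using assms by (rule mult_le_mono1)

lemma seeds_pos: "1 \<le> seeds n m"
  unfolding seeds_def by (rule one_le_power) (simp add: seed_base_def)

lemma width_le_time: "width m \<le> encode_time n m"
  using encode_time_ge[of 1] by simp

text \<open>\<open>w0\<close> is an arbitrary good seed. The search may stop earlier at another one,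
  but it cannot pass \<open>w0\<close>: the loads of a prefix of the list are at most the final
  loads, so no overload is ever detected there.\<close>

lemma runs_search:
  assumes "setup_ok n m s0 s1"
  shows "runs_in (encode_time n m) search_prog s1 search_ok"
  unfolding search_prog_def
proof (rule runs_in_seq)
  let ?N = "bins n"
  let ?c = "\<lambda>i w b. card {j. j < i \<and> hash n m w (xs ! j) = b}"
  define w0 where "w0 = (SOME w. w < seed_base n m ^ (D + 2) \<and> good n m A w)"
  have w0: "w0 < seeds n m" "good n m A w0"
    using someI_ex[OF ex_good[OF n(1) A]] unfolding w0_def seeds_def by auto
  \<comment> \<open>\<open>v\<close> encodes the lexicographic order of remaining seeds and
    remaining elements as one number, since an index is at most \<open>k\<close>. The blocks of
    later seeds are still zero.\<close>
  define I where "I = (\<lambda>v s. base s \<and> (\<forall>i. s 1 i = s0 1 i) \<and> s 2 8 \<le> w0 \<and> s 2 9 \<le> k \<and>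
    v = (w0 - s 2 8) * (k + 1) + (k - s 2 9) \<and>
    (\<forall>b<?N. s 4 (s 2 8 * ?N + b) = ?c (s 2 9) (s 2 8) b) \<and> (\<forall>y\<ge>Suc (s 2 8) * ?N. s 4 y = 0) \<and>
    (\<forall>b. ?c (s 2 9) (s 2 8) b \<le> D))"
  have b: "mem_bounded (width m) s1" using assms by (simp add: setup_ok_def)
  have lk: "len k \<le> width m" using stored_list n by (intro len_le_m) simp
  show "runs_in (encode_time n m) (Seq (Assign 13 (Load 1 (Const 0))) (Seq (Assign 8 (Const 0)) (Assign 9 (Const 0)))) s1 (I (w0 * (k + 1) + k))"
    by (rule runs_in_loopfree[OF _ b width_le_time])
      (use assms len_le_two lk encoder_memory in \<open>auto simp: setup_ok_def I_def base_def upd_apply intro!: mem_bounded_upd\<close>)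
  fix s assume I: "I (w0 * (k + 1) + k) s"
  have "Suc (w0 * (k + 1) + k) = Suc w0 * (k + 1) * 1 * 1" by simp
  also have "\<dots> \<le> seeds n m * (n + 1) * trials m * modulus m"
    using w0(1) stored_list(3) trials_pos[of m] trials_less_modulus[of m] by (intro mult_le_mono) auto
  finally have time: "Suc (w0 * (k + 1) + k) * width m \<le> encode_time n m"
    by (intro encode_time_ge) simp
  let ?e = "Bin Less (Var 9) (Var 13)"
  define x where "x = Load 1 (Bin Plus (Var 9) (Const 1))"
  define cell where "cell = Bin Plus (Bin Times (Var 8) (Var 6)) (hash_expr x)"
  let ?yes = "Seq (Store 4 cell (Bin Plus (Load 4 cell) (Const 1))) (Assign 9 (Bin Plus (Var 9) (Const 1)))"
  let ?no = "Seq (Assign 8 (Bin Plus (Var 8) (Const 1))) (Assign 9 (Const 0))"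
  let ?b = "Cond (Bin Less (Load 4 cell) (Const D)) ?yes ?no"
  have "runs_in (encode_time n m) (While ?e ?b) s search_ok"
  proof (rule runs_in_weaken[OF runs_in_while[where I = I, OF _ I time]])
    fix v s assume I: "I v s" and e: "val ?e s \<noteq> 0"
    define w i where "w = s 2 8" and "i = s 2 9"
    have base: "base s" and ik: "i < k" and w: "w \<le> w0" and v: "v = (w0 - w) * (k + 1) + (k - i)"
      and c: "\<And>b. b < ?N \<Longrightarrow> s 4 (w * ?N + b) = ?c i w b" and z: "\<And>y. Suc w * ?N \<le> y \<Longrightarrow> s 4 y = 0"
      and cD: "\<And>b. ?c i w b \<le> D" and s1: "\<And>i. s 1 i = s0 1 i"
      using I e by (auto simp: I_def w_def i_def base_def split: if_splits)
    define h where "h = hash n m w (xs ! i)"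
    have h: "h < ?N" unfolding h_def by (rule hash_less[OF n(1)])
    have "val x s = xs ! i" using s1 encoder_memory(4)[OF ik] by (simp add: x_def i_def)
    then have cell: "val cell s = w * ?N + h"
      using base val_hash_expr[of s n m x] by (simp add: cell_def base_def w_def h_def)
    have cnt: "s 4 (val cell s) = ?c i w h" using cell c[OF h] by simp
    show "wp ?b (\<lambda>s'. \<exists>v'<v. I v' s') s"
    proof (cases "?c i w h < D")
      case True
      let ?s = "upd (upd s 4 (w * ?N + h) (?c i w h + 1)) 2 9 (i + 1)"
      have l: "len (?c i w h + 1) \<le> width m" "len (i + 1) \<le> width m"
        using True ik lk len_mono[of "i + 1" k] by (auto intro!: len_D)
      have "?s 4 (w * ?N + b) = ?c (Suc i) w b" if "b < ?N" for b
        using c[OF that] by (simp add: upd_apply card_less_Suc h_def)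
      moreover have "?s 4 y = 0" if "Suc w * ?N \<le> y" for y using z[OF that] h that by (simp add: upd_apply)
      moreover have "?c (Suc i) w b \<le> D" for b
        using cD[of b] True by (cases "b = h") (auto simp: card_less_Suc h_def)
      ultimately have "I ((w0 - w) * (k + 1) + (k - Suc i)) ?s"
        using base l s1 w ik unfolding I_def base_def
        by (auto simp: upd_apply w_def intro!: mem_bounded_upd)
      then have "\<exists>v'<v. I v' ?s" using v ik by (intro exI[of _ "(w0 - w) * (k + 1) + (k - Suc i)"]) auto
      then show ?thesis using True cnt cell by (simp add: i_def upd_apply)
    next
      case False
      then have D': "?c i w h = D" using cD[of h] by simp
      have "w \<noteq> w0"
      proof
        assume "w = w0"
        have "Suc D = ?c (Suc i) w h" using D' by (simp add: card_less_Suc h_def)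
        also have "\<dots> \<le> ?c k w h" using ik by (intro card_mono) auto
        also have "\<dots> = card {x\<in>A. hash n m w x = h}"
          using card_indices[OF stored_list(2), of "\<lambda>x. hash n m w x = h"] by (simp add: k_def stored_list(1))
        also have "\<dots> \<le> D" using w0(2) \<open>w = w0\<close> by (simp add: good_def)
        finally show False by simp
      qed
      then have w': "w < w0" using w by simp
      let ?s = "upd (upd s 2 8 (w + 1)) 2 9 0"
      let ?v = "(w0 - Suc w) * (k + 1) + k"
      have l: "len (w + 1) \<le> width m" "len 0 \<le> width m" using w' w0(1) len_le_two n by (auto intro!: len_seeds[of n m])
      have "?s 4 (Suc w * ?N + b) = 0" for b using z[of "Suc w * ?N + b"] by (simp add: upd_apply)
      moreover have "?s 4 y = 0" if "Suc (Suc w) * ?N \<le> y" for y using z[of y] that by (simp add: upd_apply)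
      ultimately have "I ?v ?s"
        using base l s1 w' unfolding I_def base_def
        by (auto simp: upd_apply intro!: mem_bounded_upd)
      moreover have "?v < v"
      proof -
        obtain d where d: "w0 = Suc (w + d)" using w' less_iff_Suc_add by auto
        show ?thesis using ik unfolding v d by simp
      qed
      ultimately have "\<exists>v'<v. I v' ?s" by blast
      then show ?thesis using False cnt by (simp add: w_def)
    qed
  next
    fix s assume "(\<exists>v'. I v' s) \<and> val ?e s = 0"
    then obtain v where I: "I v s" "s 2 9 = k"
      by (auto simp: I_def base_def split: if_splits)
    have "card {x\<in>A. hash n m (s 2 8) x = b} \<le> D" for b
    proof -
      have "?c k (s 2 8) b \<le> D" using I unfolding I_def by metis
      then show ?thesis
        using card_indices[OF stored_list(2), of "\<lambda>x. hash n m (s 2 8) x = b"] by (simp add: k_def stored_list(1))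
    qed
    then show "search_ok s" using I w0(1) by (auto simp: search_ok_def I_def good_def)
  qed (auto simp: I_def base_def)
  then show "runs_in (encode_time n m) (While ?e (let cell = Bin Plus (Bin Times (Var 8) (Var 6)) (hash_expr (Load 1 (Bin Plus (Var 9) (Const 1)))) in
        Cond (Bin Less (Load 4 cell) (Const D))
          (Seq (Store 4 cell (Bin Plus (Load 4 cell) (Const 1))) (Assign 9 (Bin Plus (Var 9) (Const 1))))
          (Seq (Assign 8 (Bin Plus (Var 8) (Const 1))) (Assign 9 (Const 0))))) s search_ok"
    unfolding Let_def cell_def x_def .
qed

definition fill_ok where
  "fill_ok s \<longleftrightarrow> base s \<and> good n m A (s 2 8) \<and> s 2 8 \<le> seeds n m \<and>
    (\<forall>i\<ge>n. s 1 (Suc i) = of_bool (\<exists>a\<in>A. \<exists>t<trials m. i = position n m (s 2 8) a t))"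

lemma runs_fill:
  assumes "search_ok s1"
  shows "runs_in (encode_time n m) fill_prog s1 fill_ok"
  unfolding fill_prog_def
proof (rule runs_in_seq)
  let ?T = "trials m"
  let ?p = "\<lambda>w j. position n m w (xs ! (j div ?T)) (j mod ?T)"
  \<comment> \<open>Positions are at least \<open>n\<close> and are stored one cell higher, so the
    list of \<open>A\<close> in the cells up to \<open>n\<close> survives while it is being
    read.\<close>
  define I where "I = (\<lambda>v s. base s \<and> good n m A (s 2 8) \<and> s 2 8 \<le> seeds n m \<and> s 2 9 + v = k * ?T \<and>
    (\<forall>i\<le>n. s 1 i = s0 1 i) \<and> (\<forall>i\<ge>n. s 1 (Suc i) = of_bool (\<exists>j<s 2 9. i = ?p (s 2 8) j)))"
  have b: "mem_bounded (width m) s1" using assms by (simp add: search_ok_def base_def)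
  have "s0 1 (Suc i) = 0" if "n \<le> i" for i using that stored_list(3) encoder_memory(5) by simp
  then show "runs_in (encode_time n m) (Assign 9 (Const 0)) s1 (I (k * ?T))"
    by (intro runs_in_loopfree[OF _ b width_le_time])
      (use assms len_le_two in \<open>auto simp: search_ok_def I_def base_def upd_apply intro!: mem_bounded_upd\<close>)
  fix s assume I: "I (k * ?T) s"
  have "Suc (k * ?T) \<le> 1 * (n + 1) * ?T * 1"
    using mult_le_mono1[OF stored_list(3), of ?T] trials_pos[of m] unfolding mult_1 mult_1_right distrib_right by linarith
  also have "\<dots> \<le> seeds n m * (n + 1) * ?T * modulus m"
    using seeds_pos trials_less_modulus[of m] by (intro mult_le_mono) auto
  finally have time: "Suc (k * ?T) * width m \<le> encode_time n m" by (intro encode_time_ge) simp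
  let ?e = "Bin Less (Var 9) (Bin Times (Var 13) (Var 1))"
  define x where "x = Load 1 (Bin Plus (Bin Div (Var 9) (Var 1)) (Const 1))"
  define t where "t = Bin Mod (Var 9) (Var 1)"
  let ?b = "Seq (Store 1 (Bin Plus (position_expr x t) (Const 1)) (Const 1)) (Assign 9 (Bin Plus (Var 9) (Const 1)))"
  have "runs_in (encode_time n m) (While ?e ?b) s fill_ok"
  proof (rule runs_in_weaken[OF runs_in_while[where I = I, OF _ I time]])
    fix v s assume I: "I v s" and e: "val ?e s \<noteq> 0"
    define w c where "w = s 2 8" and "c = s 2 9"
    have base: "base s" and c: "c < k * ?T" and v: "c + v = k * ?T"
      using I e by (auto simp: I_def base_def c_def split: if_splits)
    then obtain v' where v': "v = Suc v'" by (cases v) auto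
    have ck: "c div ?T < k" "c mod ?T < ?T" using c trials_pos[of m] by (auto simp: less_mult_imp_div_less)
    have t: "val t s = c mod ?T" using base by (simp add: t_def base_def c_def)
    have "val x s = s0 1 (Suc (c div ?T))" using I ck stored_list(3) by (simp add: x_def I_def base_def c_def)
    then have x: "val x s = xs ! (c div ?T)" using encoder_memory(4)[OF ck(1)] by simp
    have p: "val (position_expr x t) s = ?p w c"
      using base ck encoder_memory(1) unfolding base_def by (subst val_position_expr) (auto simp: t x w_def)
    have pn: "n \<le> ?p w c" by (rule position_bounds[OF n(1) ck(2)])
    have "c + 1 \<le> n * ?T" using c mult_le_mono1[OF stored_list(3), of ?T] by linarith
    also have "\<dots> < 2 ^ ?T * 2 ^ ?T" using n less_two_trials[of m] less_exp[of ?T] by (intro mult_strict_mono) auto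
    also have "\<dots> \<le> 2 ^ (20 * ?T)" unfolding power_add[symmetric] by (intro power_increasing) auto
    finally have l: "len (c + 1) \<le> width m" by (rule len_trials)
    let ?s = "upd (upd s 1 (Suc (?p w c)) 1) 2 9 (c + 1)"
    have "?s 1 (Suc i) = of_bool (\<exists>j<Suc c. i = ?p w j)" if "n \<le> i" for i
      using I that by (auto simp: I_def upd_apply less_Suc_eq w_def c_def)
    moreover have "?s 1 i = s0 1 i" if "i \<le> n" for i
      using I that pn by (auto simp: I_def upd_apply)
    ultimately have "I v' ?s"
      using I v v' l len_le_two unfolding I_def base_def
      by (auto simp: upd_apply w_def c_def intro!: mem_bounded_upd)
    then show "wp ?b (\<lambda>s'. \<exists>v'<v. I v' s') s" using v' p by (auto simp: upd_apply c_def)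
  next
    fix s assume "(\<exists>v'. I v' s) \<and> val ?e s = 0"
    then obtain v where I: "I v s" "s 2 9 = k * ?T"
      by (auto simp: I_def base_def split: if_splits)
    have "(\<exists>j<k * ?T. i = ?p (s 2 8) j) \<longleftrightarrow> (\<exists>a\<in>A. \<exists>t<?T. i = position n m (s 2 8) a t)" for i
      unfolding ex_less_times[OF trials_pos, where P = "\<lambda>j t. i = position n m (s 2 8) (xs ! j) t"]
      unfolding stored_list(1)[symmetric] k_def by (metis in_set_conv_nth)
    then show "fill_ok s" using I by (auto simp: fill_ok_def I_def)
  qed (auto simp: I_def base_def position_expr_def)
  then show "runs_in (encode_time n m) (While ?e
      (Seq (Store 1 (Bin Plus (position_expr (Load 1 (Bin Plus (Bin Div (Var 9) (Var 1)) (Const 1)))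
          (Bin Mod (Var 9) (Var 1))) (Const 1)) (Const 1))
        (Assign 9 (Bin Plus (Var 9) (Const 1))))) s fill_ok"
    unfolding x_def t_def .
qed

lemma runs_cache:
  assumes "fill_ok s1"
  shows "runs_in (encode_time n m) cache_prog s1 (\<lambda>s. valid_code n m A (array_bits (s 0)) (array_bits (s 1)))"
  unfolding cache_prog_def
proof (rule runs_in_seq[OF _ runs_in_seq])
  define w where "w = s1 2 8"
  let ?S = "n + bins n * trials m * modulus m"
  define J where "J = (\<lambda>s. s 1 0 = ?S \<and> (\<forall>i\<ge>n. s 1 (Suc i) = of_bool (\<exists>a\<in>A. \<exists>t<trials m. i = position n m w a t)) \<and>
     mem_bounded (width m) s)"
  \<comment> \<open>The bits written and the shifted rest always add up to \<open>w\<close>; the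
    rest is below \<open>2 ^ v\<close>, which limits the loop to \<open>width m\<close>
    rounds.\<close>
  define I where "I = (\<lambda>v s. J s \<and> (\<exists>q. s 2 9 = 2 + q \<and> q + v = width m \<and>
    s 2 11 * 2 ^ q + (\<Sum>j<q. s 0 (3 + j) * 2 ^ j) = w \<and> (\<forall>j<q. s 0 (3 + j) \<le> 1)) \<and> s 2 11 \<le> w \<and> s 2 11 < 2 ^ v)"
  have b: "mem_bounded (width m) s1" and w: "good n m A w" "w \<le> seeds n m"
    using assms by (auto simp: fill_ok_def base_def w_def)
  have lw: "len y \<le> width m" if "y \<le> w" for y using that w n by (intro len_seeds) auto
  have "w < 2 ^ (width m - 1)" using w(2) seeds_less[OF n] by simp
  also have "\<dots> \<le> 2 ^ width m" by (rule power_increasing) auto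
  finally have w2: "w < 2 ^ width m" .
  have lS: "len ?S \<le> width m" using n by (intro len_storage) auto
  show "runs_in (encode_time n m) (Seq (Store 1 (Const 0) (Bin Plus (Load 0 (Const 1)) (Bin Times (Bin Times (Var 6) (Var 1)) (Var 4))))
      (Seq (Assign 9 (Const 2)) (Assign 11 (Var 8)))) s1 (I (width m))"
    by (rule runs_in_loopfree[OF _ b width_le_time])
      (use assms encoder_memory(1) len_le_two lS lw[of w] w2 in \<open>auto simp: fill_ok_def base_def I_def J_def w_def upd_apply intro!: mem_bounded_upd\<close>)
  define K where "K = (\<lambda>s. J s \<and> (\<exists>q. s 2 9 = 2 + q \<and> q \<le> width m \<and>
    (\<Sum>j<q. s 0 (3 + j) * 2 ^ j) = w \<and> (\<forall>j<q. s 0 (3 + j) \<le> 1)))"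
  let ?b = "Seq (Store 0 (Bin Plus (Var 9) (Const 1)) (Bin Mod (Var 11) (Const 2)))
        (Seq (Assign 11 (Bin Div (Var 11) (Const 2))) (Assign 9 (Bin Plus (Var 9) (Const 1))))"
  fix s assume I: "I (width m) s"
  have time: "Suc (width m) * width m \<le> encode_time n m" by (intro encode_time_ge) simp
  show "runs_in (encode_time n m) (While (Var 11) ?b) s K"
  proof (rule runs_in_weaken[OF runs_in_while[where I = I, OF _ I time]])
    fix v s assume I: "I v s" and e: "val (Var 11) s \<noteq> 0"
    define y where "y = s 2 11"
    obtain q where q: "s 2 9 = 2 + q" "q + v = width m" "y * 2 ^ q + (\<Sum>j<q. s 0 (3 + j) * 2 ^ j) = w"
      "\<And>j. j < q \<Longrightarrow> s 0 (3 + j) \<le> 1" "y \<le> w" "y < 2 ^ v" "J s" using I by (auto simp: I_def y_def)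
    obtain v' where v: "v = Suc v'" using q(6) e by (cases v) (auto simp: y_def)
    let ?s = "upd (upd (upd s 0 (3 + q) (y mod 2)) 2 11 (y div 2)) 2 9 (3 + q)"
    have "len (y mod 2) \<le> width m" using len_le_two by (cases "even y") (auto simp: odd_iff_mod_2_eq_one)
    moreover have "len (y div 2) \<le> width m" using q(5) by (intro lw) simp
    moreover have "len (3 + q) \<le> width m" using q(2) v by (intro len_width) simp
    ultimately have J: "J ?s" using q(7) unfolding J_def by (auto simp: upd_apply intro!: mem_bounded_upd)
    have "?s 2 11 * 2 ^ Suc q + (\<Sum>j<Suc q. ?s 0 (3 + j) * 2 ^ j) = (y div 2 * 2) * 2 ^ q + (y mod 2) * 2 ^ q + (\<Sum>j<q. s 0 (3 + j) * 2 ^ j)"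
      by (simp add: upd_apply)
    also have "(y div 2 * 2) * 2 ^ q + (y mod 2) * 2 ^ q = y * 2 ^ q"
      by (simp only: add_mult_distrib[symmetric] div_mult_mod_eq)
    finally have sum: "?s 2 11 * 2 ^ Suc q + (\<Sum>j<Suc q. ?s 0 (3 + j) * 2 ^ j) = w" using q(3) by simp
    have "I v' ?s" unfolding I_def
    proof (intro conjI exI[of _ "Suc q"] allI impI)
      show "?s 0 (3 + j) \<le> 1" if "j < Suc q" for j using that q(4) by (auto simp: upd_apply less_Suc_eq)
      show "?s 2 11 \<le> w" using q(5) by (simp add: upd_apply)
      show "?s 2 11 < 2 ^ v'" using q(6) v by (simp add: upd_apply less_mult_imp_div_less mult.commute)
    qed (use J sum q(2) v in \<open>auto simp: upd_apply\<close>)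
    then show "wp ?b (\<lambda>s'. \<exists>v'<v. I v' s') s" using v q(1) by (auto simp: upd_apply y_def numeral_3_eq_3)
  next
    fix s assume "(\<exists>v'. I v' s) \<and> val (Var 11) s = 0"
    then show "K s" by (auto simp: I_def K_def)
  qed (auto simp: I_def J_def)
  fix s assume "K s"
  then obtain q where q: "s 2 9 = 2 + q" "q \<le> width m" "(\<Sum>j<q. s 0 (3 + j) * 2 ^ j) = w"
    "\<And>j. j < q \<Longrightarrow> s 0 (3 + j) \<le> 1" and J: "J s" by (auto simp: K_def)
  let ?C = "array_bits (upd s 0 0 (2 + q) 0)" and ?B = "array_bits (upd s 0 0 (2 + q) 1)"
  have C: "length ?C = 2 + q" by (simp add: upd_apply)
  \<comment> \<open>Bit \<open>j + 2\<close> lies in cell \<open>3 + j\<close>, as cell 0 holds the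
    length. An entry of at most 1 equals its truth value.\<close>
  have "of_bool (?C ! (j + 2)) = s 0 (3 + j)" if "j < q" for j
    using that q(4)[OF that] by (subst nth_array_bits) (auto simp: upd_apply le_Suc_eq numeral_3_eq_3)
  then have "cached_seed ?C = w" unfolding cached_seed_def C using q(3) by simp
  moreover have "length ?B = ?S" using J by (simp add: nth_array_bits upd_apply J_def)
  moreover have "?B ! i = (\<exists>a\<in>A. \<exists>t<trials m. i = position n m w a t)" if "n \<le> i" "i < ?S" for i
    using J that by (simp add: nth_array_bits upd_apply J_def)
  ultimately have "valid_code n m A ?C ?B" using w C q(2) by (simp add: valid_code_def)
  then show "runs_in (encode_time n m) (Store 0 (Const 0) (Var 9)) s (\<lambda>s. valid_code n m A (array_bits (s 0)) (array_bits (s 1)))"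
    using J q(1) by (intro runs_in_loopfree[OF _ _ width_le_time]) (auto simp: J_def)
qed

lemma runs_encode: "runs_in (encode_time n m) encode_prog s0 (\<lambda>s. valid_code n m A (array_bits (s 0)) (array_bits (s 1)))"
  unfolding encode_prog_def
proof (rule runs_in_seq[OF runs_in_weaken[OF runs_setup[OF n encoder_memory(1,2) bounded_encoder_memory]] runs_in_seq[OF runs_search runs_in_seq[OF runs_fill runs_cache]]])
  have "1 * 1 * 1 * modulus m \<le> seeds n m * (n + 1) * trials m * modulus m"
    using seeds_pos trials_pos[of m] by (intro mult_le_mono) auto
  then show "modulus m * width m \<le> encode_time n m" by (intro encode_time_ge) linarith
qed

end

end

section \<open>Queries\<close>

text \<open>Without the time, sequencing is plain monadic bind, the form suited to computing
  probabilities; \<open>runs_in\<close> only expresses sure properties.\<close>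

definition outcome :: "prog \<Rightarrow> mem \<Rightarrow> mem spmf" where
  "outcome c s = map_spmf fst (exec c s)"

lemma map_fst_add_time: "map_spmf fst (add_time k p) = map_spmf fst p"
  by (simp add: add_time_def spmf.map_comp o_def split_def)

lemma outcome_seq: "outcome (Seq c1 c2) s = bind_spmf (outcome c1 s) (outcome c2)"
  by (simp add: outcome_def and_then_def map_spmf_bind_spmf bind_map_spmf o_def split_def map_fst_add_time)

lemma outcome_store [simp]: "outcome (Store a e1 e2) s = return_spmf (upd s a (val e1 s) (val e2 s))"
  by (simp add: outcome_def)

lemma outcome_toss: "outcome (Toss a e) s = map_spmf (\<lambda>b. upd s a (val e s) (of_bool b)) coin_spmf"
  by (simp add: outcome_def spmf.map_comp o_def)

lemma outcome_while: "outcome (While e c) s =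
    (if val e s = 0 then return_spmf s else bind_spmf (outcome c s) (outcome (While e c)))"
  by (simp add: outcome_def and_then_def loop.simps[of e "exec c" s] map_spmf_bind_spmf bind_map_spmf o_def
    split_def map_fst_add_time)

lemma runs_in_outcome: "runs_in X c s Q \<Longrightarrow> s' \<in> set_spmf (outcome c s) \<Longrightarrow> Q s'"
  unfolding runs_in_def runs_def outcome_def by auto

lemma lossless_outcome: "lossless_spmf (outcome c s) = lossless_spmf (exec c s)"
  by (simp add: outcome_def)

lemma runs_in_lossless: "runs_in X c s Q \<Longrightarrow> lossless_spmf (outcome c s)"
  by (simp add: runs_in_def runs_def lossless_outcome)

lemma spmf_bind_coin: "spmf (bind_spmf coin_spmf f) x = (spmf (f True) x + spmf (f False) x) / 2"
  by (simp add: spmf_bind integral_spmf_of_set UNIV_bool)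

text \<open>A bound that holds after every outcome of \<open>c1\<close> also holds on
  average.\<close>

lemma map_outcome_seq_le:
  assumes "runs_in X c1 s Q" "0 \<le> r" "\<And>s'. Q s' \<Longrightarrow> spmf (map_spmf g (outcome c2 s')) True \<le> r"
  shows "spmf (map_spmf g (outcome (Seq c1 c2) s)) True \<le> r"
  unfolding outcome_seq map_spmf_bind_spmf
  by (rule spmf_bind_leI) (use assms runs_in_outcome[OF assms(1)] in auto)

context params
begin

text \<open>Horner's rule in base 2 from the top cell downwards, ending with cell 3, which holds the
  lowest bit of the seed.\<close>

definition decode_prog :: prog where
  "decode_prog = Seq (Seq (Assign 9 (Load 1 (Const 0))) (Assign 8 (Const 0)))
    (While (Bin Less (Const 2) (Var 9))
      (Seq (Assign 8 (Bin Plus (Bin Times (Const 2) (Var 8)) (Load 1 (Var 9)))) (Assign 9 (Bin Minus (Var 9) (Const 1)))))"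

text \<open>Each round appends a bit to the trial in cell 10 and doubles its range in cell 11, which
  reaches \<open>trials m\<close> exactly since that is a power of two.\<close>

definition toss_loop :: prog where
  "toss_loop = While (Bin Less (Var 11) (Var 1))
    (Seq (Toss 2 (Const 12)) (Seq (Assign 10 (Bin Plus (Bin Times (Const 2) (Var 10)) (Var 12)))
      (Assign 11 (Bin Times (Const 2) (Var 11)))))"

definition probe_prog :: prog where
  "probe_prog = Seq (Assign 9 (position_expr (Load 0 (Const 3)) (Var 10)))
    (Seq (Store 0 (Const 0) (Var 9)) (Store 0 (Const 1) (Var 9)))"

definition pos_prog :: prog where
  "pos_prog = Seq setup_prog (Seq decode_prog (Seq (Seq (Assign 10 (Const 0)) (Assign 11 (Const 1)))
    (Seq toss_loop probe_prog)))"

text \<open>After the probes, cell 0 of array 0 holds the length of the list of answers and cell 1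
  the first bit.\<close>

definition ans_prog :: prog where
  "ans_prog = Store 0 (Const 0) (Load 0 (Const 1))"

definition query_time :: "nat \<Rightarrow> nat" where
  "query_time m = (modulus m + width m + 1) * width m"

lemma query_eq: "query pos ans_prog n m (C, B) x = map_spmf (\<lambda>s. B ! s 0 0) (outcome pos (query_input n m C x))"
proof -
  have "map_spmf (\<lambda>(s', _). s' 0 0 \<noteq> 0) (exec ans_prog (probe B s)) = return_spmf (B ! s 0 0)" for s
    by (simp add: ans_prog_def upd_apply probe_def bit_array_def list_array_def)
  then show ?thesis by (simp add: query_def outcome_def split_def spmf.map_comp o_def map_spmf_conv_bind_spmf)
qed

section \<open>Analysis of a single query\<close>

context
  fixes n m x :: nat and A :: "nat set" and C B :: "bool list" and s0 :: mem and w :: nat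
  assumes n: "1 \<le> n" "n \<le> m" and A: "A \<in> storable n m" and x: "x \<in> {1..m}"
    and code: "valid_code n m A C B"
    and s0_def: "s0 = query_input n m C x" and w_def: "w = cached_seed C"
begin

lemma cached_seed_good: "good n m A w" "w \<le> seeds n m"
  using code by (simp_all add: valid_code_def w_def)

lemma cache_length: "2 \<le> length C" "length C \<le> width m + 2"
  using code by (simp_all add: valid_code_def)

lemma storage_bits: "length B = n + bins n * trials m * modulus m"
  "n \<le> i \<Longrightarrow> i < length B \<Longrightarrow> B ! i = (\<exists>a\<in>A. \<exists>t<trials m. i = position n m w a t)"
  using code by (simp_all add: valid_code_def w_def)

lemma query_memory: "s0 0 1 = n" "s0 0 2 = m" "s0 0 3 = x" "s0 1 0 = length C" "j < length C \<Longrightarrow> s0 1 (Suc j) = of_bool (C ! j)"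
  by (auto simp: s0_def query_input_def input_def list_array_def bit_array_def numeral_2_eq_2 numeral_3_eq_3)

lemma len_le_three: "v \<le> 3 \<Longrightarrow> len v \<le> width m"
  using width_ge[of m] by (intro len_width) simp

lemma bounded_query_memory: "mem_bounded (width m) s0"
  unfolding mem_bounded_def
proof (intro allI)
  fix a i
  have "s0 a i \<le> m \<or> s0 a i \<le> 3 \<or> s0 a i = length C"
    using n x unfolding s0_def query_input_def input_def list_array_def bit_array_def
    by (auto split: nat.split simp: nth_Cons' numeral_2_eq_2)
  then show "len (s0 a i) \<le> width m" using len_le_m len_le_three len_width cache_length(2) by auto
qed

definition state where
  "state s \<longleftrightarrow> s 2 1 = trials m \<and> s 2 4 = modulus m \<and> s 2 6 = bins n \<and> s 2 7 = seed_base n m \<and>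
    (\<forall>i<trials m. s 3 i = nth_prime i) \<and> (\<forall>i. s 0 i = s0 0 i) \<and> (\<forall>i. s 1 i = s0 1 i) \<and> mem_bounded (width m) s"

lemma query_time_ge: "y \<le> modulus m + width m + 1 \<Longrightarrow> y * width m \<le> query_time m"
  unfolding query_time_def by (rule mult_le_mono1)

lemma width_le_query_time: "width m \<le> query_time m"
  using query_time_ge[of 1] by simp

lemma runs_decode:
  assumes "setup_ok n m s0 s1"
  shows "runs_in (query_time m) decode_prog s1 (\<lambda>s. state s \<and> s 2 8 = w)"
  unfolding decode_prog_def
proof (rule runs_in_seq)
  define I where "I = (\<lambda>v s. state s \<and> s 2 9 = 2 + v \<and> v \<le> length C - 2 \<and>
    s 2 8 * 2 ^ v + (\<Sum>j<v. of_bool (C ! (j + 2)) * 2 ^ j) = w)"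
  have b: "mem_bounded (width m) s1" using assms by (simp add: setup_ok_def)
  have l: "len (length C) \<le> width m" using cache_length(2) by (rule len_width)
  show "runs_in (query_time m) (Seq (Assign 9 (Load 1 (Const 0))) (Assign 8 (Const 0))) s1 (I (length C - 2))"
    by (rule runs_in_loopfree[OF _ b width_le_query_time])
      (use assms len_le_three query_memory cache_length l in \<open>auto simp: setup_ok_def I_def state_def w_def cached_seed_def upd_apply intro!: mem_bounded_upd\<close>)
  fix s assume I: "I (length C - 2) s"
  have time: "Suc (length C - 2) * width m \<le> query_time m" using cache_length by (intro query_time_ge) simp
  let ?e = "Bin Less (Const 2) (Var 9)"
  let ?b = "Seq (Assign 8 (Bin Plus (Bin Times (Const 2) (Var 8)) (Load 1 (Var 9)))) (Assign 9 (Bin Minus (Var 9) (Const 1)))"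
  show "runs_in (query_time m) (While ?e ?b) s (\<lambda>s. state s \<and> s 2 8 = w)"
  proof (rule runs_in_weaken[OF runs_in_while[where I = I, OF _ I time]])
    fix v s assume I: "I v s" and e: "val ?e s \<noteq> 0"
    then obtain v' where v: "v = Suc v'" by (cases v) (auto simp: I_def)
    define y where "y = 2 * s 2 8 + of_bool (C ! (v' + 2))"
    have vC: "Suc v' \<le> length C - 2" using I v by (simp add: I_def)
    then have load: "s 1 (Suc (Suc (Suc v'))) = of_bool (C ! (v' + 2))"
      using I query_memory(5)[of "v' + 2"] by (simp add: I_def state_def)
    have sum: "y * 2 ^ v' + (\<Sum>j<v'. of_bool (C ! (j + 2)) * 2 ^ j) = w"
    proof -
      have "s 2 8 * 2 ^ Suc v' + (\<Sum>j<Suc v'. of_bool (C ! (j + 2)) * 2 ^ j) = w"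
        using I unfolding I_def v by blast
      then show ?thesis unfolding sum.lessThan_Suc power_Suc y_def by (simp only: algebra_simps)
    qed
    \<comment> \<open>The intermediate values of Horner's rule do not exceed the final seed, so its
      length bound applies to them.\<close>
    then have "y * 1 \<le> w" by (metis le_add1 le_trans mult_le_mono2 one_le_numeral one_le_power)
    then have "len y \<le> width m" using cached_seed_good(2) n by (intro len_seeds) auto
    moreover have "len (2 + v') \<le> width m" using vC cache_length by (intro len_width) simp
    ultimately have "I v' (upd (upd s 2 8 y) 2 9 (2 + v'))"
      using I v vC sum by (auto simp: I_def state_def upd_apply intro!: mem_bounded_upd)
    then show "wp ?b (\<lambda>s'. \<exists>v'<v. I v' s') s"
      using I v load by (auto simp: I_def upd_apply y_def)
  next
    fix s assume "(\<exists>v'. I v' s) \<and> val ?e s = 0"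
    then obtain v where "I v s" "v = 0" by (auto simp: I_def split: if_splits)
    then show "state s \<and> s 2 8 = w" by (simp add: I_def)
  qed (auto simp: I_def state_def)
qed

text \<open>\<open>v\<close> counts the tosses to come; cell 10 holds the \<open>j\<close> leading
  bits of the trial.\<close>

definition toss_inv where
  "toss_inv v s \<longleftrightarrow> state s \<and> s 2 8 = w \<and> (\<exists>j. s 2 11 = 2 ^ j \<and> trials m = 2 ^ (j + v) \<and> s 2 10 < 2 ^ j)"

lemma toss_inv_Suc:
  assumes "toss_inv (Suc v) s"
  shows "toss_inv v (upd (upd (upd s 2 12 (of_bool b)) 2 10 (2 * s 2 10 + of_bool b)) 2 11 (2 * s 2 11))"
proof -
  obtain j where j: "s 2 11 = 2 ^ j" "trials m = 2 ^ (Suc j + v)" "s 2 10 < 2 ^ j"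
    using assms by (auto simp: toss_inv_def)
  have le: "2 * 2 ^ j \<le> trials m" unfolding j(2) by (simp add: power_add)
  have lt: "2 * s 2 10 + of_bool b < 2 * 2 ^ j" using j(3) by (cases b) auto
  have "len (2 * s 2 10 + of_bool b) \<le> width m" "len (2 * s 2 11) \<le> width m"
    using le lt j(1) trials_less_modulus[of m] by (auto intro!: len_modulus simp del: power_Suc)
  moreover have "len (of_bool b) \<le> width m" by (intro len_le_three) simp
  ultimately show ?thesis
    using assms j lt unfolding toss_inv_def state_def
    by (auto simp: upd_apply intro!: mem_bounded_upd exI[of _ "Suc j"])
qed

lemma toss_inv_0: "toss_inv 0 s \<longleftrightarrow> (state s \<and> s 2 8 = w \<and> s 2 11 = trials m \<and> s 2 10 < trials m)"
  by (auto simp: toss_inv_def trials_def)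

lemma toss_inv_less: "toss_inv v s \<Longrightarrow> s 2 11 < s 2 1 \<longleftrightarrow> v \<noteq> 0"
  using one_less_power[of "2::nat" v] by (cases "v = 0") (auto simp: toss_inv_def state_def power_add)

lemma runs_toss_init:
  assumes "state s1 \<and> s1 2 8 = w"
  shows "runs_in (query_time m) (Seq (Assign 10 (Const 0)) (Assign 11 (Const 1))) s1 (toss_inv (LEAST j. m ^ R < 2 ^ (2 ^ j)))"
  by (rule runs_in_loopfree[OF _ _ width_le_query_time])
    (use assms len_le_three in \<open>auto simp: toss_inv_def state_def upd_apply trials_def intro!: mem_bounded_upd exI[of _ 0]\<close>)

lemma runs_toss_loop:
  assumes "toss_inv v s"
  shows "runs_in (query_time m) toss_loop s (toss_inv 0)"
  unfolding toss_loop_def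
proof (rule runs_in_weaken[OF runs_in_while[where I = toss_inv, OF _ assms]])
  obtain j where "trials m = 2 ^ (j + v)" using assms by (auto simp: toss_inv_def)
  then have "Suc v \<le> modulus m" using trials_less_modulus[of m] less_exp[of "j + v"] by linarith
  then show "Suc v * width m \<le> query_time m" by (intro query_time_ge) simp
next
  fix v s assume I: "toss_inv v s" and e: "val (Bin Less (Var 11) (Var 1)) s \<noteq> 0"
  then obtain v' where v: "v = Suc v'" using toss_inv_less[OF I] by (cases v) (auto split: if_splits)
  show "wp (Seq (Toss 2 (Const 12)) (Seq (Assign 10 (Bin Plus (Bin Times (Const 2) (Var 10)) (Var 12)))
      (Assign 11 (Bin Times (Const 2) (Var 11))))) (\<lambda>s'. \<exists>v'<v. toss_inv v' s') s"
  proof -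
    have "\<exists>v'<v. toss_inv v' (upd (upd (upd s 2 12 (of_bool b)) 2 10 (2 * s 2 10 + of_bool b)) 2 11 (2 * s 2 11))" for b
      using toss_inv_Suc[OF I[unfolded v]] v by blast
    then show ?thesis by (simp add: upd_apply)
  qed
next
  fix s assume "(\<exists>v'. toss_inv v' s) \<and> val (Bin Less (Var 11) (Var 1)) s = 0"
  then show "toss_inv 0 s" using toss_inv_less by (auto split: if_splits)
qed (auto simp: toss_inv_def state_def)

lemma runs_probe:
  assumes "toss_inv 0 s"
  shows "runs_in (query_time m) probe_prog s
    (\<lambda>s'. s' 0 0 = position n m w x (s 2 10) \<and> s' 0 1 = position n m w x (s 2 10))"
proof (rule runs_in_loopfree[OF _ _ width_le_query_time])
  have s: "state s" "s 2 8 = w" "s 2 10 < trials m" using assms by (auto simp: toss_inv_0)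
  then have "val (position_expr (Load 0 (Const 3)) (Var 10)) s = position n m w x (s 2 10)"
    using query_memory by (subst val_position_expr) (auto simp: state_def)
  then show "wp probe_prog (\<lambda>s'. s' 0 0 = position n m w x (s 2 10) \<and> s' 0 1 = position n m w x (s 2 10)) s"
    by (simp add: probe_prog_def upd_apply)
qed (use assms in \<open>auto simp: probe_prog_def position_expr_def toss_inv_def state_def\<close>)

lemma modulus_time: "modulus m * width m \<le> query_time m"
  by (rule query_time_ge) simp

lemmas runs_setup_query = runs_in_weaken[OF runs_setup[OF n query_memory(1,2) bounded_query_memory] modulus_time]

lemma runs_pos:
  "runs_in (query_time m) pos_prog s0
    (\<lambda>s. \<exists>t<trials m. s 0 0 = position n m w x t \<and> s 0 1 = position n m w x t)"
  unfolding pos_prog_def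
proof (rule runs_in_seq[OF runs_setup_query runs_in_seq[OF runs_decode runs_in_seq[OF runs_toss_init
    runs_in_seq[OF runs_toss_loop runs_in_weaken[OF runs_probe order_refl]]]]])
  fix s s' assume "toss_inv 0 s"
    "s' 0 0 = position n m w x (s 2 10) \<and> s' 0 1 = position n m w x (s 2 10)"
  then show "\<exists>t<trials m. s' 0 0 = position n m w x t \<and> s' 0 1 = position n m w x t"
    by (auto simp: toss_inv_0)
qed

text \<open>With \<open>v\<close> tosses to come, the trial is uniform on the block of
  \<open>2 ^ v\<close> numbers that extend the prefix \<open>s 2 10\<close>. A toss chooses one half
  of the block, and the bounds for the halves are averaged. An upper bound is enough, because
  members are answered correctly on the whole support.\<close>

lemma toss_probability:
  assumes "toss_inv v s"
  shows "spmf (map_spmf (\<lambda>s. B ! s 0 0) (outcome (Seq toss_loop probe_prog) s)) True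
    \<le> card {t. s 2 10 * 2 ^ v \<le> t \<and> t < Suc (s 2 10) * 2 ^ v \<and> B ! position n m w x t} / 2 ^ v"
  using assms
proof (induction v arbitrary: s)
  case 0
  define t where "t = s 2 10"
  have "s 2 11 \<ge> s 2 1" using toss_inv_less[OF 0] by simp
  then have eq: "outcome (Seq toss_loop probe_prog) s = outcome probe_prog s"
    by (simp add: outcome_seq toss_loop_def outcome_while)
  have g: "B ! s' 0 0 = B ! position n m w x t" if "s' \<in> set_spmf (outcome probe_prog s)" for s'
    using runs_in_outcome[OF runs_probe[OF 0] that] by (simp add: t_def)
  have set: "{t'. t * 2 ^ 0 \<le> t' \<and> t' < Suc t * 2 ^ 0 \<and> B ! position n m w x t'} = (if B ! position n m w x t then {t} else {})"
    by (auto simp: less_Suc_eq)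
  have c: "card {t'. t * 2 ^ 0 \<le> t' \<and> t' < Suc t * 2 ^ 0 \<and> B ! position n m w x t'} = of_bool (B ! position n m w x t)"
    unfolding set by simp
  have "spmf (map_spmf (\<lambda>s. B ! s 0 0) (outcome probe_prog s)) True \<le> of_bool (B ! position n m w x t)"
  proof (cases "B ! position n m w x t")
    case False
    then have "True \<notin> set_spmf (map_spmf (\<lambda>s. B ! s 0 0) (outcome probe_prog s))" using g by auto
    then have "spmf (map_spmf (\<lambda>s. B ! s 0 0) (outcome probe_prog s)) True = 0"
      by (simp only: spmf_eq_0_set_spmf simp_thms)
    then show ?thesis using False by simp
  qed (simp add: pmf_le_1)
  then show ?case unfolding eq t_def[symmetric] c by simp
next
  case (Suc v)
  define S where "S = (\<lambda>b. upd (upd (upd s 2 12 (of_bool b)) 2 10 (2 * s 2 10 + of_bool b)) 2 11 (2 * s 2 11))"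
  define t where "t = s 2 10"
  let ?G = "\<lambda>a b. {t'. a \<le> t' \<and> t' < b \<and> B ! position n m w x t'}"
  have "s 2 11 < s 2 1" using toss_inv_less[OF Suc(2)] by simp
  moreover have "outcome (Seq (Toss 2 (Const 12)) (Seq (Assign 10 (Bin Plus (Bin Times (Const 2) (Var 10)) (Var 12)))
      (Assign 11 (Bin Times (Const 2) (Var 11))))) s = map_spmf S coin_spmf"
    by (simp add: outcome_seq outcome_toss bind_map_spmf o_def map_spmf_conv_bind_spmf upd_apply S_def)
  ultimately have "outcome toss_loop s = bind_spmf coin_spmf (\<lambda>b. outcome toss_loop (S b))"
    unfolding toss_loop_def by (subst outcome_while) (simp add: bind_map_spmf o_def)
  then have "outcome (Seq toss_loop probe_prog) s = bind_spmf coin_spmf (\<lambda>b. outcome (Seq toss_loop probe_prog) (S b))"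
    by (simp add: outcome_seq)
  then have "spmf (map_spmf (\<lambda>s. B ! s 0 0) (outcome (Seq toss_loop probe_prog) s)) True =
    (spmf (map_spmf (\<lambda>s. B ! s 0 0) (outcome (Seq toss_loop probe_prog) (S True))) True +
     spmf (map_spmf (\<lambda>s. B ! s 0 0) (outcome (Seq toss_loop probe_prog) (S False))) True) / 2"
    by (simp add: map_spmf_bind_spmf spmf_bind_coin o_def)
  moreover have "spmf (map_spmf (\<lambda>s. B ! s 0 0) (outcome (Seq toss_loop probe_prog) (S b))) True
    \<le> card (?G ((2 * t + of_bool b) * 2 ^ v) (Suc (2 * t + of_bool b) * 2 ^ v)) / 2 ^ v" for b
  proof -
    have "toss_inv v (S b)" unfolding S_def by (rule toss_inv_Suc[OF Suc(2)])
    moreover have "S b 2 10 = 2 * t + of_bool b" by (simp add: S_def t_def upd_apply)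
    ultimately show ?thesis using Suc.IH[of "S b"] by simp
  qed
  from this[of True] this[of False]
  have "spmf (map_spmf (\<lambda>s. B ! s 0 0) (outcome (Seq toss_loop probe_prog) (S True))) True
      \<le> card (?G ((2 * t + 1) * 2 ^ v) (Suc (2 * t + 1) * 2 ^ v)) / 2 ^ v"
    "spmf (map_spmf (\<lambda>s. B ! s 0 0) (outcome (Seq toss_loop probe_prog) (S False))) True
      \<le> card (?G ((2 * t) * 2 ^ v) (Suc (2 * t) * 2 ^ v)) / 2 ^ v"
    by simp_all
  moreover have "card (?G a c) = card (?G a b) + card (?G b c)" if "a \<le> b" "b \<le> c" for a b c
  proof -
    have fin: "finite (?G a' b')" for a' b' by (rule finite_subset[of _ "{..<b'}"]) auto
    have "?G a c = ?G a b \<union> ?G b c" using that by auto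
    then have "card (?G a c) = card (?G a b \<union> ?G b c)" by (rule arg_cong)
    also have "\<dots> = card (?G a b) + card (?G b c)"
    proof (rule card_Un_disjoint[OF fin fin])
      show "?G a b \<inter> ?G b c = {}" using that by fastforce
    qed
    finally show ?thesis .
  qed
  from this[of "2 * t * 2 ^ v" "(2 * t + 1) * 2 ^ v" "Suc (2 * t + 1) * 2 ^ v"]
  have "card (?G (2 * t * 2 ^ v) (Suc (2 * t + 1) * 2 ^ v)) =
    card (?G (2 * t * 2 ^ v) ((2 * t + 1) * 2 ^ v)) + card (?G ((2 * t + 1) * 2 ^ v) (Suc (2 * t + 1) * 2 ^ v))"
    by (simp only: mult_le_mono1 le_add1 Suc_eq_plus1)
  moreover have "t * 2 ^ Suc v = 2 * t * 2 ^ v" "Suc t * 2 ^ Suc v = Suc (2 * t + 1) * 2 ^ v" by simp_all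
  ultimately show ?case unfolding t_def[symmetric]
    by (simp only: Suc_eq_plus1 of_nat_add power_Suc) (simp add: field_simps)
qed

text \<open>Initially the prefix is \<open>0\<close> and all tosses are to come, so the block
  consists of all trials. \<open>toss_inv\<close> leaves the prefix open up to its range; hence the
  extra condition \<open>s 2 10 = 0\<close>.\<close>

lemma pos_probability:
  "spmf (map_spmf (\<lambda>s. B ! s 0 0) (outcome pos_prog s0)) True
    \<le> card {t. t < trials m \<and> B ! position n m w x t} / trials m"
  unfolding pos_prog_def
proof (rule map_outcome_seq_le[OF runs_setup_query], assumption, simp,
    rule map_outcome_seq_le[OF runs_decode], assumption, simp,
    rule map_outcome_seq_le[where Q = "\<lambda>s. toss_inv (LEAST j. m ^ R < 2 ^ (2 ^ j)) s \<and> s 2 10 = 0"])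
  fix s' :: mem assume "state s' \<and> s' 2 8 = w"
  then show "runs_in (query_time m) (Seq (Assign 10 (Const 0)) (Assign 11 (Const 1))) s'
    (\<lambda>s. toss_inv (LEAST j. m ^ R < 2 ^ (2 ^ j)) s \<and> s 2 10 = 0)"
    using len_le_three by (intro runs_in_loopfree[OF _ _ width_le_query_time])
      (auto simp: toss_inv_def state_def upd_apply trials_def intro!: mem_bounded_upd exI[of _ 0])
next
  fix s assume "toss_inv (LEAST j. m ^ R < 2 ^ (2 ^ j)) s \<and> s 2 10 = 0"
  then show "spmf (map_spmf (\<lambda>s. B ! s 0 0) (outcome (Seq toss_loop probe_prog) s)) True
    \<le> card {t. t < trials m \<and> B ! position n m w x t} / trials m"
    using toss_probability[of "LEAST j. m ^ R < 2 ^ (2 ^ j)" s] by (simp add: trials_def)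
qed simp

end

end

section \<open>Properties of the scheme for arbitrary valid codes\<close>

context params
begin

context
  fixes n m x :: nat and A :: "nat set" and C B :: "bool list"
  assumes n: "1 \<le> n" "n \<le> m" and A: "A \<in> storable n m" and x: "x \<in> {1..m}"
    and code: "valid_code n m A C B"
begin

lemmas query_facts = n A x code refl refl

lemma query_outcome:
  assumes "s \<in> set_spmf (outcome pos_prog (query_input n m C x))"
  shows "\<exists>t<trials m. s 0 0 = position n m (cached_seed C) x t \<and> s 0 1 = position n m (cached_seed C) x t"
  by (rule runs_in_outcome[OF runs_pos[OF query_facts] assms])

lemma probes_valid_code: "probes_valid pos_prog n m (C, B) x"
  unfolding probes_valid_def
proof (clarify)
  fix s t assume st: "(s, t) \<in> set_spmf (exec pos_prog (query_input n m C x))"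
  then have "fst (s, t) \<in> set_spmf (outcome pos_prog (query_input n m C x))"
    unfolding outcome_def set_map_spmf by (rule imageI)
  then obtain t' where "t' < trials m" "s 0 0 = position n m (cached_seed C) x t'" "s 0 1 = position n m (cached_seed C) x t'"
    using query_outcome[of s] by auto
  then show "s 0 0 < length B \<and> s 0 1 < length B"
    using position_bounds(2)[OF n(1), of t' m "cached_seed C" x] storage_bits(1)[OF query_facts] by simp
qed

lemma lossless_query: "lossless_spmf (query pos_prog ans_prog n m (C, B) x)"
  unfolding query_eq using runs_in_lossless[OF runs_pos[OF query_facts]] by simp

lemma query_member:
  assumes "x \<in> A"
  shows "spmf (query pos_prog ans_prog n m (C, B) x) True = 1"
proof -
  have "B ! s 0 0 = True" if s: "s \<in> set_spmf (outcome pos_prog (query_input n m C x))" for s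
  proof -
    obtain t where t: "t < trials m" "s 0 0 = position n m (cached_seed C) x t"
      using query_outcome[OF s] by auto
    then show ?thesis
      using storage_bits(2)[OF query_facts, of "s 0 0"] position_bounds[OF n(1) t(1), of "cached_seed C" x]
        storage_bits(1)[OF query_facts] assms by auto
  qed
  then have "map_spmf (\<lambda>s. B ! s 0 0) (outcome pos_prog (query_input n m C x)) =
    map_spmf (\<lambda>s. True) (outcome pos_prog (query_input n m C x))"
    by (intro map_spmf_cong) auto
  then show ?thesis
    unfolding query_eq using runs_in_lossless[OF runs_pos[OF query_facts]]
    by (simp add: map_spmf_conv_bind_spmf bind_spmf_const lossless_weight_spmfD)
qed

lemma query_nonmember:
  fixes \<epsilon> :: real
  assumes "x \<notin> A" and \<epsilon>: "\<epsilon> > 0" "D \<le> \<epsilon> * R"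
  shows "spmf (query pos_prog ans_prog n m (C, B) x) True < \<epsilon>"
proof -
  \<comment> \<open>All positions are at least \<open>n\<close>, where a bit of \<open>B\<close> is
    set exactly if a member marks it.\<close>
  have "{t. t < trials m \<and> B ! position n m (cached_seed C) x t} =
    {t. t < trials m \<and> (\<exists>a\<in>A. \<exists>t'<trials m. position n m (cached_seed C) x t = position n m (cached_seed C) a t')}"
    using storage_bits[OF query_facts] position_bounds[OF n(1), of _ m "cached_seed C" x] by auto
  then show ?thesis
    unfolding query_eq
    using pos_probability[OF query_facts] error_bound[OF A x assms(1) cached_seed_good(1)[OF query_facts] \<epsilon>] by simp
qed

lemma query_runs_within:
  "runs_within pos_prog (query_input n m C x) (real (time_factor pos_prog * query_time m))"
  by (rule runs_within_runs[OF runs_pos[OF query_facts, unfolded runs_in_def]]) simp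

end

lemma valid_encodings:
  assumes "1 \<le> n" "n \<le> m" "A \<in> storable n m" "(C, B) \<in> encodings encode_prog n m A"
  shows "valid_code n m A C B"
  using runs_encode[OF assms(1-3) refl refl refl] assms(4)
  unfolding runs_in_def runs_def encodings_def by fastforce

lemma encode_complexity:
  assumes "1 \<le> n" "n \<le> m" "A \<in> storable n m"
  shows "lossless_spmf (exec encode_prog (encoder_input n m A))"
    "expected_time encode_prog (encoder_input n m A) \<le> of_nat (time_factor encode_prog * encode_time n m)"
proof -
  note r = runs_encode[OF assms refl refl refl, unfolded runs_in_def]
  show "lossless_spmf (exec encode_prog (encoder_input n m A))" using r by (simp add: runs_def)
  show "expected_time encode_prog (encoder_input n m A) \<le> of_nat (time_factor encode_prog * encode_time n m)"
    by (rule expected_time_runs[OF r])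
qed

end

section \<open>Polynomial bounds\<close>

lemma poly2_simps [simp]:
  "poly2 (p + q) x y = poly2 p x y + poly2 q x y"
  "poly2 (p * q) x y = poly2 p x y * poly2 q x y"
  "poly2 (p ^ k) x y = poly2 p x y ^ k"
  "poly2 [:r:] x y = poly r y"
  "poly2 [:0, 1:] x y = x"
  "poly2 1 x y = 1"
  "poly2 (numeral a) x y = numeral a"
  by (simp_all add: poly2_def)

context params
begin

definition trials_poly :: "real poly" where "trials_poly = [:1, 2 * real R:]"
definition modulus_poly :: "real poly" where "modulus_poly = 16 * trials_poly\<^sup>2 + 1"
definition width_poly :: "real poly" where
  "width_poly = [:real (D + 3):] * (20 * trials_poly + 3 * modulus_poly\<^sup>2 + 20)"
text \<open>\<open>[:0, 1:]\<close> stands for \<open>n\<close>, and the coefficients are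
  polynomials in \<open>log 2 m\<close>. The 8 comes from \<open>side n <= 2 * n\<close>.\<close>

definition base_poly :: "real poly poly" where
  "base_poly = 16 * (8 * [:0, 1:]\<^sup>2 + [:0, 1:]\<^sup>2 * [:trials_poly:] + 1)\<^sup>2 + 1"
definition encode_poly :: "real poly poly" where
  "encode_poly = (base_poly ^ (D + 2) * ([:0, 1:] + 1) * [:trials_poly:] * [:modulus_poly:] + [:width_poly:] + 1) * [:width_poly:]"
definition query_poly :: "real poly" where
  "query_poly = (modulus_poly + width_poly + 1) * width_poly"

lemma trials_poly: "1 \<le> m \<Longrightarrow> real (trials m) \<le> poly trials_poly (log 2 (real m))"
  using trials_le[of m] by (simp add: trials_poly_def mult_ac)

lemma modulus_poly: "1 \<le> m \<Longrightarrow> real (modulus m) \<le> poly modulus_poly (log 2 (real m))"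
proof -
  assume m: "1 \<le> m"
  have "real (modulus m) \<le> real (16 * (trials m)\<^sup>2 + 1)" by (intro of_nat_mono modulus_le)
  also have "\<dots> = 16 * (real (trials m))\<^sup>2 + 1" by simp
  also have "\<dots> \<le> 16 * (poly trials_poly (log 2 (real m)))\<^sup>2 + 1"
    using trials_poly[OF m] by (intro add_mono mult_left_mono power_mono) auto
  finally show ?thesis by (simp add: modulus_poly_def)
qed

lemma width_poly: "1 \<le> m \<Longrightarrow> real (width m) \<le> poly width_poly (log 2 (real m))"
proof -
  assume m: "1 \<le> m"
  have "real (width m) = real (D + 3) * (20 * real (trials m) + 3 * (real (modulus m))\<^sup>2 + 20)"
    by (simp add: width_def)
  also have "\<dots> \<le> real (D + 3) * (20 * poly trials_poly (log 2 (real m)) + 3 * (poly modulus_poly (log 2 (real m)))\<^sup>2 + 20)"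
    using trials_poly[OF m] modulus_poly[OF m] by (intro add_mono mult_left_mono power_mono) auto
  finally show ?thesis by (simp add: width_poly_def)
qed

lemma query_poly: "1 \<le> m \<Longrightarrow> real (query_time m) \<le> poly query_poly (log 2 (real m))"
proof -
  assume m: "1 \<le> m"
  have "real (query_time m) = (real (modulus m) + real (width m) + 1) * real (width m)"
    by (simp add: query_time_def algebra_simps)
  also have "\<dots> \<le> poly query_poly (log 2 (real m))"
    unfolding query_poly_def poly_add poly_mult poly_1
    using modulus_poly[OF m] width_poly[OF m] by (intro add_mono mult_mono) (auto intro: order_trans[of 0 "real _"] add_nonneg_nonneg)
  finally show ?thesis .
qed

lemma base_poly:
  assumes "1 \<le> n" "1 \<le> m"
  shows "real (seed_base n m) \<le> poly2 base_poly (real n) (log 2 (real m))"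
proof -
  have "bins n \<le> 8 * n\<^sup>2" using side_le[OF assms(1)] by (simp add: bins_def power2_eq_square)
  then have "real (bins n) \<le> real (8 * n\<^sup>2)" by (intro of_nat_mono)
  then have b: "real (bins n) \<le> 8 * (real n)\<^sup>2" by simp
  have "real (seed_base n m) = 16 * (real (bins n) + (real n)\<^sup>2 * real (trials m) + 1)\<^sup>2 + 1"
    by (simp add: seed_base_def add_ac)
  also have "\<dots> \<le> 16 * (8 * (real n)\<^sup>2 + (real n)\<^sup>2 * poly trials_poly (log 2 (real m)) + 1)\<^sup>2 + 1"
    using b trials_poly[OF assms(2)] by (intro add_mono mult_left_mono power_mono) auto
  finally show ?thesis unfolding base_poly_def poly2_simps .
qed

lemma encode_poly:
  assumes "1 \<le> n" "1 \<le> m"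
  shows "real (encode_time n m) \<le> poly2 encode_poly (real n) (log 2 (real m))"
proof -
  note le = trials_poly[OF assms(2)] modulus_poly[OF assms(2)] width_poly[OF assms(2)] base_poly[OF assms]
  have nonneg: "0 \<le> poly trials_poly (log 2 (real m))" "0 \<le> poly modulus_poly (log 2 (real m))"
    "0 \<le> poly width_poly (log 2 (real m))" "0 \<le> poly2 base_poly (real n) (log 2 (real m))"
    using le by (auto intro: order_trans[OF of_nat_0_le_iff])
  have "real (encode_time n m) =
      (real (seed_base n m) ^ (D + 2) * (real n + 1) * real (trials m) * real (modulus m) + real (width m) + 1) * real (width m)"
    by (simp add: encode_time_def seeds_def algebra_simps)
  also have "\<dots> \<le> (poly2 base_poly (real n) (log 2 (real m)) ^ (D + 2) * (real n + 1) * poly trials_poly (log 2 (real m)) *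
      poly modulus_poly (log 2 (real m)) + poly width_poly (log 2 (real m)) + 1) * poly width_poly (log 2 (real m))"
    using le nonneg by (intro add_mono mult_mono power_mono) auto
  finally show ?thesis unfolding encode_poly_def poly2_simps .
qed

text \<open>The summand 1 pays for the first \<open>n\<close> bits. In \<open>8 = 4 * 2\<close>, the
  4 is that of \<open>bins\<close> and the 2 is lost when \<open>side n\<close> is rounded to a
  power of two.\<close>

lemma storage_bound:
  fixes \<delta> :: real
  assumes "1 \<le> n" "1 \<le> m" and \<delta>: "1 \<le> \<delta> * D"
  shows "real (n + bins n * trials m * modulus m) \<le>
    real n powr (1 + \<delta>) * poly (1 + 8 * trials_poly * modulus_poly) (log 2 (real m))"
proof -
  have d: "1 / real D \<le> \<delta>" using \<delta> D by (simp add: field_simps)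
  have "0 \<le> 1 / real D" by simp
  then have d0: "0 \<le> \<delta>" using d by (rule order_trans)
  let ?p = "real n powr (1 + \<delta>)"
  have "real n = real n powr 1" using assms(1) by simp
  also have "\<dots> \<le> ?p" using assms(1) d d0 by (intro powr_mono) auto
  finally have 1: "real n \<le> ?p" .
  have "real (bins n) = 4 * real n * real (side n)" by (simp add: bins_def)
  also have "\<dots> \<le> 4 * real n * (2 * real n powr (1 / D))"
    using side_le_powr[OF assms(1)] by (intro mult_left_mono) auto
  also have "\<dots> = 8 * real n powr (1 + 1 / D)" using assms(1) by (simp add: powr_add)
  also have "\<dots> \<le> 8 * ?p" using assms(1) d d0 by (intro mult_left_mono powr_mono) auto
  finally have 2: "real (bins n) \<le> 8 * ?p" .
  have "real (n + bins n * trials m * modulus m) = real n + real (bins n) * real (trials m) * real (modulus m)" by simp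
  also have "\<dots> \<le> ?p + 8 * ?p * poly trials_poly (log 2 (real m)) * poly modulus_poly (log 2 (real m))"
    using 1 2 trials_poly[OF assms(2)] modulus_poly[OF assms(2)]
    by (intro add_mono mult_mono) (auto intro: order_trans[OF of_nat_0_le_iff])
  also have "\<dots> = ?p * poly (1 + 8 * trials_poly * modulus_poly) (log 2 (real m))"
    by (simp add: algebra_simps)
  finally show ?thesis .
qed

end

theorem theorem6:
  fixes \<epsilon> \<delta> :: real
  assumes "\<epsilon> > 0" and "\<delta> > 0"
  shows "\<exists>enc pos ans :: prog. \<exists>pB pC pQ :: real poly. \<exists>pE :: real poly poly.
    \<forall>n m :: nat. 1 \<le> n \<longrightarrow> n \<le> m \<longrightarrow>
      (\<forall>A \<in> storable n m.
         lossless_spmf (exec enc (encoder_input n m A)) \<and>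
         expected_time enc (encoder_input n m A) \<le> ennreal (poly2 pE (real n) (log 2 (real m)))) \<and>
      (\<forall>store. (\<forall>A \<in> storable n m. store A \<in> encodings enc n m A) \<longrightarrow>
         one_sided_scheme \<epsilon> n m pos ans store \<and>
         (\<forall>A \<in> storable n m. \<forall>C B. store A = (C, B) \<longrightarrow>
            real (length B) \<le> real n powr (1 + \<delta>) * poly pB (log 2 (real m)) \<and>
            real (length C) \<le> poly pC (log 2 (real m)) \<and>
            (\<forall>x \<in> {1..m}. runs_within pos (query_input n m C x) (poly pQ (log 2 (real m))))))"
proof -
  \<comment> \<open>\<open>1 / D <= \<delta>\<close> keeps the excess \<open>n powr (1 / D)\<close>
    of the buckets below \<open>n powr \<delta>\<close>, and \<open>D / \<epsilon> <= R\<close> is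
    what the error bound asks for. Both depend on the constants only, so the programs are the same
    for all \<open>n\<close> and \<open>m\<close>.\<close>
  define D where "D = max 2 (nat \<lceil>1 / \<delta>\<rceil>)"
  define R where "R = max 1 (nat \<lceil>D / \<epsilon>\<rceil>)"
  interpret params D R by unfold_locales (simp_all add: D_def R_def)
  have "1 / \<delta> \<le> real D" unfolding D_def by linarith
  then have \<delta>: "1 \<le> \<delta> * D" using assms(2) by (simp add: field_simps)
  have "D / \<epsilon> \<le> real R" unfolding R_def by linarith
  then have \<epsilon>: "real D \<le> \<epsilon> * R" using assms(1) by (simp add: field_simps)
  show ?thesis
  proof (intro exI allI impI conjI ballI)
    fix n m A assume nm: "1 \<le> n" "n \<le> m" and A: "A \<in> storable n m"
    then have m: "1 \<le> m" by simp
    show "lossless_spmf (exec encode_prog (encoder_input n m A))" by (rule encode_complexity(1)[OF nm A])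
    have "real (time_factor encode_prog * encode_time n m) \<le>
        poly2 ([:[:real (time_factor encode_prog):]:] * encode_poly) (real n) (log 2 (real m))"
      unfolding poly2_simps using encode_poly[OF nm(1) m] by (simp add: mult_left_mono)
    then have "ennreal (real (time_factor encode_prog * encode_time n m)) \<le>
        ennreal (poly2 ([:[:real (time_factor encode_prog):]:] * encode_poly) (real n) (log 2 (real m)))"
      by (rule ennreal_leI)
    then show "expected_time encode_prog (encoder_input n m A) \<le>
        ennreal (poly2 ([:[:real (time_factor encode_prog):]:] * encode_poly) (real n) (log 2 (real m)))"
      using encode_complexity(2)[OF nm A] by (simp only: ennreal_of_nat_eq_real_of_nat)
  next
    fix n m store assume nm: "1 \<le> n" "n \<le> m" and store: "\<forall>A \<in> storable n m. store A \<in> encodings encode_prog n m A"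
    \<comment> \<open>Every possible result of the encoder is a valid code, so it does not matter
      which one \<open>store\<close> selects.\<close>
    have code: "valid_code n m A (fst (store A)) (snd (store A))" if "A \<in> storable n m" for A
      using store that by (intro valid_encodings[OF nm that]) auto
    show "one_sided_scheme \<epsilon> n m pos_prog ans_prog store"
      unfolding one_sided_scheme_def
    proof (intro ballI conjI impI)
      fix A x assume A: "A \<in> storable n m" and x: "x \<in> {1..m}"
      have eq: "store A = (fst (store A), snd (store A))" by simp
      show "probes_valid pos_prog n m (store A) x"
        by (subst eq) (rule probes_valid_code[OF nm A x code[OF A]])
      show "lossless_spmf (query pos_prog ans_prog n m (store A) x)"
        by (subst eq) (rule lossless_query[OF nm A x code[OF A]])
      show "spmf (query pos_prog ans_prog n m (store A) x) True = 1" if "x \<in> A"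
        by (subst eq) (rule query_member[OF nm A x code[OF A] that])
      show "spmf (query pos_prog ans_prog n m (store A) x) True < \<epsilon>" if "x \<notin> A"
        by (subst eq) (rule query_nonmember[OF nm A x code[OF A] that assms(1) \<epsilon>])
    qed
    fix A C B assume A: "A \<in> storable n m" and CB: "store A = (C, B)"
    have m: "1 \<le> m" using nm by simp
    have v: "valid_code n m A C B" using code[OF A] CB by simp
    show "real (length B) \<le> real n powr (1 + \<delta>) * poly (1 + 8 * trials_poly * modulus_poly) (log 2 (real m))"
      using v storage_bound[OF nm(1) m \<delta>] unfolding valid_code_def by simp
    have "length C \<le> width m + 2" using v unfolding valid_code_def by simp
    then show "real (length C) \<le> poly (width_poly + 2) (log 2 (real m))"
      using width_poly[OF m] by simp
    fix x assume x: "x \<in> {1..m}"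
    have "real (time_factor pos_prog * query_time m) \<le> poly ([:real (time_factor pos_prog):] * query_poly) (log 2 (real m))"
      using query_poly[OF m] by (simp add: mult_left_mono)
    then show "runs_within pos_prog (query_input n m C x) (poly ([:real (time_factor pos_prog):] * query_poly) (log 2 (real m)))"
      using query_runs_within[OF nm A x v] unfolding runs_within_def by fastforce
  qed
qed

end
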